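(* Let $m,n$ be positive integers. If $m\neq n$ then the homomorphism $\pi_*\colon\operatorname{Aut}(X_{m,n})\to\operatorname{Aut}(T_{m,n})$ is continuous and injective.
   Context: The complex $X_{m,n}$. For positive integers $m,n$ let $k=\gcd(m,n)$. Let $Z_{m,n}$ be the 2-complex with one vertex, 1-cells $a,t_0,\dots,t_{k-1}$, and $k$ 2-cells attached along the words $t_i a^{m/k}t_{i+1}^{-1}a^{-n/k}$ (indices modulo $k$). $X_{m,n}$ is its universal cover with the induced cell structure. The tree and the projection. Lifts of $a$ are horizontal 1-cells; lifts of the $t_i$ are vertical 1-cells, directed "upward" as the $t_i$. The connected components of the union of the horizontal 1-cells are lines, called branching lines. The closures of the components of the complement of the branching lines are strips, homeomorphic to $\mathbb{R}\times[0,1]$, each joining a lower branching line to an upper one. $T_{m,n}$ is the directed tree whose vertices are the branching lines and whose edges are the strips, directed upward; every vertex has $m$ incoming and $n$ outgoing edges. $X_{m,n}$ is homeomorphic to $T_{m,n}\times\mathbb{R}$ and $\pi\colon X_{m,n}\to T_{m,n}$ is the projection, with $\pi^{-1}(\text{vertex})$ the branching line and $\pi^{-1}(\text{closed edge})$ the strip. When $(m,n)\neq(1,1)$, $\operatorname{Aut}(X_{m,n})$ preserves the families of branching lines and strips, so $\pi$ induces a homomorphism $\pi_*\colon\operatorname{Aut}(X_{m,n})\to\operatorname{Aut}(T_{m,n})$. Automorphism groups. For a CW complex $X$ (in particular for a tree), $\operatorname{Aut}(X)$ is the group of cell-structure-preserving homeomorphisms modulo those inducing the identity permutation on the set of cells,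 with the topology generated by the sets $\{f\mid f(\sigma)=\tau\}$ for cells $\sigma,\tau$. *)

theory Defs
  imports "HOL-Analysis.Analysis" "HOL-Algebra.Coset" "HOL-Algebra.Bij"
begin

section \<open>Weak topologies and universal covers\<close>

text \<open>The final topology on \<open>P\<close> with respect to characteristic maps \<open>\<phi> c : D c \<rightarrow> P\<close>, i.e. the
  topology of a CW complex.\<close>

definition weak_topology ::
  "'p set \<Rightarrow> 'c set \<Rightarrow> ('c \<Rightarrow> 'e::topological_space set) \<Rightarrow> ('c \<Rightarrow> 'e \<Rightarrow> 'p) \<Rightarrow> 'p topology" where
  "weak_topology P I D \<phi> =
     topology (\<lambda>U. U \<subseteq> P \<and> (\<forall>c\<in>I. openin (top_of_set (D c)) {u \<in> D c. \<phi> c u \<in> U}))"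

lemma openin_weak_topology:
  "openin (weak_topology P I D \<phi>) U \<longleftrightarrow>
     U \<subseteq> P \<and> (\<forall>c\<in>I. openin (top_of_set (D c)) {u \<in> D c. \<phi> c u \<in> U})"
proof -
  have "istopology (\<lambda>U. U \<subseteq> P \<and> (\<forall>c\<in>I. openin (top_of_set (D c)) {u \<in> D c. \<phi> c u \<in> U}))"
    unfolding istopology_def
  proof (intro conjI allI impI ballI)
    fix S T c
    assume S: "S \<subseteq> P \<and> (\<forall>c\<in>I. openin (top_of_set (D c)) {u \<in> D c. \<phi> c u \<in> S})"
      and T: "T \<subseteq> P \<and> (\<forall>c\<in>I. openin (top_of_set (D c)) {u \<in> D c. \<phi> c u \<in> T})"
      and c: "c \<in> I"
    have "{u \<in> D c. \<phi> c u \<in> S \<inter> T} = {u \<in> D c. \<phi> c u \<in> S} \<inter> {u \<in> D c. \<phi> c u \<in> T}" by auto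
    then show "openin (top_of_set (D c)) {u \<in> D c. \<phi> c u \<in> S \<inter> T}"
      using S T c by (simp add: openin_Int)
  next
    fix K c
    assume K: "\<forall>U\<in>K. U \<subseteq> P \<and> (\<forall>c\<in>I. openin (top_of_set (D c)) {u \<in> D c. \<phi> c u \<in> U})"
      and c: "c \<in> I"
    have "{u \<in> D c. \<phi> c u \<in> \<Union>K} = (\<Union>U\<in>K. {u \<in> D c. \<phi> c u \<in> U})" by auto
    then show "openin (top_of_set (D c)) {u \<in> D c. \<phi> c u \<in> \<Union>K}"
      using K c by auto
  qed blast+
  then show ?thesis
    by (simp add: weak_topology_def)
qed

text \<open>The notion of the library's constant \<^const>\<open>covering_space\<close>, for abstract topologies.\<close>

definition covering_map :: "'a topology \<Rightarrow> ('a \<Rightarrow> 'b) \<Rightarrow> 'b topology \<Rightarrow> bool" where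
  "covering_map X p Y \<longleftrightarrow>
     continuous_map X Y p \<and> p ` topspace X = topspace Y \<and>
     (\<forall>y\<in>topspace Y. \<exists>U. y \<in> U \<and> openin Y U \<and>
        (\<exists>\<V>. \<Union>\<V> = {x \<in> topspace X. p x \<in> U} \<and>
             (\<forall>V\<in>\<V>. openin X V) \<and> pairwise disjnt \<V> \<and>
             (\<forall>V\<in>\<V>. homeomorphic_map (subtopology X V) (subtopology Y U) p)))"

definition simply_connected_space :: "'a topology \<Rightarrow> bool" where
  "simply_connected_space X \<longleftrightarrow>
     path_connected_space X \<and>
     (\<forall>g. pathin X g \<and> g 1 = g 0 \<longrightarrow>
        homotopic_with (\<lambda>r. r 0 = g 0 \<and> r 1 = g 0) (top_of_set {0..1}) X g (\<lambda>_. g 0))"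

definition universal_covering :: "'a topology \<Rightarrow> ('a \<Rightarrow> 'b) \<Rightarrow> 'b topology \<Rightarrow> bool" where
  "universal_covering X p Y \<longleftrightarrow> covering_map X p Y \<and> simply_connected_space X"


section \<open>Automorphism groups of CW complexes\<close>

text \<open>A complex is given by its space \<open>X\<close> and the set \<open>C\<close> of its open cells, as subsets of \<open>X\<close>.
  Following \<^const>\<open>BijGroup\<close>, self-maps of \<open>X\<close> are extensional functions.\<close>

definition cell_homeos :: "'a topology \<Rightarrow> 'a set set \<Rightarrow> ('a \<Rightarrow> 'a) set" where
  "cell_homeos X C =
     {f \<in> Bij (topspace X). homeomorphic_map X X f \<and> (\<lambda>\<sigma>. f ` \<sigma>) ` C = C}"

definition cell_trivial_homeos :: "'a topology \<Rightarrow> 'a set set \<Rightarrow> ('a \<Rightarrow> 'a) set" where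
  "cell_trivial_homeos X C = {f \<in> cell_homeos X C. \<forall>\<sigma>\<in>C. f ` \<sigma> = \<sigma>}"

definition Aut_complex :: "'a topology \<Rightarrow> 'a set set \<Rightarrow> ('a \<Rightarrow> 'a) set monoid" where
  "Aut_complex X C =
     (BijGroup (topspace X))\<lparr>carrier := cell_homeos X C\<rparr> Mod cell_trivial_homeos X C"

text \<open>An element of the automorphism group is a coset \<open>F\<close>, all of whose members induce the same
  permutation of the cells.\<close>

definition Aut_topology :: "'a topology \<Rightarrow> 'a set set \<Rightarrow> ('a \<Rightarrow> 'a) set topology" where
  "Aut_topology X C =
     topology_generated_by
       {{F \<in> carrier (Aut_complex X C). \<exists>f\<in>F. f ` \<sigma> = \<tau>} |\<sigma> \<tau>. \<sigma> \<in> C \<and> \<tau> \<in> C}"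


section \<open>The complex \<open>Z\<^sub>m\<^sub>,\<^sub>n\<close>\<close>

datatype zcell = ZVertex | ZHor | ZVert nat | ZFace nat

definition zcells :: "nat \<Rightarrow> nat \<Rightarrow> zcell set" where
  "zcells m n = {ZVertex, ZHor} \<union> ZVert ` {..<gcd m n} \<union> ZFace ` {..<gcd m n}"

fun closed_dom :: "zcell \<Rightarrow> (real \<times> real) set" where
  "closed_dom ZVertex = {(0, 0)}"
| "closed_dom ZHor = {0..1} \<times> {0}"
| "closed_dom (ZVert i) = {0} \<times> {0..1}"
| "closed_dom (ZFace i) = {0..1} \<times> {0..1}"

fun open_dom :: "zcell \<Rightarrow> (real \<times> real) set" where
  "open_dom ZVertex = {(0, 0)}"
| "open_dom ZHor = {0<..<1} \<times> {0}"
| "open_dom (ZVert i) = {0} \<times> {0<..<1}"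
| "open_dom (ZFace i) = {0<..<1} \<times> {0<..<1}"

text \<open>As a set, the complex is the disjoint union of its open cells: a point is a cell together
  with coordinates in the interior of the model cell.\<close>

type_synonym zpoint = "zcell \<times> real \<times> real"

definition zopen_cell :: "zcell \<Rightarrow> zpoint set" where
  "zopen_cell c = {c} \<times> open_dom c"

text \<open>The path running around the loop \<open>a\<close> once per unit of time, and the loop \<open>t\<^sub>i\<close>.\<close>

definition a_path :: "real \<Rightarrow> zpoint" where
  "a_path x = (if x \<in> \<int> then (ZVertex, 0, 0) else (ZHor, frac x, 0))"

definition t_path :: "nat \<Rightarrow> real \<Rightarrow> zpoint" where
  "t_path i y = (if y = 0 \<or> y = 1 then (ZVertex, 0, 0) else (ZVert i, 0, y))"

text \<open>Characteristic maps. The model 2-cell is the unit square; read clockwise from the origin, its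
  boundary (left side, top, right side, bottom) spells
  \<open>t\<^sub>i a\<^bsup>m/k\<^esup> t\<^sub>i\<^sub>+\<^sub>1\<^bsup>-1\<^esup> a\<^bsup>-n/k\<^esup>\<close>, where \<open>k = gcd m n\<close>.\<close>

fun zchar :: "nat \<Rightarrow> nat \<Rightarrow> zcell \<Rightarrow> real \<times> real \<Rightarrow> zpoint" where
  "zchar m n ZVertex (x, y) = (ZVertex, 0, 0)"
| "zchar m n ZHor (x, y) = a_path x"
| "zchar m n (ZVert i) (x, y) = t_path i y"
| "zchar m n (ZFace i) (x, y) =
     (if y = 0 then a_path (real (n div gcd m n) * x)
      else if y = 1 then a_path (real (m div gcd m n) * x)
      else if x = 0 then t_path i y
      else if x = 1 then t_path (Suc i mod gcd m n) y
      else (ZFace i, x, y))"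

definition Z_complex :: "nat \<Rightarrow> nat \<Rightarrow> zpoint topology" where
  "Z_complex m n =
     weak_topology (\<Union>c\<in>zcells m n. zopen_cell c) (zcells m n) closed_dom (zchar m n)"


section \<open>The cell structure of the universal cover\<close>

text \<open>In the following \<open>p : X \<rightarrow> Z\<^sub>m\<^sub>,\<^sub>n\<close> is a universal covering. The characteristic maps of the induced
  cell structure on \<open>X\<close> are the lifts of those of \<open>Z\<^sub>m\<^sub>,\<^sub>n\<close>.\<close>

definition char_lifts ::
  "nat \<Rightarrow> nat \<Rightarrow> 'x topology \<Rightarrow> ('x \<Rightarrow> zpoint) \<Rightarrow> zcell \<Rightarrow> (real \<times> real \<Rightarrow> 'x) set" where
  "char_lifts m n X p c =
     {h. continuous_map (top_of_set (closed_dom c)) X h \<and>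
         (\<forall>u\<in>closed_dom c. p (h u) = zchar m n c u)}"

definition X_cells :: "nat \<Rightarrow> nat \<Rightarrow> 'x topology \<Rightarrow> ('x \<Rightarrow> zpoint) \<Rightarrow> 'x set set" where
  "X_cells m n X p = (\<Union>c\<in>zcells m n. (\<lambda>h. h ` open_dom c) ` char_lifts m n X p c)"

definition horizontal_part :: "nat \<Rightarrow> nat \<Rightarrow> 'x topology \<Rightarrow> ('x \<Rightarrow> zpoint) \<Rightarrow> 'x set" where
  "horizontal_part m n X p = (\<Union>h\<in>char_lifts m n X p ZHor. h ` closed_dom ZHor)"

definition branching_lines :: "nat \<Rightarrow> nat \<Rightarrow> 'x topology \<Rightarrow> ('x \<Rightarrow> zpoint) \<Rightarrow> 'x set set" where
  "branching_lines m n X p =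
     connected_components_of (subtopology X (horizontal_part m n X p))"

definition strips :: "nat \<Rightarrow> nat \<Rightarrow> 'x topology \<Rightarrow> ('x \<Rightarrow> zpoint) \<Rightarrow> 'x set set" where
  "strips m n X p =
     (\<lambda>C. X closure_of C) `
       connected_components_of (subtopology X (topspace X - horizontal_part m n X p))"

text \<open>The lower (upper) branching line of a strip contains the initial (terminal) points of the
  vertical 1-cells in the strip, which are directed as the \<open>t\<^sub>i\<close>.\<close>

definition lower_line :: "nat \<Rightarrow> nat \<Rightarrow> 'x topology \<Rightarrow> ('x \<Rightarrow> zpoint) \<Rightarrow> 'x set \<Rightarrow> 'x set" where
  "lower_line m n X p S =
     (THE L. L \<in> branching_lines m n X p \<and>
        (\<exists>i<gcd m n. \<exists>h\<in>char_lifts m n X p (ZVert i). h ` closed_dom (ZVert i) \<subseteq> S \<and> h (0, 0) \<in> L))"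

definition upper_line :: "nat \<Rightarrow> nat \<Rightarrow> 'x topology \<Rightarrow> ('x \<Rightarrow> zpoint) \<Rightarrow> 'x set \<Rightarrow> 'x set" where
  "upper_line m n X p S =
     (THE L. L \<in> branching_lines m n X p \<and>
        (\<exists>i<gcd m n. \<exists>h\<in>char_lifts m n X p (ZVert i). h ` closed_dom (ZVert i) \<subseteq> S \<and> h (0, 1) \<in> L))"


section \<open>The tree and the projection\<close>

text \<open>The tree as a 1-dimensional CW complex: a point is a vertex, with dummy coordinate \<open>0\<close>, or an
  edge with a coordinate in \<open>(0,1)\<close> increasing in the upward direction.\<close>

datatype 'x tcell = TVertex "'x set" | TEdge "'x set"

type_synonym 'x tpoint = "'x tcell \<times> real"

definition tcells :: "nat \<Rightarrow> nat \<Rightarrow> 'x topology \<Rightarrow> ('x \<Rightarrow> zpoint) \<Rightarrow> 'x tcell set" where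
  "tcells m n X p = TVertex ` branching_lines m n X p \<union> TEdge ` strips m n X p"

fun tclosed_dom :: "'x tcell \<Rightarrow> real set" where
  "tclosed_dom (TVertex L) = {0}"
| "tclosed_dom (TEdge S) = {0..1}"

fun topen_dom :: "'x tcell \<Rightarrow> real set" where
  "topen_dom (TVertex L) = {0}"
| "topen_dom (TEdge S) = {0<..<1}"

fun tchar :: "nat \<Rightarrow> nat \<Rightarrow> 'x topology \<Rightarrow> ('x \<Rightarrow> zpoint) \<Rightarrow> 'x tcell \<Rightarrow> real \<Rightarrow> 'x tpoint" where
  "tchar m n X p (TVertex L) s = (TVertex L, 0)"
| "tchar m n X p (TEdge S) s =
     (if s = 0 then (TVertex (lower_line m n X p S), 0)
      else if s = 1 then (TVertex (upper_line m n X p S), 0)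
      else (TEdge S, s))"

definition topen_cell :: "'x tcell \<Rightarrow> 'x tpoint set" where
  "topen_cell c = {c} \<times> topen_dom c"

definition T_cells :: "nat \<Rightarrow> nat \<Rightarrow> 'x topology \<Rightarrow> ('x \<Rightarrow> zpoint) \<Rightarrow> 'x tpoint set set" where
  "T_cells m n X p = topen_cell ` tcells m n X p"

definition T_complex :: "nat \<Rightarrow> nat \<Rightarrow> 'x topology \<Rightarrow> ('x \<Rightarrow> zpoint) \<Rightarrow> 'x tpoint topology" where
  "T_complex m n X p =
     weak_topology (\<Union>(T_cells m n X p)) (tcells m n X p) tclosed_dom (tchar m n X p)"

text \<open>On a strip the projection is the height function, i.e. the second coordinate of the
  model square (or of the model vertical 1-cell).\<close>

definition tree_proj :: "nat \<Rightarrow> nat \<Rightarrow> 'x topology \<Rightarrow> ('x \<Rightarrow> zpoint) \<Rightarrow> 'x \<Rightarrow> 'x tpoint" where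
  "tree_proj m n X p x =
     (if x \<in> horizontal_part m n X p
      then (TVertex (THE L. L \<in> branching_lines m n X p \<and> x \<in> L), 0)
      else (TEdge (THE S. S \<in> strips m n X p \<and> x \<in> S), snd (snd (p x))))"

abbreviation Aut_X :: "nat \<Rightarrow> nat \<Rightarrow> 'x topology \<Rightarrow> ('x \<Rightarrow> zpoint) \<Rightarrow> ('x \<Rightarrow> 'x) set monoid" where
  "Aut_X m n X p \<equiv> Aut_complex X (X_cells m n X p)"

abbreviation Aut_T ::
  "nat \<Rightarrow> nat \<Rightarrow> 'x topology \<Rightarrow> ('x \<Rightarrow> zpoint) \<Rightarrow> ('x tpoint \<Rightarrow> 'x tpoint) set monoid" where
  "Aut_T m n X p \<equiv> Aut_complex (T_complex m n X p) (T_cells m n X p)"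

text \<open>The class of \<open>f\<close> is sent to the class of those \<open>g\<close> that permute the cells of the tree in the way
  \<open>f\<close> permutes their preimages (the branching lines and the open strips).\<close>

definition pi_star ::
  "nat \<Rightarrow> nat \<Rightarrow> 'x topology \<Rightarrow> ('x \<Rightarrow> zpoint) \<Rightarrow> ('x \<Rightarrow> 'x) set \<Rightarrow> ('x tpoint \<Rightarrow> 'x tpoint) set" where
  "pi_star m n X p F =
     {g \<in> cell_homeos (T_complex m n X p) (T_cells m n X p).
        \<exists>f\<in>F. \<forall>c\<in>T_cells m n X p.
          f ` {x \<in> topspace X. tree_proj m n X p x \<in> c} =
          {x \<in> topspace X. tree_proj m n X p x \<in> g ` c}}"

end

theory Submission
  imports Defs
begin

text \<open>Write \<open>k = gcd m n\<close>. Let \<open>h\<close> be an automorphism fixing every branching line and every strip,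
  and consider a vertical 1-cell from \<open>x\<close> up to \<open>y\<close> in a strip. The vertical 1-cells of the strip are
  spaced \<open>n/k\<close> apart along the lower line and \<open>m/k\<close> along the upper one, so \<open>h\<close> moves \<open>x\<close> by \<open>j n/k\<close> and
  \<open>y\<close> by \<open>j m/k\<close> for the same integer \<open>j\<close>. If \<open>m < n\<close> (\<open>m > n\<close>), going up (down) indefinitely makes
  the displacement decrease strictly until it is \<open>0\<close>; but then it was \<open>0\<close> to begin with. Hence \<open>h\<close> fixes
  all vertices, and then all cells.

  The argument needs that displacements are well-defined, i.e. that the loop \<open>a\<^sup>L\<close> is not
  null-homotopic for \<open>L \<noteq> 0\<close>. On the square, a null-homotopy has a real-valued height, and
  there is a circle-valued map which rotates \<open>\<beta> h\<close> times along a horizontal cell at height \<open>h\<close> as soon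
  as \<open>\<beta> (h + 1) m = \<beta> h n\<close>; only finitely many heights occur, so the \<open>\<beta> h\<close> can be taken to be
  integers.

  Automorphisms preserve the horizontal 1-cells, and hence act on the tree, because a horizontal
  1-cell has \<open>m + n \<ge> 3\<close> adjacent 2-cells and a vertical one only two.\<close>

section \<open>Weak topologies and connected components\<close>

text \<open>The sum of the \<open>k\<close> relations is \<open>(m - n) a = 0\<close> in the first
  homology of the complex, so for \<open>m \<noteq> n\<close> no continuous circle-valued function
  on \<open>Z_complex\<close> turns along \<open>a\<close>. This is why the detecting function has
  to use a real height, which exists only after pulling back to a square, and why its turning
  numbers vary with that height.

  The cover is known only through \<open>universal_covering\<close>. A lift of a characteristic map
  is determined by the lift of the corner \<open>(0, 0)\<close>, which always lies over the single
  vertex; so every cell of the cover has a unique name \<open>(c, x)\<close> with \<open>x\<close> a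
  vertex. The geometry reduces to the bijections \<open>s\<close> and \<open>up i\<close> of the
  vertices, the relation \<open>up_sh_step\<close>, and two facts obtained from loops:
  \<open>sh_inj\<close> and \<open>up_not_sh\<close>. The second one also prevents an automorphism
  that fixes all lines from turning a vertical 1-cell upside down.

  The Hausdorff property is proved because closures of open cells have to be closed cells: only then
  does a homeomorphism that permutes open cells carry ends of 1-cells to ends.\<close>

lemma topspace_weak_topology:
  assumes "\<And>c u. c \<in> I \<Longrightarrow> u \<in> D c \<Longrightarrow> \<phi> c u \<in> P"
  shows "topspace (weak_topology P I D \<phi>) = P"
proof -
  have "{u \<in> D c. \<phi> c u \<in> P} = D c" if "c \<in> I" for c
    using assms that by blast
  then have "openin (weak_topology P I D \<phi>) P"
    by (simp add: openin_weak_topology)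
  then show ?thesis
    by (metis openin_subset openin_topspace openin_weak_topology subset_antisym)
qed

lemma continuous_map_weak_topology:
  assumes maps: "\<And>c u. c \<in> I \<Longrightarrow> u \<in> D c \<Longrightarrow> \<phi> c u \<in> P"
  shows "continuous_map (weak_topology P I D \<phi>) Y f \<longleftrightarrow>
    f \<in> P \<rightarrow> topspace Y \<and> (\<forall>c\<in>I. continuous_map (top_of_set (D c)) Y (\<lambda>u. f (\<phi> c u)))"
proof -
  have eq: "{u \<in> D c. \<phi> c u \<in> P \<and> f (\<phi> c u) \<in> U} = {u \<in> D c. f (\<phi> c u) \<in> U}" if "c \<in> I" for c U
    using maps that by blast
  have top: "topspace (weak_topology P I D \<phi>) = P"
    using maps by (rule topspace_weak_topology)
  show ?thesis
    unfolding continuous_map_def top openin_weak_topology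
    using maps by (auto simp: Pi_iff eq)
qed

lemma continuous_map_characteristic:
  assumes maps: "\<And>c u. c \<in> I \<Longrightarrow> u \<in> D c \<Longrightarrow> \<phi> c u \<in> P" and "c \<in> I"
  shows "continuous_map (top_of_set (D c)) (weak_topology P I D \<phi>) (\<phi> c)"
proof -
  have "topspace (weak_topology P I D \<phi>) = P"
    using maps by (rule topspace_weak_topology)
  then show ?thesis
    using assms by (auto simp: continuous_map_def openin_weak_topology)
qed

text \<open>The complement of a member is a union of members, hence open; a component that meets a
  member therefore cannot leave it. This identifies explicit families of lines and open strips with
  the components in \<open>branching_lines\<close> and \<open>strips\<close>.\<close>

lemma connected_components_of_open_partition:
  assumes ne: "\<And>A. A \<in> \<A> \<Longrightarrow> A \<noteq> {}"
    and opn: "\<And>A. A \<in> \<A> \<Longrightarrow> openin Y A"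
    and conn: "\<And>A. A \<in> \<A> \<Longrightarrow> connectedin Y A"
    and disj: "\<And>A B. A \<in> \<A> \<Longrightarrow> B \<in> \<A> \<Longrightarrow> A \<noteq> B \<Longrightarrow> A \<inter> B = {}"
    and cover: "\<Union>\<A> = topspace Y"
  shows "connected_components_of Y = \<A>"
proof -
  have sub: "A \<subseteq> S" if A: "A \<in> \<A>" and S: "S \<in> connected_components_of Y" "A \<inter> S \<noteq> {}" for A S
    using connected_components_of_maximal[of S Y A] conn[OF A] S by (auto simp: disjnt_def)
  have eq: "S = A" if A: "A \<in> \<A>" and S: "S \<in> connected_components_of Y" "A \<inter> S \<noteq> {}" for A S
  proof (rule ccontr)
    assume "S \<noteq> A"
    with sub[OF that] obtain z where z: "z \<in> S" "z \<notin> A" by blast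
    have "openin Y (\<Union>(\<A> - {A}))" using opn by blast
    moreover have "S \<subseteq> A \<union> \<Union>(\<A> - {A})"
      using cover connected_components_of_subset[OF S(1)] by blast
    moreover have "A \<inter> \<Union>(\<A> - {A}) \<inter> S = {}" using disj A by blast
    moreover have "\<Union>(\<A> - {A}) \<inter> S \<noteq> {}"
      using z cover connected_components_of_subset[OF S(1)] by blast
    ultimately show False
      using connectedin_connected_components_of[OF S(1)] opn[OF A] S(2)
      unfolding connectedin by blast
  qed
  show ?thesis
  proof (intro equalityI subsetI)
    fix S assume S: "S \<in> connected_components_of Y"
    then obtain z where "z \<in> S" "z \<in> topspace Y"
      using nonempty_connected_components_of connected_components_of_subset by fast
    then obtain A where "A \<in> \<A>" "z \<in> A" using cover by blast
    with eq[OF this(1) S] \<open>z \<in> S\<close> show "S \<in> \<A>" by blast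
  next
    fix A assume A: "A \<in> \<A>"
    then obtain z where "z \<in> A" "z \<in> topspace Y" using ne cover by blast
    then obtain S where "S \<in> connected_components_of Y" "z \<in> S"
      using Union_connected_components_of by (metis UnionE)
    with eq[OF A this(1)] \<open>z \<in> A\<close> show "A \<in> connected_components_of Y" by blast
  qed
qed

text \<open>The unions over the windows from \<open>-L\<close> to \<open>L\<close> grow by one set
  at each end, and all of them contain \<open>A 0\<close>.\<close>

lemma connectedin_int_chain:
  fixes A :: "int \<Rightarrow> 'a set"
  assumes conn: "\<And>j. connectedin X (A j)" and int: "\<And>j. A j \<inter> A (j + 1) \<noteq> {}"
  shows "connectedin X (\<Union>j. A j)"
proof -
  define B where "B L = (\<Union>j\<in>{- int L..int L}. A j)" for L
  have conn_B: "connectedin X (B L)" for L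
  proof (induction L)
    case 0
    then show ?case using conn by (simp add: B_def)
  next
    case (Suc L)
    have "{- int (Suc L)..int (Suc L)} = insert (int L + 1) (insert (- int L - 1) {- int L..int L})"
      by auto
    then have B: "B (Suc L) = (B L \<union> A (- int L - 1)) \<union> A (int L + 1)" by (auto simp: B_def)
    have sub: "A (- int L) \<subseteq> B L" "A (int L) \<subseteq> B L" by (auto simp: B_def)
    have "A (- int L - 1) \<inter> A (- int L) \<noteq> {}" using int[of "- int L - 1"] by simp
    then have "connectedin X (B L \<union> A (- int L - 1))"
      using sub by (intro connectedin_Un[OF Suc conn]) blast
    moreover have "(B L \<union> A (- int L - 1)) \<inter> A (int L + 1) \<noteq> {}"
      using int[of "int L"] sub by blast
    ultimately have "connectedin X ((B L \<union> A (- int L - 1)) \<union> A (int L + 1))"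
      using connectedin_Un conn by blast
    with B show ?case by simp
  qed
  have "A 0 \<noteq> {}" using int[of 0] by blast
  moreover have "A 0 \<subseteq> B L" for L unfolding B_def by (rule UN_upper) simp
  ultimately have "\<Inter>(range B) \<noteq> {}" by blast
  with conn_B have "connectedin X (\<Union>(range B))" by (intro connectedin_Union) auto
  moreover have "\<Union>(range B) = (\<Union>j. A j)"
  proof -
    have "A j \<subseteq> B (nat \<bar>j\<bar>)" for j unfolding B_def by (rule UN_upper) auto
    moreover have "B L \<subseteq> (\<Union>j. A j)" for L by (auto simp: B_def)
    ultimately show ?thesis by blast
  qed
  ultimately show ?thesis by simp
qed

lemma grid_point:
  assumes "0 \<le> x" "x \<le> 1" "L > 0"
  obtains j :: nat and r :: real where "j < L" "r \<in> {0..1}" "x = (real j + r) / real L"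
proof (cases "x = 1")
  \<comment> \<open>The floor would put the right end into a nonexistent interval \<open>L\<close>;
    it becomes the end \<open>r = 1\<close> of the last one.\<close>
  case True
  have "real (L - 1) + 1 = real L" using assms by simp
  then show thesis using True assms that[of "L - 1" 1] by simp
next
  case False
  define j where "j = nat \<lfloor>real L * x\<rfloor>"
  have j: "real j = of_int \<lfloor>real L * x\<rfloor>" using assms by (simp add: j_def)
  have "real L * x < real L * 1" using False assms by (intro mult_strict_left_mono) auto
  then have "real j < real L" using j by linarith
  then show thesis using that[of j "real L * x - real j"] j assms(3) by simp linarith
qed

section \<open>Lifting to covering spaces\<close>

lemma covering_map_unique_lift:
  assumes cov: "covering_map X p Y" and T: "connected_space T"
    and g: "continuous_map T X g" and h: "continuous_map T X h"
    and eq: "\<And>t. t \<in> topspace T \<Longrightarrow> p (g t) = p (h t)"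
    and a: "a \<in> topspace T" "g a = h a" and b: "b \<in> topspace T"
  shows "g b = h b"
proof -
  have gX: "g t \<in> topspace X" and hX: "h t \<in> topspace X" if "t \<in> topspace T" for t
    using g h that by (auto simp: continuous_map_def)
  let ?E = "{t \<in> topspace T. g t = h t}"
  have loc: "\<exists>W. openin T W \<and> t \<in> W \<and> (W \<subseteq> ?E \<or> W \<inter> ?E = {})" if t: "t \<in> topspace T" for t
  proof -
    have "p (g t) \<in> topspace Y"
      using cov gX[OF t] by (auto simp: covering_map_def)
    then obtain U \<V> where U: "p (g t) \<in> U" "\<Union>\<V> = {x \<in> topspace X. p x \<in> U}"
      and V: "\<forall>V\<in>\<V>. openin X V" "pairwise disjnt \<V>"
        "\<forall>V\<in>\<V>. homeomorphic_map (subtopology X V) (subtopology Y U) p"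
      using cov unfolding covering_map_def by meson
    obtain V where V1: "V \<in> \<V>" "g t \<in> V" using U gX[OF t] by blast
    have "h t \<in> \<Union>\<V>" using U hX[OF t] eq[OF t] by simp
    then obtain V' where V2: "V' \<in> \<V>" "h t \<in> V'" by blast
    let ?W = "{s \<in> topspace T. g s \<in> V} \<inter> {s \<in> topspace T. h s \<in> V'}"
    have "openin T ?W"
      using V(1) V1 V2 openin_continuous_map_preimage[OF g] openin_continuous_map_preimage[OF h]
      by (intro openin_Int) blast+
    moreover have "?W \<subseteq> ?E" if "V = V'"
    proof -
      have "inj_on p (topspace X \<inter> V)"
        using homeomorphic_imp_injective_map[OF bspec[OF V(3) V1(1)]] by simp
      then show ?thesis using eq gX hX that by (auto simp: inj_on_def)
    qed
    moreover have "?W \<inter> ?E = {}" if "V \<noteq> V'"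
      using V(2) V1 V2 that by (fastforce simp: pairwise_def disjnt_def)
    ultimately show ?thesis using V1 V2 t by (intro exI[of _ ?W]) blast
  qed
  have E: "openin T ?E"
    by (subst openin_subopen) (use loc in blast)
  have "openin T (topspace T - ?E)"
  proof (subst openin_subopen, intro ballI)
    fix t assume t: "t \<in> topspace T - ?E"
    then obtain W where W: "openin T W" "t \<in> W" "W \<subseteq> ?E \<or> W \<inter> ?E = {}"
      using loc[of t] by auto
    then have "W \<subseteq> topspace T - ?E" using t openin_subset[OF W(1)] by blast
    with W show "\<exists>W. openin T W \<and> t \<in> W \<and> W \<subseteq> topspace T - ?E" by blast
  qed
  then have "closedin T ?E" by (simp add: closedin_def)
  then have "?E = {} \<or> ?E = topspace T"
    using T[unfolded connected_space_clopen_in, rule_format, OF conjI, OF E] by blast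
  with a have "?E = topspace T" by blast
  then show ?thesis using b by blast
qed

lemma covering_map_Hausdorff:
  assumes cov: "covering_map X p Y" and Y: "Hausdorff_space Y"
  shows "Hausdorff_space X"
  unfolding Hausdorff_space_def
proof (intro allI impI)
  fix x y assume xy: "x \<in> topspace X \<and> y \<in> topspace X \<and> x \<noteq> y"
  have p: "continuous_map X Y p" using cov by (simp add: covering_map_def)
  have pY: "p x \<in> topspace Y" "p y \<in> topspace Y" using p xy by (auto simp: continuous_map_def)
  show "\<exists>U V. openin X U \<and> openin X V \<and> x \<in> U \<and> y \<in> V \<and> disjnt U V"
  proof (cases "p x = p y")
    case False
    then obtain U V where "openin Y U" "openin Y V" "p x \<in> U" "p y \<in> V" "disjnt U V"
      using Y pY unfolding Hausdorff_space_def by blast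
    then show ?thesis using p xy
      by (intro exI[of _ "{z \<in> topspace X. p z \<in> U}"] exI[of _ "{z \<in> topspace X. p z \<in> V}"])
        (auto simp: continuous_map_def disjnt_def)
  next
    case True
    obtain U \<V> where U: "p x \<in> U" "\<Union>\<V> = {x \<in> topspace X. p x \<in> U}"
      and V: "\<forall>V\<in>\<V>. openin X V" "pairwise disjnt \<V>"
        "\<forall>V\<in>\<V>. homeomorphic_map (subtopology X V) (subtopology Y U) p"
      using cov pY unfolding covering_map_def by meson
    obtain V where V1: "V \<in> \<V>" "x \<in> V" using U xy by blast
    have "y \<in> \<Union>\<V>" using U xy True by simp
    then obtain V' where V2: "V' \<in> \<V>" "y \<in> V'" by blast
    have "inj_on p (topspace X \<inter> V)"
      using homeomorphic_imp_injective_map[OF bspec[OF V(3) V1(1)]] by simp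
    then have "V \<noteq> V'" using V1 V2 xy True by (auto simp: inj_on_def)
    then have "disjnt V V'" using V(2) V1 V2 by (simp add: pairwise_def)
    then show ?thesis using V(1) V1 V2 by blast
  qed
qed

text \<open>\<open>r\<close> is the inverse of \<open>p\<close> on the sheet \<open>V\<close>. With
  local inverses at hand, lifting is composition with \<open>r\<close>.\<close>

lemma covering_map_sheets:
  assumes cov: "covering_map X p Y" and y: "y \<in> topspace Y"
  obtains U where "openin Y U" "y \<in> U"
    "\<And>x. x \<in> topspace X \<Longrightarrow> p x \<in> U \<Longrightarrow>
       \<exists>V r. openin X V \<and> x \<in> V \<and> continuous_map (subtopology Y U) X r \<and> r \<in> U \<rightarrow> V \<and>
         (\<forall>y\<in>U. p (r y) = y) \<and> (\<forall>v\<in>V. p v \<in> U \<and> r (p v) = v)"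
proof -
  obtain U \<V> where U: "y \<in> U" "\<Union>\<V> = {x \<in> topspace X. p x \<in> U}" "openin Y U"
      and V: "\<forall>V\<in>\<V>. openin X V"
        "\<forall>V\<in>\<V>. homeomorphic_map (subtopology X V) (subtopology Y U) p"
    using cov y unfolding covering_map_def by meson
  show ?thesis
  proof (rule that[OF U(3,1)])
    fix x assume x: "x \<in> topspace X" "p x \<in> U"
    then have "x \<in> \<Union>\<V>" using U by simp
    then obtain V where V1: "V \<in> \<V>" "x \<in> V" by blast
    then obtain r where r: "homeomorphic_maps (subtopology X V) (subtopology Y U) p r"
      using V homeomorphic_map_maps by blast
    have oV: "openin X V" using V V1 by blast
    have tV: "topspace (subtopology X V) = V" and tU: "topspace (subtopology Y U) = U"
      using oV U by (auto simp: openin_subset inf.absorb2)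
    have c: "continuous_map (subtopology Y U) (subtopology X V) r"
      using r by (simp add: homeomorphic_maps_def)
    have "continuous_map (subtopology Y U) X r" using c continuous_map_into_fulltopology by blast
    moreover have "r \<in> U \<rightarrow> V" using c tU by (auto simp: continuous_map_in_subtopology)
    moreover have "\<forall>y\<in>U. p (r y) = y" "\<forall>v\<in>V. r (p v) = v"
      using r unfolding homeomorphic_maps_def tV tU by auto
    moreover have "\<forall>v\<in>V. p v \<in> U" using U(2) V1 by blast
    ultimately show "\<exists>V r. openin X V \<and> x \<in> V \<and> continuous_map (subtopology Y U) X r \<and> r \<in> U \<rightarrow> V \<and>
         (\<forall>y\<in>U. p (r y) = y) \<and> (\<forall>v\<in>V. p v \<in> U \<and> r (p v) = v)"
      using oV V1 by blast
  qed
qed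

section \<open>Lifting maps defined on rectangles\<close>

text \<open>A lift is demanded through every point over every \<open>u\<close> in \<open>R\<close>.
  The lift on a second piece can thus be started at whatever value the first lift takes at a common
  point.\<close>

definition liftable :: "'x topology \<Rightarrow> ('x \<Rightarrow> 'y) \<Rightarrow> ('e::topological_space \<Rightarrow> 'y) \<Rightarrow> 'e set \<Rightarrow> bool" where
  "liftable X p q R \<longleftrightarrow> (\<forall>u\<in>R. \<forall>x\<in>topspace X. p x = q u \<longrightarrow>
     (\<exists>h. continuous_map (top_of_set R) X h \<and> (\<forall>v\<in>R. p (h v) = q v) \<and> h u = x))"

lemma continuous_map_paste_closed:
  assumes f: "continuous_map (top_of_set A) X f" and g: "continuous_map (top_of_set B) X g"
    and A: "closed A" and B: "closed B" and eq: "\<And>v. v \<in> A \<Longrightarrow> v \<in> B \<Longrightarrow> f v = g v"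
  shows "continuous_map (top_of_set (A \<union> B)) X (\<lambda>v. if v \<in> A then f v else g v)"
  unfolding continuous_map_closedin
proof (intro conjI allI impI ballI)
  fix C assume C: "closedin X C"
  have "closedin (top_of_set A) {v \<in> A. f v \<in> C}" "closedin (top_of_set B) {v \<in> B. g v \<in> C}"
    using f g C unfolding continuous_map_closedin by auto
  then have "closed {v \<in> A. f v \<in> C}" "closed {v \<in> B. g v \<in> C}"
    using A B closedin_closed_trans by blast+
  then have "closedin (top_of_set (A \<union> B)) ({v \<in> A. f v \<in> C} \<union> {v \<in> B. g v \<in> C})"
    by (intro closed_subset closed_Un) auto
  moreover have "{v \<in> topspace (top_of_set (A \<union> B)). (if v \<in> A then f v else g v) \<in> C}
      = {v \<in> A. f v \<in> C} \<union> {v \<in> B. g v \<in> C}"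
    using eq by auto
  ultimately show "closedin (top_of_set (A \<union> B))
      {v \<in> topspace (top_of_set (A \<union> B)). (if v \<in> A then f v else g v) \<in> C}"
    by simp
qed (use f g in \<open>auto simp: continuous_map_def\<close>)

lemma connected_space_top_of_set: "connected S \<Longrightarrow> connected_space (top_of_set S)"
  by (metis connectedin_def connectedin_iff_connected)

text \<open>Two lifts that agree at one point of the connected overlap agree on all of it, so they
  can be pasted.\<close>

lemma liftable_Un:
  assumes cov: "covering_map X p Y"
    and A: "closed A" "liftable X p q A" and B: "closed B" "liftable X p q B"
    and AB: "connected (A \<inter> B)" "A \<inter> B \<noteq> {}" and q: "q \<in> A \<union> B \<rightarrow> topspace Y"
  shows "liftable X p q (A \<union> B)"
proof -
  \<comment> \<open>The prescribed point may lie in either piece; \<open>A\<close> and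
    \<open>B\<close> are generalised so that both cases are instances.\<close>
  have *: "\<exists>h. continuous_map (top_of_set (A \<union> B)) X h \<and> (\<forall>v\<in>A \<union> B. p (h v) = q v) \<and> h u = x"
    if A: "closed A" "liftable X p q A" and B: "closed B" "liftable X p q B"
      and AB: "connected (A \<inter> B)" "A \<inter> B \<noteq> {}"
      and u: "u \<in> A" and x: "x \<in> topspace X" "p x = q u" for A B u x
  proof -
    obtain f where f: "continuous_map (top_of_set A) X f" "\<forall>v\<in>A. p (f v) = q v" "f u = x"
      using A u x unfolding liftable_def by blast
    obtain w where w: "w \<in> A \<inter> B" using AB by blast
    have "f w \<in> topspace X" using f(1) w by (auto simp: continuous_map_def)
    then obtain g where g: "continuous_map (top_of_set B) X g" "\<forall>v\<in>B. p (g v) = q v" "g w = f w"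
      using B w f(2) unfolding liftable_def by blast
    have eq: "f v = g v" if "v \<in> A" "v \<in> B" for v
    proof (rule covering_map_unique_lift[OF cov, where T = "top_of_set (A \<inter> B)" and a = w])
      show "continuous_map (top_of_set (A \<inter> B)) X f" "continuous_map (top_of_set (A \<inter> B)) X g"
        using continuous_map_from_subtopology_mono f(1) g(1) by blast+
    qed (use AB that w f g in \<open>auto intro: connected_space_top_of_set\<close>)
    show ?thesis
    proof (intro exI conjI)
      show "continuous_map (top_of_set (A \<union> B)) X (\<lambda>v. if v \<in> A then f v else g v)"
        by (rule continuous_map_paste_closed) (use f g A B eq in auto)
    qed (use f g u in auto)
  qed
  show ?thesis
    unfolding liftable_def
  proof (intro ballI impI)
    fix u x assume u: "u \<in> A \<union> B" and x: "x \<in> topspace X" "p x = q u"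
    show "\<exists>h. continuous_map (top_of_set (A \<union> B)) X h \<and> (\<forall>v\<in>A \<union> B. p (h v) = q v) \<and> h u = x"
    proof (cases "u \<in> A")
      case True
      show ?thesis by (rule *[OF A B AB True x])
    next
      case False
      with u have "u \<in> B" by blast
      from *[OF B A _ _ this x] AB show ?thesis by (simp add: Un_commute Int_commute)
    qed
  qed
qed

lemma liftable_small:
  assumes cov: "covering_map X p Y" and q: "continuous_map (top_of_set R) Y q" and v: "v \<in> R"
  obtains T where "open T" "v \<in> T" "\<And>S. S \<subseteq> R \<inter> T \<Longrightarrow> liftable X p q S"
proof -
  have "q v \<in> topspace Y" using q v by (auto simp: continuous_map_def)
  then obtain U where U: "openin Y U" "q v \<in> U"
    "\<And>x. x \<in> topspace X \<Longrightarrow> p x \<in> U \<Longrightarrow>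
       \<exists>V r. openin X V \<and> x \<in> V \<and> continuous_map (subtopology Y U) X r \<and> r \<in> U \<rightarrow> V \<and>
         (\<forall>y\<in>U. p (r y) = y) \<and> (\<forall>v\<in>V. p v \<in> U \<and> r (p v) = v)"
    by (rule covering_map_sheets[OF cov]) blast
  have "openin (top_of_set R) {w \<in> R. q w \<in> U}"
    using q U(1) by (auto simp: continuous_map_def)
  then obtain T where T: "open T" "{w \<in> R. q w \<in> U} = R \<inter> T"
    by (auto simp: openin_open)
  show ?thesis
  proof (rule that[OF T(1)])
    show "v \<in> T" using T v U(2) by blast
    fix S assume S: "S \<subseteq> R \<inter> T"
    show "liftable X p q S" unfolding liftable_def
    proof (intro ballI impI)
      fix u x assume u: "u \<in> S" and x: "x \<in> topspace X" "p x = q u"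
      have qU: "q w \<in> U" if "w \<in> S" for w using S T that by blast
      then obtain V r where r: "continuous_map (subtopology Y U) X r" "\<forall>y\<in>U. p (r y) = y"
        and V: "x \<in> V" "\<forall>v\<in>V. p v \<in> U \<and> r (p v) = v"
        using U(3)[OF x(1)] x u by metis
      have "S \<subseteq> R" using S by blast
      then have "continuous_map (top_of_set S) Y q"
        using continuous_map_from_subtopology_mono q by blast
      then have "continuous_map (top_of_set S) (subtopology Y U) q"
        using qU by (auto simp: continuous_map_in_subtopology)
      then have "continuous_map (top_of_set S) X (r \<circ> q)" using r(1) continuous_map_compose by blast
      then show "\<exists>h. continuous_map (top_of_set S) X h \<and> (\<forall>v\<in>S. p (h v) = q v) \<and> h u = x"
        using r V x qU by (intro exI[of _ "r \<circ> q"]) auto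
    qed
  qed
qed

text \<open>Bisection takes the place of a Lebesgue number: first horizontally, for thin rectangles
  around a fixed height, then vertically, for rectangles of full width.\<close>

lemma liftable_box:
  fixes q :: "real \<times> real \<Rightarrow> 'y"
  assumes cov: "covering_map X p Y" and q: "continuous_map (top_of_set ({A..B} \<times> {C..D})) Y q"
    and AB: "A \<le> B" and CD: "C \<le> D"
  shows "liftable X p q ({A..B} \<times> {C..D})"
proof -
  have qY: "q \<in> {A..B} \<times> {C..D} \<rightarrow> topspace Y" using q by (auto simp: continuous_map_def)
  have strip: "\<exists>\<delta>>0. \<forall>c d. C \<le> c \<and> c \<le> y \<and> y \<le> d \<and> d \<le> D \<and> d - c < \<delta> \<longrightarrow>
      liftable X p q ({A..B} \<times> {c..d})" if y: "C \<le> y" "y \<le> D" for y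
  proof -
    \<comment> \<open>The thickness \<open>\<delta>\<close> may depend on the interval; when two
      intervals are joined, the smaller one survives.\<close>
    let ?P = "\<lambda>a b. A \<le> a \<longrightarrow> b \<le> B \<longrightarrow> (\<exists>\<delta>>0. \<forall>c d. C \<le> c \<and> c \<le> y \<and> y \<le> d \<and> d \<le> D \<and> d - c < \<delta> \<longrightarrow>
      liftable X p q ({a..b} \<times> {c..d}))"
    have "?P A B"
    proof (rule Bolzano[where P = ?P], goal_cases)
      case (2 a b e)
      note trans = 2
      show ?case
      proof (intro impI)
        assume ae: "A \<le> a" "e \<le> B"
        obtain \<delta>1 where 1: "\<delta>1 > 0" "\<And>c d. C \<le> c \<and> c \<le> y \<and> y \<le> d \<and> d \<le> D \<and> d - c < \<delta>1 \<Longrightarrow>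
          liftable X p q ({a..b} \<times> {c..d})"
          using trans(1) ae trans(3,4) by (smt (verit))
        obtain \<delta>2 where 2: "\<delta>2 > 0" "\<And>c d. C \<le> c \<and> c \<le> y \<and> y \<le> d \<and> d \<le> D \<and> d - c < \<delta>2 \<Longrightarrow>
          liftable X p q ({b..e} \<times> {c..d})"
          using trans(2) ae trans(3,4) by (smt (verit))
        show "\<exists>\<delta>>0. \<forall>c d. C \<le> c \<and> c \<le> y \<and> y \<le> d \<and> d \<le> D \<and> d - c < \<delta> \<longrightarrow>
          liftable X p q ({a..e} \<times> {c..d})"
        proof (intro exI[of _ "min \<delta>1 \<delta>2"] conjI allI impI)
          fix c d assume cd: "C \<le> c \<and> c \<le> y \<and> y \<le> d \<and> d \<le> D \<and> d - c < min \<delta>1 \<delta>2"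
          have un: "{a..e} \<times> {c..d} = {a..b} \<times> {c..d} \<union> {b..e} \<times> {c..d}"
            using trans(3,4) by auto
          have int: "{a..b} \<times> {c..d} \<inter> {b..e} \<times> {c..d} = {b} \<times> {c..d}"
            using trans(3,4) by auto
          show "liftable X p q ({a..e} \<times> {c..d})"
            unfolding un
          proof (rule liftable_Un[OF cov])
            show "connected ({a..b} \<times> {c..d} \<inter> {b..e} \<times> {c..d})"
              unfolding int by (intro connected_Times) auto
            show "q \<in> {a..b} \<times> {c..d} \<union> {b..e} \<times> {c..d} \<rightarrow> topspace Y"
              using qY ae cd trans(3,4) by fastforce
          qed (use 1 2 cd int in \<open>auto simp: closed_Times\<close>)
        qed (use 1 2 in auto)
      qed
    next
      case (3 x)
      note local = 3
      have "(x, y) \<in> {A..B} \<times> {C..D}" using local y by simp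
      then obtain T where T: "open T" "(x, y) \<in> T"
        "\<And>S. S \<subseteq> {A..B} \<times> {C..D} \<inter> T \<Longrightarrow> liftable X p q S"
        using liftable_small[OF cov q] by metis
      then obtain S1 S2 where S: "open S1" "open S2" "x \<in> S1" "y \<in> S2" "S1 \<times> S2 \<subseteq> T"
        by (metis open_prod_elim mem_Sigma_iff)
      obtain e1 where e1: "e1 > 0" "\<And>z. \<bar>z - x\<bar> < e1 \<Longrightarrow> z \<in> S1"
        using S by (auto simp: open_dist dist_real_def)
      obtain e2 where e2: "e2 > 0" "\<And>z. \<bar>z - y\<bar> < e2 \<Longrightarrow> z \<in> S2"
        using S by (auto simp: open_dist dist_real_def)
      have "liftable X p q ({a..b} \<times> {c..d})"
        if "a \<le> x \<and> x \<le> b \<and> b - a < e1" "A \<le> a" "b \<le> B"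
          "C \<le> c \<and> c \<le> y \<and> y \<le> d \<and> d \<le> D \<and> d - c < e2" for a b c d
      proof (rule T(3))
        have "{a..b} \<subseteq> S1" "{c..d} \<subseteq> S2" using that e1 e2 by auto
        then show "{a..b} \<times> {c..d} \<subseteq> {A..B} \<times> {C..D} \<inter> T" using S(5) that by auto
      qed
      then show ?case using e1(1) e2(1) by blast
    qed (rule AB)
    then show ?thesis by simp
  qed
  let ?P = "\<lambda>c d. C \<le> c \<longrightarrow> d \<le> D \<longrightarrow> liftable X p q ({A..B} \<times> {c..d})"
  have "?P C D"
  proof (rule Bolzano[where P = ?P], goal_cases)
    case (2 c d e)
    note trans = 2
    show ?case
    proof (intro impI)
      assume ce: "C \<le> c" "e \<le> D"
      have un: "{A..B} \<times> {c..e} = {A..B} \<times> {c..d} \<union> {A..B} \<times> {d..e}"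
        using trans(3,4) by auto
      have int: "{A..B} \<times> {c..d} \<inter> {A..B} \<times> {d..e} = {A..B} \<times> {d}"
        using trans(3,4) by auto
      show "liftable X p q ({A..B} \<times> {c..e})"
        unfolding un
      proof (rule liftable_Un[OF cov])
        show "connected ({A..B} \<times> {c..d} \<inter> {A..B} \<times> {d..e})"
          unfolding int by (intro connected_Times) auto
        show "q \<in> {A..B} \<times> {c..d} \<union> {A..B} \<times> {d..e} \<rightarrow> topspace Y"
          using qY ce trans(3,4) by fastforce
      qed (use trans ce AB int in \<open>auto simp: closed_Times\<close>)
    qed
  next
    case (3 y)
    then obtain \<delta> where "\<delta> > 0" "\<forall>c d. C \<le> c \<and> c \<le> y \<and> y \<le> d \<and> d \<le> D \<and> d - c < \<delta> \<longrightarrow>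
      liftable X p q ({A..B} \<times> {c..d})" using strip by blast
    then show ?case by blast
  qed (rule CD)
  then show ?thesis by simp
qed

section \<open>Maps between automorphism groups of complexes\<close>

lemma (in group_hom) rcoset_kernel:
  assumes g: "g \<in> carrier G"
  shows "kernel G H h #> g = {g' \<in> carrier G. h g' = h g}"
proof (intro equalityI subsetI)
  fix g' assume "g' \<in> kernel G H h #> g"
  then show "g' \<in> {g' \<in> carrier G. h g' = h g}"
    using g by (auto simp: r_coset_def kernel_def)
next
  fix g' assume g': "g' \<in> {g' \<in> carrier G. h g' = h g}"
  then have "g' \<otimes> inv g \<in> kernel G H h"
    using g by (simp add: kernel_def)
  moreover have "g' = (g' \<otimes> inv g) \<otimes> g" using g g' by (simp add: G.m_assoc)
  ultimately show "g' \<in> kernel G H h #> g" by (auto simp: r_coset_def)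
qed

section \<open>Homeomorphisms that permute the cells\<close>

lemma compose_image: "A \<subseteq> S \<Longrightarrow> compose S f g ` A = f ` (g ` A)"
  by (force simp: compose_def)

lemma cell_homeosD:
  assumes "f \<in> cell_homeos X C"
  shows "bij_betw f (topspace X) (topspace X)" "homeomorphic_map X X f"
    "\<sigma> \<in> C \<Longrightarrow> f ` \<sigma> \<in> C" "f \<in> Bij (topspace X)"
  using assms by (auto simp: cell_homeos_def Bij_def)

lemma cell_homeos_compose:
  assumes C: "C \<subseteq> Pow (topspace X)" and f: "f \<in> cell_homeos X C" and g: "g \<in> cell_homeos X C"
  shows "compose (topspace X) f g \<in> cell_homeos X C"
proof -
  have "homeomorphic_map X X (f \<circ> g)"
    using f g by (auto simp: cell_homeos_def intro: homeomorphic_map_compose)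
  then have "homeomorphic_map X X (compose (topspace X) f g)"
    by (rule homeomorphic_map_eq) (simp add: compose_def)
  moreover have "(\<lambda>\<sigma>. compose (topspace X) f g ` \<sigma>) ` C = (\<lambda>\<sigma>. f ` \<sigma>) ` (\<lambda>\<sigma>. g ` \<sigma>) ` C"
  proof -
    have "(\<lambda>\<sigma>. compose (topspace X) f g ` \<sigma>) ` C = (\<lambda>\<sigma>. f ` (g ` \<sigma>)) ` C"
      using C by (intro image_cong refl compose_image) blast
    also have "\<dots> = (\<lambda>\<sigma>. f ` \<sigma>) ` (\<lambda>\<sigma>. g ` \<sigma>) ` C" by (rule image_image[symmetric])
    finally show ?thesis .
  qed
  moreover have "(\<lambda>\<sigma>. f ` \<sigma>) ` C = C" "(\<lambda>\<sigma>. g ` \<sigma>) ` C = C" using f g by (simp_all add: cell_homeos_def)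
  ultimately show ?thesis
    unfolding cell_homeos_def using f g by (intro CollectI conjI compose_Bij) (simp_all add: cell_homeosD(4))
qed

lemma cell_homeos_inverse:
  assumes C: "C \<subseteq> Pow (topspace X)" and f: "f \<in> cell_homeos X C"
  defines "f' \<equiv> restrict (inv_into (topspace X) f) (topspace X)"
  shows "f' \<in> cell_homeos X C" "A \<subseteq> topspace X \<Longrightarrow> f' ` (f ` A) = A" "compose (topspace X) f' f = (\<lambda>x\<in>topspace X. x)"
proof -
  have bij: "bij_betw f (topspace X) (topspace X)" by (rule cell_homeosD(1)[OF f])
  have left: "f' (f x) = x" if "x \<in> topspace X" for x
    using that bij by (simp add: f'_def bij_betw_inv_into_left bij_betw_apply)
  show im: "f' ` (f ` A) = A" if "A \<subseteq> topspace X" for A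
    using left that by (force simp: image_image)
  obtain g where g: "homeomorphic_maps X X f g"
    using cell_homeosD(2)[OF f] homeomorphic_map_maps by blast
  have "homeomorphic_map X X g" using g homeomorphic_map_maps homeomorphic_maps_sym by blast
  moreover have "g y = f' y" if "y \<in> topspace X" for y
  proof -
    have "g y \<in> topspace X" "f (g y) = y"
      using g that by (auto simp: homeomorphic_maps_def continuous_map_def)
    then show ?thesis using left[of "g y"] by simp
  qed
  ultimately have "homeomorphic_map X X f'" by (rule homeomorphic_map_eq)
  moreover have "f' \<in> Bij (topspace X)"
    unfolding f'_def by (rule restrict_inv_into_Bij[OF cell_homeosD(4)[OF f]])
  moreover have "(\<lambda>\<sigma>. f' ` \<sigma>) ` C = C"
  proof -
    have "(\<lambda>\<sigma>. f' ` \<sigma>) ` C = (\<lambda>\<sigma>. f' ` \<sigma>) ` (\<lambda>\<sigma>. f ` \<sigma>) ` C"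
      using f by (simp add: cell_homeos_def)
    also have "\<dots> = id ` C"
      unfolding image_image using C by (intro image_cong refl) (simp add: im[unfolded image_image] subset_eq)
    finally show ?thesis by simp
  qed
  ultimately show "f' \<in> cell_homeos X C" by (simp add: cell_homeos_def)
  show "compose (topspace X) f' f = (\<lambda>x\<in>topspace X. x)"
    unfolding f'_def by (rule Bij_compose_restrict_eq[OF cell_homeosD(4)[OF f]])
qed

lemma cell_homeos_id: "C \<subseteq> Pow (topspace X) \<Longrightarrow> (\<lambda>x\<in>topspace X. x) \<in> cell_homeos X C"
proof -
  assume C: "C \<subseteq> Pow (topspace X)"
  have "homeomorphic_map X X (\<lambda>x\<in>topspace X. x)"
    by (rule homeomorphic_map_eq[OF homeomorphic_map_id[THEN iffD2, OF refl]]) simp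
  moreover have "(\<lambda>\<sigma>. (\<lambda>x\<in>topspace X. x) ` \<sigma>) ` C = id ` C"
    using C by (intro image_cong refl) (auto simp: image_iff)
  ultimately show ?thesis by (simp add: cell_homeos_def id_Bij)
qed

text \<open>By \<open>Aut_complex_structure\<close> this is the coset of \<open>f\<close> modulo the
  cell-trivial homeomorphisms.\<close>

definition cell_class :: "'a topology \<Rightarrow> 'a set set \<Rightarrow> ('a \<Rightarrow> 'a) \<Rightarrow> ('a \<Rightarrow> 'a) set" where
  "cell_class X C f = {f' \<in> cell_homeos X C. \<forall>\<sigma>\<in>C. f' ` \<sigma> = f ` \<sigma>}"

text \<open>The cell-trivial homeomorphisms are the kernel of the action on \<open>C\<close>, so two
  homeomorphisms lie in the same coset exactly if they permute the cells alike.\<close>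

lemma Aut_complex_structure:
  assumes C: "C \<subseteq> Pow (topspace X)"
  shows "carrier (Aut_complex X C) = cell_class X C ` cell_homeos X C" (is ?A)
    and "f \<in> cell_homeos X C \<Longrightarrow> g \<in> cell_homeos X C \<Longrightarrow>
      cell_class X C f \<otimes>\<^bsub>Aut_complex X C\<^esub> cell_class X C g = cell_class X C (compose (topspace X) f g)"
proof -
  let ?S = "topspace X"
  let ?G = "(BijGroup ?S)\<lparr>carrier := cell_homeos X C\<rparr>"
  let ?h = "\<lambda>f. \<lambda>\<sigma>\<in>C. f ` \<sigma>"
  have BijGamma: "cell_homeos X C \<subseteq> Bij ?S" by (auto simp: cell_homeos_def)
  have mult: "f \<otimes>\<^bsub>?G\<^esub> g = compose ?S f g" if "f \<in> cell_homeos X C" "g \<in> cell_homeos X C" for f g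
    using that BijGamma by (auto simp: BijGroup_def)
  have G: "group ?G"
  proof (rule groupI)
    fix f assume f: "f \<in> carrier ?G"
    then have f': "f \<in> cell_homeos X C" by simp
    show "\<exists>f'\<in>carrier ?G. f' \<otimes>\<^bsub>?G\<^esub> f = \<one>\<^bsub>?G\<^esub>"
      using cell_homeos_inverse[OF C f'] f' mult
      by (intro bexI[of _ "restrict (inv_into ?S f) ?S"]) (auto simp: BijGroup_def)
    show "\<one>\<^bsub>?G\<^esub> \<otimes>\<^bsub>?G\<^esub> f = f"
      using group.is_monoid[OF group_BijGroup[of ?S]] f' BijGamma monoid.l_one[of "BijGroup ?S" f]
      by (auto simp: BijGroup_def)
  next
    fix f g h assume "f \<in> carrier ?G" "g \<in> carrier ?G" "h \<in> carrier ?G"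
    then show "f \<otimes>\<^bsub>?G\<^esub> g \<otimes>\<^bsub>?G\<^esub> h = f \<otimes>\<^bsub>?G\<^esub> (g \<otimes>\<^bsub>?G\<^esub> h)"
      using group.is_monoid[OF group_BijGroup[of ?S]] BijGamma monoid.m_assoc[of "BijGroup ?S" f g h]
      by (auto simp: BijGroup_def)
  qed (use cell_homeos_compose[OF C] cell_homeos_id[OF C] BijGamma in \<open>auto simp: mult BijGroup_def subset_iff\<close>)
  have hB: "?h f \<in> Bij C" if f: "f \<in> cell_homeos X C" for f
  proof -
    have "inj_on ((`) f) C"
      using C inj_on_image_eq_iff[OF bij_betw_imp_inj_on[OF cell_homeosD(1)[OF f]]]
      by (auto intro!: inj_onI simp: subset_eq)
    moreover have "(`) f ` C = C" using f by (simp add: cell_homeos_def)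
    ultimately show ?thesis by (auto simp: Bij_def bij_betw_def inj_on_def)
  qed
  have "group_hom ?G (BijGroup C) ?h"
  proof (intro group_hom.intro group_hom_axioms.intro G group_BijGroup homI)
    fix f g assume "f \<in> carrier ?G" "g \<in> carrier ?G"
    then have fg: "f \<in> cell_homeos X C" "g \<in> cell_homeos X C" by auto
    have "?h (compose ?S f g) = compose C (?h f) (?h g)"
    proof
      fix \<sigma>
      show "?h (compose ?S f g) \<sigma> = compose C (?h f) (?h g) \<sigma>"
      proof (cases "\<sigma> \<in> C")
        case True
        then have "\<sigma> \<subseteq> ?S" using C by blast
        then show ?thesis using True cell_homeosD(3)[OF fg(2) True]
          by (simp add: compose_image) (simp add: compose_def)
      qed (simp add: compose_def)
    qed
    then show "?h (f \<otimes>\<^bsub>?G\<^esub> g) = ?h f \<otimes>\<^bsub>BijGroup C\<^esub> ?h g"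
      using hB[OF fg(1)] hB[OF fg(2)] by (simp only: mult[OF fg]) (simp add: BijGroup_def)
  qed (use hB in \<open>simp add: BijGroup_def\<close>)
  then interpret group_hom ?G "BijGroup C" ?h .
  have K: "cell_trivial_homeos X C = kernel ?G (BijGroup C) ?h"
  proof -
    have "?h f = (\<lambda>\<sigma>\<in>C. \<sigma>) \<longleftrightarrow> (\<forall>\<sigma>\<in>C. f ` \<sigma> = \<sigma>)" for f :: "'a \<Rightarrow> 'a"
      by (auto simp: fun_eq_iff restrict_def)
    then show ?thesis by (auto simp: cell_trivial_homeos_def kernel_def BijGroup_def)
  qed
  have cls: "cell_trivial_homeos X C #>\<^bsub>?G\<^esub> f = cell_class X C f" if "f \<in> cell_homeos X C" for f
  proof -
    have "?h f' = ?h f \<longleftrightarrow> (\<forall>\<sigma>\<in>C. f' ` \<sigma> = f ` \<sigma>)" for f' :: "'a \<Rightarrow> 'a"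
      by (auto simp: fun_eq_iff restrict_def)
    then show ?thesis unfolding K using rcoset_kernel[of f] that by (simp add: cell_class_def)
  qed
  show ?A
    unfolding Aut_complex_def FactGroup_def RCOSETS_def using cls by auto
  assume fg: "f \<in> cell_homeos X C" "g \<in> cell_homeos X C"
  have "normal (cell_trivial_homeos X C) ?G" unfolding K by (rule normal_kernel)
  then have "(cell_trivial_homeos X C #>\<^bsub>?G\<^esub> f) <#>\<^bsub>?G\<^esub> (cell_trivial_homeos X C #>\<^bsub>?G\<^esub> g) =
      cell_trivial_homeos X C #>\<^bsub>?G\<^esub> (f \<otimes>\<^bsub>?G\<^esub> g)"
    by (rule normal.rcos_sum) (use fg in simp_all)
  then show "cell_class X C f \<otimes>\<^bsub>Aut_complex X C\<^esub> cell_class X C g = cell_class X C (compose (topspace X) f g)"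
    unfolding Aut_complex_def FactGroup_def
    by (simp only: cls[OF fg(1)] cls[OF fg(2)] mult[OF fg] cls[OF cell_homeos_compose[OF C fg]] monoid.select_convs)
qed

text \<open>\<open>pre d\<close> stands for the preimage of a cell \<open>d\<close> under a
  projection. Three properties of the projection enter: the preimages are nonempty unions of cells,
  they are disjoint, and every \<open>f\<close> permutes them as some \<open>g\<close> permutes the
  cells. Then \<open>\<Phi>\<close> sends the class of \<open>f\<close> to the class of
  \<open>g\<close>.\<close>

lemma Aut_induced_map:
  fixes X :: "'a topology" and Y :: "'b topology" and D :: "'b set set" and pre :: "'b set \<Rightarrow> 'a set"
  defines "\<Phi> \<equiv> \<lambda>F. {g \<in> cell_homeos Y D. \<exists>f\<in>F. \<forall>d\<in>D. f ` pre d = pre (g ` d)}"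
  assumes C: "C \<subseteq> Pow (topspace X)" "{} \<notin> C" and D: "D \<subseteq> Pow (topspace Y)" "D \<noteq> {}"
    and pre_cells: "\<And>d. d \<in> D \<Longrightarrow> \<exists>A\<subseteq>C. A \<noteq> {} \<and> pre d = \<Union>A"
    and pre_disjoint: "\<And>d d'. d \<in> D \<Longrightarrow> d' \<in> D \<Longrightarrow> pre d \<inter> pre d' \<noteq> {} \<Longrightarrow> d = d'"
    and ex: "\<And>f. f \<in> cell_homeos X C \<Longrightarrow> \<exists>g\<in>cell_homeos Y D. \<forall>d\<in>D. f ` pre d = pre (g ` d)"
  shows "\<Phi> \<in> hom (Aut_complex X C) (Aut_complex Y D)"
    and "continuous_map (Aut_topology X C) (Aut_topology Y D) \<Phi>"
    and "(\<And>f \<sigma>. f \<in> cell_homeos X C \<Longrightarrow> (\<And>d. d \<in> D \<Longrightarrow> f ` pre d = pre d) \<Longrightarrow> \<sigma> \<in> C \<Longrightarrow> f ` \<sigma> = \<sigma>) \<Longrightarrow>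
      inj_on \<Phi> (carrier (Aut_complex X C))"
proof -
  note carX = Aut_complex_structure(1)[OF C(1)] and carY = Aut_complex_structure(1)[OF D(1)]
  have pre_ne: "pre d \<noteq> {}" and pre_sub: "pre d \<subseteq> topspace X" if d: "d \<in> D" for d
  proof -
    obtain A where A: "A \<subseteq> C" "A \<noteq> {}" "pre d = \<Union>A" using pre_cells[OF d] by blast
    then obtain a where "a \<in> A" "a \<noteq> {}" using C(2) by (metis all_not_in_conv subsetD)
    then show "pre d \<noteq> {}" using A(3) by blast
    show "pre d \<subseteq> topspace X" using A C(1) by blast
  qed
  have pre_inj: "d = d'" if "d \<in> D" "d' \<in> D" "pre d = pre d'" for d d'
    using pre_disjoint[OF that(1,2)] pre_ne[OF that(1)] that(3) by simp
  have pre_cong: "f ` pre d = f' ` pre d" if eq: "\<And>\<sigma>. \<sigma> \<in> C \<Longrightarrow> f ` \<sigma> = f' ` \<sigma>" and d: "d \<in> D"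
    for f f' :: "'a \<Rightarrow> 'a" and d
  proof -
    obtain A where "A \<subseteq> C" "pre d = \<Union>A" using pre_cells[OF d] by blast
    moreover have "(\<Union>\<sigma>\<in>A. f ` \<sigma>) = (\<Union>\<sigma>\<in>A. f' ` \<sigma>)"
      using eq \<open>A \<subseteq> C\<close> by (intro SUP_cong refl) blast
    ultimately show ?thesis by (simp add: image_Union)
  qed
  have self: "f \<in> cell_class X C f" if "f \<in> cell_homeos X C" for f and X :: "'z topology" and C
    using that by (simp add: cell_class_def)
  have \<Phi>: "\<Phi> (cell_class X C f) = cell_class Y D g"
    if f: "f \<in> cell_homeos X C" and g: "g \<in> cell_homeos Y D" "\<And>d. d \<in> D \<Longrightarrow> f ` pre d = pre (g ` d)" for f g
  proof (intro equalityI subsetI)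
    fix g' assume "g' \<in> \<Phi> (cell_class X C f)"
    then obtain f' where f': "f' \<in> cell_class X C f" "\<And>d. d \<in> D \<Longrightarrow> f' ` pre d = pre (g' ` d)"
      and g': "g' \<in> cell_homeos Y D" by (auto simp: \<Phi>_def)
    have "g' ` d = g ` d" if d: "d \<in> D" for d
    proof (rule pre_inj)
      show "pre (g' ` d) = pre (g ` d)"
        using f'(2)[OF d] g(2)[OF d] pre_cong[of f' f d] f'(1) d by (auto simp: cell_class_def)
    qed (use cell_homeosD(3) g' g(1) d in auto)
    then show "g' \<in> cell_class Y D g" using g' by (simp add: cell_class_def)
  next
    fix g' assume "g' \<in> cell_class Y D g"
    then show "g' \<in> \<Phi> (cell_class X C f)"
      using g(2) self[OF f] by (auto simp: \<Phi>_def cell_class_def)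
  qed
  obtain lift where lift: "\<And>f. f \<in> cell_homeos X C \<Longrightarrow> lift f \<in> cell_homeos Y D"
    "\<And>f d. f \<in> cell_homeos X C \<Longrightarrow> d \<in> D \<Longrightarrow> f ` pre d = pre (lift f ` d)"
    using ex by metis
  have \<Phi>_lift: "\<Phi> (cell_class X C f) = cell_class Y D (lift f)" if "f \<in> cell_homeos X C" for f
    using that lift by (intro \<Phi>)
  have \<Phi>_car: "\<Phi> F \<in> carrier (Aut_complex Y D)" if "F \<in> carrier (Aut_complex X C)" for F
    using that lift(1) by (auto simp: carX carY \<Phi>_lift)
  show "\<Phi> \<in> hom (Aut_complex X C) (Aut_complex Y D)"
  proof (rule homI)
    fix F F' assume "F \<in> carrier (Aut_complex X C)" "F' \<in> carrier (Aut_complex X C)"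
    then obtain f f' where f: "f \<in> cell_homeos X C" "F = cell_class X C f"
      "f' \<in> cell_homeos X C" "F' = cell_class X C f'" by (auto simp: carX)
    have "\<Phi> (cell_class X C (compose (topspace X) f f')) =
        cell_class Y D (compose (topspace Y) (lift f) (lift f'))"
    proof (rule \<Phi>)
      fix d assume d: "d \<in> D"
      then have "compose (topspace X) f f' ` pre d = f ` (f' ` pre d)" by (intro compose_image pre_sub)
      also have "\<dots> = pre (lift f ` (lift f' ` d))"
        using lift f d cell_homeosD(3)[OF lift(1)[OF f(3)] d] by simp
      also have "lift f ` (lift f' ` d) = compose (topspace Y) (lift f) (lift f') ` d"
        using D d by (intro compose_image[symmetric]) blast
      finally show "compose (topspace X) f f' ` pre d = pre (compose (topspace Y) (lift f) (lift f') ` d)" .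
    qed (use f lift(1) C(1) D(1) in \<open>auto intro!: cell_homeos_compose\<close>)
    then show "\<Phi> (F \<otimes>\<^bsub>Aut_complex X C\<^esub> F') = \<Phi> F \<otimes>\<^bsub>Aut_complex Y D\<^esub> \<Phi> F'"
      using f lift(1) by (simp add: Aut_complex_structure(2)[OF C(1)] Aut_complex_structure(2)[OF D(1)] \<Phi>_lift)
  qed (rule \<Phi>_car)
  show "continuous_map (Aut_topology X C) (Aut_topology Y D) \<Phi>"
    unfolding Aut_topology_def continuous_on_generated_topo_iff
  proof (intro conjI allI impI)
    let ?B = "{{F \<in> carrier (Aut_complex X C). \<exists>f\<in>F. f ` \<sigma> = \<tau>} |\<sigma> \<tau>. \<sigma> \<in> C \<and> \<tau> \<in> C}"
    let ?T = "topology_generated_by ?B"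
    have top: "topspace ?T \<subseteq> carrier (Aut_complex X C)" by auto
    {
      fix U assume "U \<in> {{F \<in> carrier (Aut_complex Y D). \<exists>f\<in>F. f ` \<sigma> = \<tau>} |\<sigma> \<tau>. \<sigma> \<in> D \<and> \<tau> \<in> D}"
      then obtain \<sigma> \<tau> where st: "\<sigma> \<in> D" "\<tau> \<in> D" "U = {G \<in> carrier (Aut_complex Y D). \<exists>g\<in>G. g ` \<sigma> = \<tau>}" by blast
      \<comment> \<open>A single cell \<open>e\<close> over \<open>\<sigma>\<close> decides whether
        \<open>\<sigma>\<close> goes to \<open>\<tau>\<close>, as the preimages are disjoint. So the
        inverse image of a subbasic set is a union of subbasic sets, one for each cell over
        \<open>\<tau>\<close>.\<close>
      obtain e where e: "e \<in> C" "e \<subseteq> pre \<sigma>" using pre_cells[OF st(1)] by blast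
      have iff: "\<Phi> F \<in> U \<longleftrightarrow> (\<exists>e'\<in>C. e' \<subseteq> pre \<tau> \<and> (\<exists>f\<in>F. f ` e = e'))"
        if F: "F \<in> carrier (Aut_complex X C)" for F
      proof -
        obtain f where f: "f \<in> cell_homeos X C" "F = cell_class X C f" using F by (auto simp: carX)
        have "\<Phi> F \<in> U \<longleftrightarrow> lift f ` \<sigma> = \<tau>"
        proof -
          have \<Phi>F: "\<Phi> F = cell_class Y D (lift f)" unfolding f(2) by (rule \<Phi>_lift[OF f(1)])
          have "g ` \<sigma> = lift f ` \<sigma>" if "g \<in> \<Phi> F" for g
            using that st(1) unfolding \<Phi>F cell_class_def by blast
          moreover have "lift f \<in> \<Phi> F" unfolding \<Phi>F by (rule self[OF lift(1)[OF f(1)]])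
          ultimately show ?thesis using \<Phi>_car[OF F] unfolding st(3) by blast
        qed
        also have "\<dots> \<longleftrightarrow> f ` e \<subseteq> pre \<tau>"
        proof
          assume "f ` e \<subseteq> pre \<tau>"
          moreover have "f ` e \<subseteq> pre (lift f ` \<sigma>)" using lift(2)[OF f(1) st(1)] e(2) by blast
          moreover have "f ` e \<noteq> {}" using e(1) C(2) by auto
          ultimately show "lift f ` \<sigma> = \<tau>"
            using cell_homeosD(3)[OF lift(1)[OF f(1)] st(1)] st(2) by (intro pre_disjoint) blast+
        qed (use lift(2)[OF f(1) st(1)] e(2) in blast)
        also have "\<dots> \<longleftrightarrow> (\<exists>e'\<in>C. e' \<subseteq> pre \<tau> \<and> (\<exists>f\<in>F. f ` e = e'))"
        proof -
          have "f' ` e = f ` e" if "f' \<in> F" for f' using that e(1) by (simp add: f(2) cell_class_def)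
          then show ?thesis using self[OF f(1)] cell_homeosD(3)[OF f(1) e(1)] f(2) by metis
        qed
        finally show ?thesis .
      qed
      have "\<Phi> -` U \<inter> topspace ?T =
          \<Union>{{F \<in> carrier (Aut_complex X C). \<exists>f\<in>F. f ` e = e'} | e'. e' \<in> C \<and> e' \<subseteq> pre \<tau>}" (is "_ = ?R")
      proof (intro equalityI subsetI)
        fix F assume "F \<in> \<Phi> -` U \<inter> topspace ?T"
        then show "F \<in> ?R" using top iff[of F] by blast
      next
        fix F assume "F \<in> ?R"
        then obtain e' where e': "e' \<in> C" "e' \<subseteq> pre \<tau>" "F \<in> carrier (Aut_complex X C)" "\<exists>f\<in>F. f ` e = e'" by blast
        then have "F \<in> topspace ?T" unfolding topology_generated_by_topspace using e(1) by blast
        then show "F \<in> \<Phi> -` U \<inter> topspace ?T" using e' iff[of F] by blast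
      qed
      moreover have "openin ?T ?R"
        using e(1) by (intro openin_Union) (blast intro: topology_generated_by_Basis)
      ultimately show "openin ?T (\<Phi> -` U \<inter> topspace ?T)" by simp
    }
    show "\<Phi> ` topspace ?T \<subseteq> \<Union>{{F \<in> carrier (Aut_complex Y D). \<exists>f\<in>F. f ` \<sigma> = \<tau>} |\<sigma> \<tau>. \<sigma> \<in> D \<and> \<tau> \<in> D}"
    proof
      fix G assume "G \<in> \<Phi> ` topspace ?T"
      then obtain F where "F \<in> carrier (Aut_complex X C)" "G = \<Phi> F" using top by blast
      then obtain f where f: "f \<in> cell_homeos X C" "G = cell_class Y D (lift f)"
        using \<Phi>_lift by (auto simp: carX)
      \<comment> \<open>The space of a generated topology is the union of its generators, so
        \<open>G\<close> has to be placed in one of them; any cell of \<open>D\<close>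
        serves.\<close>
      obtain d where "d \<in> D" using D(2) by blast
      moreover have "G \<in> carrier (Aut_complex Y D)" using f lift(1) by (simp add: carY)
      moreover have "lift f \<in> G" unfolding f(2) by (rule self[OF lift(1)[OF f(1)]])
      moreover have "lift f ` d \<in> D" using cell_homeosD(3)[OF lift(1)[OF f(1)]] \<open>d \<in> D\<close> .
      ultimately show "G \<in> \<Union>{{F \<in> carrier (Aut_complex Y D). \<exists>f\<in>F. f ` \<sigma> = \<tau>} |\<sigma> \<tau>. \<sigma> \<in> D \<and> \<tau> \<in> D}"
        by blast
    qed
  qed
  show "inj_on \<Phi> (carrier (Aut_complex X C))"
    if triv: "\<And>f \<sigma>. f \<in> cell_homeos X C \<Longrightarrow> (\<And>d. d \<in> D \<Longrightarrow> f ` pre d = pre d) \<Longrightarrow> \<sigma> \<in> C \<Longrightarrow> f ` \<sigma> = \<sigma>"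
  proof (rule inj_onI)
    fix F F' assume "F \<in> carrier (Aut_complex X C)" "F' \<in> carrier (Aut_complex X C)" and eq: "\<Phi> F = \<Phi> F'"
    then obtain f f' where f: "f \<in> cell_homeos X C" "F = cell_class X C f"
      "f' \<in> cell_homeos X C" "F' = cell_class X C f'" by (auto simp: carX)
    have same: "f ` pre d = f' ` pre d" if d: "d \<in> D" for d
    proof -
      have "lift f \<in> cell_class Y D (lift f')"
        using eq self[OF lift(1)[OF f(1)]] by (simp add: f(2,4) \<Phi>_lift[OF f(1)] \<Phi>_lift[OF f(3)])
      then show ?thesis using lift(2)[OF f(1) d] lift(2)[OF f(3) d] d by (simp add: cell_class_def)
    qed
    \<comment> \<open>With \<open>g\<close> the inverse of \<open>f'\<close>, the composition of
      \<open>f\<close> followed by \<open>g\<close> fixes every \<open>pre d\<close>, so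
      \<open>triv\<close> applies to it.\<close>
    define g where "g = restrict (inv_into (topspace X) f') (topspace X)"
    note g = cell_homeos_inverse[OF C(1) f(3), folded g_def]
    have "compose (topspace X) g f ` \<sigma> = \<sigma>" if "\<sigma> \<in> C" for \<sigma>
    proof (rule triv[OF cell_homeos_compose[OF C(1) g(1) f(1)] _ that])
      fix d assume d: "d \<in> D"
      then show "compose (topspace X) g f ` pre d = pre d"
        using pre_sub[OF d] same[OF d] g(2)[OF pre_sub[OF d]] by (simp add: compose_image)
    qed
    then have gf: "g ` (f ` \<sigma>) = \<sigma>" if "\<sigma> \<in> C" for \<sigma>
      using that C(1) by (simp add: compose_image subset_eq)
    have inj_g: "inj_on g (topspace X)" using cell_homeosD(1)[OF g(1)] by (rule bij_betw_imp_inj_on)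
    have "f ` \<sigma> = f' ` \<sigma>" if "\<sigma> \<in> C" for \<sigma>
    proof (rule inj_on_image_eq_iff[OF inj_g, THEN iffD1])
      show "g ` f ` \<sigma> = g ` f' ` \<sigma>" using gf[OF that] g(2)[of \<sigma>] that C(1) by auto
      show "f ` \<sigma> \<subseteq> topspace X" "f' ` \<sigma> \<subseteq> topspace X"
        using cell_homeosD(3)[OF f(1) that] cell_homeosD(3)[OF f(3) that] C(1) by auto
    qed
    then show "F = F'" by (auto simp: f(2,4) cell_class_def)
  qed
qed

section \<open>Loops in \<open>Z\<^sub>m\<^sub>,\<^sub>n\<close>\<close>

abbreviation Z_points :: "nat \<Rightarrow> nat \<Rightarrow> zpoint set" where
  "Z_points m n \<equiv> (\<Union>c\<in>zcells m n. zopen_cell c)"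

lemma a_path_in_Z: "a_path x \<in> Z_points m n"
  using frac_ge_0[of x] frac_lt_1[of x]
  by (auto simp: a_path_def zcells_def zopen_cell_def less_le)

lemma t_path_in_Z: "i < gcd m n \<Longrightarrow> 0 \<le> y \<Longrightarrow> y \<le> 1 \<Longrightarrow> t_path i y \<in> Z_points m n"
  by (auto simp: t_path_def zcells_def zopen_cell_def)

lemma zchar_in_Z:
  assumes m: "m > 0" and c: "c \<in> zcells m n" and u: "u \<in> closed_dom c"
  shows "zchar m n c u \<in> Z_points m n"
proof (cases c)
  case ZVertex
  then show ?thesis by (cases u) (auto simp: zcells_def zopen_cell_def)
next
  case ZHor
  then show ?thesis using a_path_in_Z by (cases u) auto
next
  case (ZVert i)
  then have "i < gcd m n" using c by (auto simp: zcells_def)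
  then show ?thesis using u ZVert t_path_in_Z[of i m n] by (cases u) auto
next
  case (ZFace i)
  then have i: "i < gcd m n" using c by (auto simp: zcells_def)
  obtain x y where xy: "u = (x, y)" "0 \<le> x" "x \<le> 1" "0 \<le> y" "y \<le> 1"
    using u ZFace by (cases u) auto
  have "Suc i mod gcd m n < gcd m n" using m by simp
  moreover have "(ZFace i, x, y) \<in> Z_points m n" if "y \<noteq> 0" "y \<noteq> 1" "x \<noteq> 0" "x \<noteq> 1"
    using that i xy by (auto simp: zcells_def zopen_cell_def)
  ultimately show ?thesis
    using ZFace xy i a_path_in_Z[of _ m n] t_path_in_Z[of _ m n] by auto
qed

lemma topspace_Z_complex: "m > 0 \<Longrightarrow> topspace (Z_complex m n) = Z_points m n"
  unfolding Z_complex_def by (rule topspace_weak_topology) (rule zchar_in_Z)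

lemma continuous_map_zchar:
  "m > 0 \<Longrightarrow> c \<in> zcells m n \<Longrightarrow>
    continuous_map (top_of_set (closed_dom c)) (Z_complex m n) (zchar m n c)"
  unfolding Z_complex_def by (rule continuous_map_characteristic) (rule zchar_in_Z)

lemma continuous_map_Z_complex_iff:
  assumes "m > 0"
  shows "continuous_map (Z_complex m n) Y f \<longleftrightarrow> f \<in> Z_points m n \<rightarrow> topspace Y \<and>
    (\<forall>c\<in>zcells m n. continuous_map (top_of_set (closed_dom c)) Y (\<lambda>u. f (zchar m n c u)))"
  unfolding Z_complex_def by (rule continuous_map_weak_topology) (rule zchar_in_Z[OF assms])

text \<open>\<open>A\<close>, \<open>T\<close> and \<open>F\<close> describe the function in model
  coordinates on the loop \<open>a\<close>, the loops \<open>t_i\<close> and the squares. The last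
  four hypotheses make the values on the sides of a square those read along the attaching
  word.\<close>

lemma continuous_map_Z_complexI:
  fixes \<phi> :: "zpoint \<Rightarrow> 'b::topological_space"
  assumes m: "m > 0"
    and A: "\<And>x. \<phi> (a_path x) = A x" "continuous_on {0..1} A"
    and T: "\<And>i y. i < gcd m n \<Longrightarrow> 0 \<le> y \<Longrightarrow> y \<le> 1 \<Longrightarrow> \<phi> (t_path i y) = T i y"
      "\<And>i. i < gcd m n \<Longrightarrow> continuous_on {0..1} (T i)"
    and F: "\<And>i x y. i < gcd m n \<Longrightarrow> 0 < x \<Longrightarrow> x < 1 \<Longrightarrow> 0 < y \<Longrightarrow> y < 1 \<Longrightarrow> \<phi> (ZFace i, x, y) = F i (x, y)"
      "\<And>i. i < gcd m n \<Longrightarrow> continuous_on ({0..1} \<times> {0..1}) (F i)"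
    and bottom: "\<And>i x. F i (x, 0) = A (real (n div gcd m n) * x)"
    and top: "\<And>i x. F i (x, 1) = A (real (m div gcd m n) * x)"
    and left: "\<And>i y. i < gcd m n \<Longrightarrow> F i (0, y) = T i y"
    and right: "\<And>i y. i < gcd m n \<Longrightarrow> F i (1, y) = T (Suc i mod gcd m n) y"
  shows "continuous_map (Z_complex m n) euclidean \<phi>"
  unfolding continuous_map_Z_complex_iff[OF m]
proof (intro conjI ballI)
  fix c assume c: "c \<in> zcells m n"
  have k: "Suc i mod gcd m n < gcd m n" for i using m by simp
  show "continuous_map (top_of_set (closed_dom c)) euclidean (\<lambda>u. \<phi> (zchar m n c u))"
  proof (cases c)
    case ZVertex
    then show ?thesis by simp
  next
    case ZHor
    have "continuous_on ({0..1} \<times> {0}) (\<lambda>u::real \<times> real. A (fst u))"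
      by (rule continuous_on_compose2[OF A(2)]) (auto intro: continuous_intros)
    then have "continuous_on ({0..1} \<times> {0}) (\<lambda>u. \<phi> (zchar m n c u))"
      by (rule continuous_on_eq) (auto simp: ZHor A)
    then show ?thesis using ZHor by simp
  next
    case (ZVert i)
    then have i: "i < gcd m n" using c by (auto simp: zcells_def)
    have "continuous_on ({0} \<times> {0..1}) (\<lambda>u::real \<times> real. T i (snd u))"
      by (rule continuous_on_compose2[OF T(2)[OF i]]) (auto intro: continuous_intros)
    then have "continuous_on ({0} \<times> {0..1}) (\<lambda>u. \<phi> (zchar m n c u))"
      by (rule continuous_on_eq) (auto simp: ZVert T i)
    then show ?thesis using ZVert by simp
  next
    case (ZFace i)
    then have i: "i < gcd m n" using c by (auto simp: zcells_def)
    have "continuous_on ({0..1} \<times> {0..1}) (\<lambda>u. \<phi> (zchar m n c u))"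
      by (rule continuous_on_eq[OF F(2)[OF i]])
        (auto simp: ZFace A T F i k bottom top left right)
    then show ?thesis using ZFace by simp
  qed
qed simp

section \<open>Circle-valued functions on the complex\<close>

lemma cis_of_int [simp]: "cis (2 * pi * (real_of_int j * real_of_int l)) = 1"
  "cis (2 * pi * real_of_int j) = 1" "cis (2 * pi * (real_of_int j * real l')) = 1" 
  by (auto intro!: cis_multiple_2pi simp: Ints_mult)

lemma cis_of_int_frac: "cis (2 * pi * (real_of_int b * frac x)) = cis (2 * pi * (real_of_int b * x))"
proof -
  have "2 * pi * (real_of_int b * x) =
      2 * pi * (real_of_int b * frac x) + 2 * pi * (real_of_int b * real_of_int \<lfloor>x\<rfloor>)"
    by (simp add: frac_def algebra_simps)
  then show ?thesis by (simp add: cis_mult[symmetric] del: cis_mult)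
qed

text \<open>The height itself jumps from 1 to 0 at the loop \<open>a\<close>; only its class modulo
  1 is continuous on the complex.\<close>

lemma continuous_map_height: 
  "m > 0 \<Longrightarrow> continuous_map (Z_complex m n) euclidean (\<lambda>z. cis (2 * pi * snd (snd z)))"
  by (rule continuous_map_Z_complexI[where A = "\<lambda>_. 1" and T = "\<lambda>_ y. cis (2 * pi * y)"
        and F = "\<lambda>_ u. cis (2 * pi * snd u)"])
    (auto simp: a_path_def t_path_def intro!: continuous_intros)

text \<open>The functions \<open>annulus_phase\<close> and \<open>circle_phase\<close> describe, away from the loop \<open>a\<close> and near
  it, the circle-valued map that rotates \<open>b\<close> times along \<open>a\<close>; they are cut off so as to be
  continuous on all of the complex.\<close>

definition annulus_phase :: "nat \<Rightarrow> int \<Rightarrow> zpoint \<Rightarrow> complex" where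
  "annulus_phase N b z = (case z of
      (ZFace i, x, y) \<Rightarrow> of_real (sin (pi * y)) * cis (2 * pi * (real_of_int b * (real N * x)))
    | (ZVert i, x, y) \<Rightarrow> of_real (sin (pi * y)) | _ \<Rightarrow> 0)"

definition circle_phase :: "nat \<Rightarrow> nat \<Rightarrow> int \<Rightarrow> zpoint \<Rightarrow> complex" where
  "circle_phase N M b z = (case z of
      (ZFace i, x, y) \<Rightarrow> of_real (max (cos (pi * y)) 0) * cis (2 * pi * (real_of_int b * (real N * x)))
          + of_real (max (- cos (pi * y)) 0) * cis (2 * pi * (real_of_int b * (real M * x)))
    | (ZVert i, x, y) \<Rightarrow> of_real \<bar>cos (pi * y)\<bar>
    | (ZHor, x, y) \<Rightarrow> cis (2 * pi * (real_of_int b * x)) | (ZVertex, x, y) \<Rightarrow> 1)"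

lemma continuous_map_annulus_phase:
  assumes "m > 0"
  shows "continuous_map (Z_complex m n) euclidean (annulus_phase (n div gcd m n) b)"
  by (rule continuous_map_Z_complexI[where A = "\<lambda>_. 0" and T = "\<lambda>_ y. of_real (sin (pi * y))"
        and F = "\<lambda>_ u. of_real (sin (pi * snd u)) *
          cis (2 * pi * (real_of_int b * (real (n div gcd m n) * fst u)))"])
    (use assms in \<open>auto simp: annulus_phase_def a_path_def t_path_def intro!: continuous_intros\<close>)

lemma continuous_map_circle_phase:
  assumes "m > 0"
  shows "continuous_map (Z_complex m n) euclidean (circle_phase (n div gcd m n) (m div gcd m n) b)"
proof -
  have *: "max c 0 + max (- c) 0 = \<bar>c\<bar>" for c :: real by auto
  have **: "complex_of_real (max c 0) + complex_of_real (max (- c) 0) = complex_of_real \<bar>c\<bar>" for c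
    by (metis * of_real_add)
  show ?thesis
  by (rule continuous_map_Z_complexI[where A = "\<lambda>x. cis (2 * pi * (real_of_int b * x))" and T = "\<lambda>_ y. of_real \<bar>cos (pi * y)\<bar>"
        and F = "\<lambda>_ u. of_real (max (cos (pi * snd u)) 0) *
          cis (2 * pi * (real_of_int b * (real (n div gcd m n) * fst u)))
          + of_real (max (- cos (pi * snd u)) 0) *
          cis (2 * pi * (real_of_int b * (real (m div gcd m n) * fst u)))"])
    (use assms in \<open>auto simp: circle_phase_def a_path_def t_path_def cis_of_int_frac **
      simp flip: distrib_right elim!: Ints_cases
      intro!: continuous_intros\<close>)
qed

section \<open>Winding along the boundary of a square\<close>

text \<open>The values of \<open>f\<close> are integer multiples of \<open>2 * pi * \<i>\<close>,
  and distinct ones have distance at least 1.\<close>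

lemma exp_eq_1_constant:
  fixes f :: "'a::topological_space \<Rightarrow> complex"
  assumes "connected S" "continuous_on S f" "\<And>u. u \<in> S \<Longrightarrow> exp (f u) = 1" "u \<in> S" "v \<in> S"
  shows "f u = f v"
proof -
  have "f constant_on S"
  proof (rule continuous_discrete_range_constant[OF assms(1,2)])
    fix x assume x: "x \<in> S"
    have "1 \<le> norm (f y - f x)" if y: "y \<in> S" "f y \<noteq> f x" for y
    proof -
      obtain i j :: int where ij: "Re (f x) = 0" "Re (f y) = 0" "Im (f x) = of_int (2 * i) * pi"
        "Im (f y) = of_int (2 * j) * pi"
        using assms(3)[OF x] assms(3)[OF y(1)] by (auto simp: exp_eq_1)
      then have "i \<noteq> j" using y(2) by (auto simp: complex_eq_iff)
      then have "1 \<le> \<bar>j - i\<bar>" by linarith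
      then have "1 \<le> 1 * \<bar>real_of_int (j - i)\<bar>" by (metis mult_1 of_int_1_le_iff of_int_abs)
      also have "\<dots> \<le> 2 * pi * \<bar>real_of_int (j - i)\<bar>"
        by (rule mult_right_mono) (use pi_gt3 in auto)
      also have "2 * pi * \<bar>real_of_int (j - i)\<bar> = \<bar>Im (f y - f x)\<bar>"
      proof -
        have "Im (f y - f x) = 2 * pi * real_of_int (j - i)"
          using ij by (simp add: algebra_simps)
        then show ?thesis by (simp only: abs_mult) simp
      qed
      also have "\<dots> \<le> norm (f y - f x)" by (rule abs_Im_le_cmod)
      finally show ?thesis .
    qed
    then show "\<exists>e>0. \<forall>y. y \<in> S \<and> f y \<noteq> f x \<longrightarrow> e \<le> norm (f y - f x)" by (intro exI[of _ 1]) auto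
  qed
  then show ?thesis using assms(4,5) by (auto simp: constant_on_def)
qed

lemma logarithm_on_square:
  fixes \<phi> :: "real \<times> real \<Rightarrow> complex"
  assumes "continuous_on ({0..1} \<times> {0..1}) \<phi>" "\<And>u. u \<in> {0..1} \<times> {0..1} \<Longrightarrow> \<phi> u \<noteq> 0"
  obtains \<psi> where "continuous_on ({0..1} \<times> {0..1}) \<psi>" "\<And>u. u \<in> {0..1} \<times> {0..1} \<Longrightarrow> \<phi> u = exp (\<psi> u)"
proof -
  have "contractible ({0..1::real} \<times> {0..1::real})"
    by (intro convex_imp_contractible convex_Times) auto
  from continuous_logarithm_on_contractible[OF assms(1) this] assms(2) that show thesis by metis
qed

text \<open>A logarithm of \<open>\<phi>\<close> exists because the square is contractible. It is
  constant on the three sides where \<open>\<phi>\<close> is 1, hence has equal values at the ends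
  of the fourth, along which it differs from \<open>\<i> * 2 * pi * \<theta>\<close> by a
  constant.\<close>

lemma square_winding:
  fixes \<phi> :: "real \<times> real \<Rightarrow> complex"
  assumes cont: "continuous_on ({0..1} \<times> {0..1}) \<phi>" and nz: "\<And>u. u \<in> {0..1} \<times> {0..1} \<Longrightarrow> \<phi> u \<noteq> 0"
    and bd: "\<And>t. t \<in> {0..1} \<Longrightarrow> \<phi> (1, t) = 1" "\<And>s. s \<in> {0..1} \<Longrightarrow> \<phi> (s, 0) = 1" "\<And>s. s \<in> {0..1} \<Longrightarrow> \<phi> (s, 1) = 1"
    and \<theta>: "continuous_on {0..1} \<theta>" "\<And>t. t \<in> {0..1} \<Longrightarrow> \<phi> (0, t) = cis (2 * pi * \<theta> t)"
  shows "\<theta> 1 = \<theta> 0"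
proof -
  obtain \<psi> where \<psi>: "continuous_on ({0..1} \<times> {0..1}) \<psi>" "\<And>u. u \<in> {0..1} \<times> {0..1} \<Longrightarrow> \<phi> u = exp (\<psi> u)"
    using logarithm_on_square[OF cont nz] by metis
  have c1: "continuous_on {0..1} (\<lambda>t. \<psi> (s, t))" and c2: "continuous_on {0..1} (\<lambda>t. \<psi> (t, s))"
    if "s \<in> {0..1}" for s
    using that by (auto intro!: continuous_on_compose2[OF \<psi>(1)] continuous_intros)
  have "\<psi> (1, 0) = \<psi> (1, 1)"
    by (rule exp_eq_1_constant[of "{0..1}" "\<lambda>t. \<psi> (1, t)"]) (use c1 bd \<psi>(2) in auto)
  moreover have "\<psi> (0, 0) = \<psi> (1, 0)"
    by (rule exp_eq_1_constant[of "{0..1}" "\<lambda>t. \<psi> (t, 0)"]) (use c2 bd \<psi>(2) in auto)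
  moreover have "\<psi> (0, 1) = \<psi> (1, 1)"
    by (rule exp_eq_1_constant[of "{0..1}" "\<lambda>t. \<psi> (t, 1)"]) (use c2 bd \<psi>(2) in auto)
  moreover have "\<psi> (0, 0) - \<i> * of_real (2 * pi * \<theta> 0) = \<psi> (0, 1) - \<i> * of_real (2 * pi * \<theta> 1)"
    by (rule exp_eq_1_constant[of "{0..1}" "\<lambda>t. \<psi> (0, t) - \<i> * of_real (2 * pi * \<theta> t)"])
      (use c1 \<theta> \<psi>(2)[symmetric] in \<open>auto simp: exp_diff cis_conv_exp intro!: continuous_intros\<close>)
  ultimately show ?thesis by simp
qed

lemma frac_eq_of_cis_eq:
  assumes "cis (2 * pi * r) = cis (2 * pi * y)" "0 \<le> y" "y < 1"
  shows "frac r = y"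
proof -
  have "sin (2 * pi * r) = sin (2 * pi * y) \<and> cos (2 * pi * r) = cos (2 * pi * y)"
    using assms(1) by (metis cis.simps(1) cis.simps(2))
  then obtain j :: int where "2 * pi * r = 2 * pi * y + 2 * pi * of_int j"
    using sin_cos_eq_iff[of "2 * pi * r" "2 * pi * y"] by auto
  then have "2 * pi * r = 2 * pi * (y + of_int j)" by (simp add: algebra_simps)
  then have "r = y + of_int j" by simp
  then show ?thesis using assms(2,3) by (simp add: frac_unique_iff)
qed

text \<open>Subtracting the integer part of \<open>r\<close> changes the sine and cosine of
  \<open>pi * r\<close> at most by a sign.\<close>

lemma abs_sin_frac: "\<bar>sin (pi * r)\<bar> = sin (pi * frac r)"
  and abs_cos_frac: "\<bar>cos (pi * r)\<bar> = \<bar>cos (pi * frac r)\<bar>"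
proof -
  have r: "pi * r = pi * frac r + of_int \<lfloor>r\<rfloor> * pi"
    by (simp add: frac_def algebra_simps)
  have "\<bar>sin (pi * r)\<bar> = \<bar>sin (pi * frac r)\<bar>" "\<bar>cos (pi * r)\<bar> = \<bar>cos (pi * frac r)\<bar>"
    unfolding r by (auto simp: sin_add cos_add abs_mult sin_zero_iff_int2 mult.commute[of _ pi])
  moreover have "0 \<le> sin (pi * frac r)"
    using frac_ge_0[of r] frac_lt_1[of r] by (intro sin_ge_zero) (auto simp: mult_left_le)
  ultimately show "\<bar>sin (pi * r)\<bar> = sin (pi * frac r)" "\<bar>cos (pi * r)\<bar> = \<bar>cos (pi * frac r)\<bar>" by auto
qed

section \<open>The circle-valued map with turning numbers depending on the height\<close>

text \<open>\<open>r\<close> is a real height of \<open>z\<close>, and \<open>\<beta> h\<close> the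
  number of turns along a horizontal 1-cell at height \<open>h\<close>. The bottom of a square
  consists of \<open>N\<close> such cells, so between the heights \<open>h\<close> and
  \<open>h + 1\<close> a square turns \<open>\<beta> h * N\<close> times; its top, made of
  \<open>M\<close> cells, has to turn equally often.\<close>

definition phase :: "nat \<Rightarrow> (int \<Rightarrow> int) \<Rightarrow> zpoint \<Rightarrow> real \<Rightarrow> complex" where
  "phase N \<beta> z r = (case z of
      (ZFace i, x, y) \<Rightarrow> cis (2 * pi * (real_of_int (\<beta> \<lfloor>r\<rfloor>) * (real N * x)))
    | (ZHor, x, y) \<Rightarrow> cis (2 * pi * (real_of_int (\<beta> \<lfloor>r\<rfloor>) * x)) | _ \<Rightarrow> 1)"

text \<open>The sine vanishes at integer heights, where the turning number of a square stops
  describing \<open>phase\<close>; elsewhere \<open>phase\<close> is a quotient of two functions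
  whose continuity is known.\<close>

lemma annulus_phase_eq:
  assumes z: "z \<in> Z_points m n" and r: "cis (2 * pi * r) = cis (2 * pi * snd (snd z))"
  shows "annulus_phase N (\<beta> \<lfloor>r\<rfloor>) z = of_real \<bar>sin (pi * r)\<bar> * phase N \<beta> z r"
proof -
  obtain c x y where zc: "z = (c, x, y)" by (cases z)
  have y: "0 \<le> y" "y < 1" using z zc by (auto simp: zcells_def zopen_cell_def)
  have "\<bar>sin (pi * r)\<bar> = sin (pi * y)"
    using frac_eq_of_cis_eq[OF _ y] r zc by (simp add: abs_sin_frac)
  then show ?thesis
    using z by (auto simp: zc annulus_phase_def phase_def zcells_def zopen_cell_def)
qed

text \<open>Within distance 1/2 of the height \<open>h\<close>, a point of a square is in the lower
  half of a square above or in the upper half of a square below. In the second case the square turns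
  \<open>\<beta> (h - 1) * N\<close> times, and the hypothesis on \<open>\<beta>\<close> converts
  this into the \<open>\<beta> h * M\<close> turns of \<open>circle_phase\<close>. The cosine
  vanishes halfway up, where the two formulas part.\<close>

lemma circle_phase_eq:
  assumes z: "z \<in> Z_points m n" and r: "cis (2 * pi * r) = cis (2 * pi * snd (snd z))"
    and h: "\<bar>r - of_int h\<bar> < 1/2" and \<beta>: "\<beta> (h - 1) * int N = \<beta> h * int M"
  shows "circle_phase N M (\<beta> h) z = of_real \<bar>cos (pi * r)\<bar> * phase N \<beta> z r"
proof -
  obtain c x y where zc: "z = (c, x, y)" by (cases z)
  have y: "0 \<le> y" "y < 1" using z zc by (auto simp: zcells_def zopen_cell_def)
  have fr: "frac r = y" using frac_eq_of_cis_eq[OF _ y] r zc by simp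
  then have abs_cos: "\<bar>cos (pi * r)\<bar> = \<bar>cos (pi * y)\<bar>"
    using abs_cos_frac[of r] by simp
  have ry: "r = of_int \<lfloor>r\<rfloor> + y" using fr by (simp add: frac_def)
  consider "\<lfloor>r\<rfloor> = h" "y < 1/2" | "\<lfloor>r\<rfloor> = h - 1" "y > 1/2"
    using h ry y by (smt (verit) floor_correct of_int_1_less_iff of_int_diff of_int_less_iff of_int_1 field_sum_of_halves linorder_not_less)
  then show ?thesis
  proof cases
    case 1
    have "0 \<le> pi * y" "pi * y < pi * (1/2)" using y 1 by (auto intro: mult_strict_left_mono)
    then have "0 < cos (pi * y)" using pi_gt_zero by (intro cos_gt_zero_pi) linarith+
    then show ?thesis using z 1
      by (auto simp: zc circle_phase_def phase_def zcells_def zopen_cell_def abs_cos)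
  next
    case 2
    have "cos (pi * y) < 0"
    proof -
      have "pi * y < pi * 1" "pi * (1/2) < pi * y" using y 2 by (auto intro: mult_strict_left_mono)
      then have "0 < cos (pi - pi * y)" using pi_gt_zero by (intro cos_gt_zero_pi) linarith+
      then show ?thesis by simp
    qed
    have "real_of_int (\<beta> (h - 1)) * real N = real_of_int (\<beta> h) * real M"
      using \<beta> by (metis of_int_mult of_int_of_nat_eq)
    then have e: "real_of_int (\<beta> (h - 1)) * (real N * x) = real_of_int (\<beta> h) * (real M * x)"
      by (simp flip: mult.assoc)
    show ?thesis using z 2 y \<open>cos (pi * y) < 0\<close>
      by (auto simp: e zc circle_phase_def phase_def zcells_def zopen_cell_def abs_cos)
  qed
qed

text \<open>Near each point \<open>f\<close> is a quotient of continuous functions that may depend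
  on the point. The filter \<open>at u within S\<close> leaves out \<open>u\<close>, hence the
  separate equation at \<open>u\<close>.\<close>

lemma continuous_on_locally_quotient:
  fixes f :: "'a::topological_space \<Rightarrow> complex"
  assumes "\<And>u. u \<in> S \<Longrightarrow> \<exists>g d. continuous_on S g \<and> continuous_on S d \<and> d u \<noteq> (0::real) \<and>
    (\<forall>\<^sub>F v in at u within S. g v = of_real (d v) * f v) \<and> g u = of_real (d u) * f u"
  shows "continuous_on S f"
  unfolding continuous_on_def
proof
  fix u assume u: "u \<in> S"
  then obtain g d where g: "continuous_on S g" "continuous_on S d" "d u \<noteq> 0"
    "\<forall>\<^sub>F v in at u within S. g v = of_real (d v) * f v" "g u = of_real (d u) * f u"
    using assms by blast
  have d: "(d \<longlongrightarrow> d u) (at u within S)" using g(2) u by (auto simp: continuous_on_def)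
  have "((\<lambda>v. g v / of_real (d v)) \<longlongrightarrow> g u / of_real (d u)) (at u within S)"
    using g(1,3) u d by (intro tendsto_intros) (auto simp: continuous_on_def)
  moreover have "\<forall>\<^sub>F v in at u within S. g v / of_real (d v) = f v"
    using g(4) tendsto_imp_eventually_ne[OF d g(3)] by eventually_elim simp
  ultimately show "(f \<longlongrightarrow> f u) (at u within S)"
    using g(3,5) tendsto_cong by fastforce
qed

text \<open>The rotation numbers are scaled by a power of \<open>N * M\<close> so that they are integers at all the
  heights that occur.\<close>

lemma horizontal_loop_not_nullhomotopic:
  fixes K :: "real \<times> real \<Rightarrow> zpoint"
  assumes m: "m > 0" and n: "n > 0"
    and K: "continuous_map (top_of_set ({0..1} \<times> {0..1})) (Z_complex m n) K"
    and K0: "\<And>t. t \<in> {0..1} \<Longrightarrow> K (0, t) = a_path (real L * t)"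
    and bd: "\<And>t. t \<in> {0..1} \<Longrightarrow> K (1, t) = (ZVertex, 0, 0)"
      "\<And>s. s \<in> {0..1} \<Longrightarrow> K (s, 0) = (ZVertex, 0, 0)" "\<And>s. s \<in> {0..1} \<Longrightarrow> K (s, 1) = (ZVertex, 0, 0)"
  shows "L = 0"
proof -
  let ?Q = "{0..1} \<times> {0..1} :: (real \<times> real) set"
  define N M where "N = n div gcd m n" and "M = m div gcd m n"
  have NM: "N > 0" "M > 0"
    using m n by (auto simp: N_def M_def div_greater_zero_iff intro: gcd_le1_nat gcd_le2_nat)
  have compK: "continuous_on ?Q (\<lambda>u. g (K u))"
    if "continuous_map (Z_complex m n) euclidean g" for g :: "zpoint \<Rightarrow> complex"
    using continuous_map_compose[OF K that] by (simp add: comp_def)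
  have KZ: "K u \<in> Z_points m n" if "u \<in> ?Q" for u
    using K that topspace_Z_complex[OF m, of n] unfolding continuous_map_def by fastforce
  let ?ht = "\<lambda>z. cis (2 * pi * snd (snd z))"
  obtain \<psi> where \<psi>: "continuous_on ?Q \<psi>" "\<And>u. u \<in> ?Q \<Longrightarrow> ?ht (K u) = exp (\<psi> u)"
    using logarithm_on_square[OF compK[OF continuous_map_height[OF m]]] by (metis cis_neq_zero)
  \<comment> \<open>A real height on the square, measured in turns and normalised to 0 at the
    corner, so that the side carrying the loop has height 0.\<close>
  define \<eta> where "\<eta> u = (Im (\<psi> u) - Im (\<psi> (0, 0))) / (2 * pi)" for u
  have \<eta>_cont: "continuous_on ?Q \<eta>"
    unfolding \<eta>_def by (intro continuous_intros \<psi>(1)) auto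
  have \<psi>_cis: "exp (\<psi> u) = cis (Im (\<psi> u))" if "u \<in> ?Q" for u
  proof -
    have "norm (exp (\<psi> u)) = 1" using \<psi>(2)[OF that] by (metis norm_cis)
    then have "exp (Re (\<psi> u)) = 1" by simp
    then show ?thesis by (simp add: exp_eq_polar)
  qed
  have "?ht (K (0, 0)) = 1" using bd(2)[of 0] by simp
  then have "cis (Im (\<psi> (0, 0))) = 1" using \<psi>(2)[of "(0, 0)"] \<psi>_cis[of "(0, 0)"] by simp
  then have \<eta>: "cis (2 * pi * \<eta> u) = ?ht (K u)" if "u \<in> ?Q" for u
    using \<psi>(2)[OF that] \<psi>_cis[OF that] by (simp add: \<eta>_def cis_divide[symmetric])
  have ht_a: "?ht (a_path x) = 1" for x by (simp add: a_path_def)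
  have \<eta>0: "\<eta> (0, t) = 0" if t: "t \<in> {0..1}" for t
  proof -
    have "\<psi> (0, t) = \<psi> (0, 0)"
    proof (rule exp_eq_1_constant[of "{0..1}" "\<lambda>t. \<psi> (0, t)"])
      show "continuous_on {0..1} (\<lambda>t. \<psi> (0, t))"
        by (auto intro!: continuous_on_compose2[OF \<psi>(1)] continuous_intros)
      show "exp (\<psi> (0, t)) = 1" if "t \<in> {0..1}" for t
        using that \<psi>(2)[of "(0, t)"] K0[of t] ht_a[of "real L * t"] by simp
    qed (use t in auto)
    then show ?thesis by (simp add: \<eta>_def)
  qed
  have "compact (\<eta> ` ?Q)" by (intro compact_continuous_image \<eta>_cont compact_Times) auto
  then obtain b where b: "\<And>u. u \<in> ?Q \<Longrightarrow> \<bar>\<eta> u\<bar> \<le> b"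
    using compact_imp_bounded bounded_iff by (metis image_eqI real_norm_def)
  \<comment> \<open>The margin 2 makes every integer height that occurs lie strictly between
    \<open>- C\<close> and \<open>C\<close>, as \<open>\<beta>_step\<close> requires.\<close>
  define C where "C = \<lceil>b\<rceil> + 2"
  have C: "\<bar>\<eta> u\<bar> + 2 \<le> of_int C" if "u \<in> ?Q" for u using b[OF that] unfolding C_def by linarith
  \<comment> \<open>The recursion in \<open>\<beta>_step\<close> is solved by the powers of
    \<open>N / M\<close>. Since \<open>nat\<close> truncates negative exponents to 0, it is claimed
    only between \<open>- C\<close> and \<open>C\<close>.\<close>
  define \<beta> where "\<beta> h = int (N ^ nat (C + h) * M ^ nat (C - h))" for h
  have \<beta>_step: "\<beta> (h - 1) * int N = \<beta> h * int M" if h: "- C < h" "h < C" for h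
  proof -
    have "nat (C + h) = Suc (nat (C + (h - 1)))" "nat (C - (h - 1)) = Suc (nat (C - h))"
      using h by auto
    then show ?thesis by (simp add: \<beta>_def)
  qed
  define \<phi> where "\<phi> u = phase N \<beta> (K u) (\<eta> u)" for u
  have near: "\<forall>\<^sub>F v in at u within ?Q. \<eta> v \<in> W \<and> v \<in> ?Q" if "open W" "\<eta> u \<in> W" "u \<in> ?Q" for u W
  proof -
    have "(\<eta> \<longlongrightarrow> \<eta> u) (at u within ?Q)" using \<eta>_cont that by (auto simp: continuous_on_def)
    then have "\<forall>\<^sub>F v in at u within ?Q. \<eta> v \<in> W" using that by (auto dest: topological_tendstoD)
    moreover have "\<forall>\<^sub>F v in at u within ?Q. v \<in> ?Q" by (simp add: eventually_at_filter)
    ultimately show ?thesis by eventually_elim simp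
  qed
  have \<phi>_cont: "continuous_on ?Q \<phi>"
  proof (rule continuous_on_locally_quotient)
    fix u assume u: "u \<in> ?Q"
    show "\<exists>g d. continuous_on ?Q g \<and> continuous_on ?Q d \<and> d u \<noteq> (0::real) \<and>
      (\<forall>\<^sub>F v in at u within ?Q. g v = of_real (d v) * \<phi> v) \<and> g u = of_real (d u) * \<phi> u"
    \<comment> \<open>Off the integers the floor of \<open>\<eta>\<close> is locally constant and
      \<open>annulus_phase\<close> applies; at an integer height the floor jumps and
      \<open>circle_phase\<close> covers both sides of the jump.\<close>
    proof (cases "\<eta> u \<in> \<int>")
      case False
      let ?g = "\<lambda>v. annulus_phase N (\<beta> \<lfloor>\<eta> u\<rfloor>) (K v)" and ?d = "\<lambda>v. \<bar>sin (pi * \<eta> v)\<bar>"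
      have "continuous_on ?Q ?g"
        unfolding N_def by (intro compK continuous_map_annulus_phase m)
      moreover have "continuous_on ?Q ?d" by (intro continuous_intros \<eta>_cont)
      moreover have "?d u \<noteq> 0"
        using False by (auto simp: sin_zero_iff_int2)
      moreover have eq: "?g v = of_real (?d v) * \<phi> v" if "v \<in> ?Q" "\<lfloor>\<eta> v\<rfloor> = \<lfloor>\<eta> u\<rfloor>" for v
        using annulus_phase_eq[OF KZ[OF that(1)] \<eta>[OF that(1)], of N \<beta>] that(2) by (simp add: \<phi>_def)
      moreover have "\<forall>\<^sub>F v in at u within ?Q. ?g v = of_real (?d v) * \<phi> v"
      proof -
        have "\<eta> u \<in> {of_int \<lfloor>\<eta> u\<rfloor><..<of_int \<lfloor>\<eta> u\<rfloor> + 1}"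
        proof -
          have "\<eta> u \<noteq> of_int \<lfloor>\<eta> u\<rfloor>" using False by (metis Ints_of_int)
          then show ?thesis using floor_correct[of "\<eta> u"] by (auto simp: less_le)
        qed
        from near[OF open_greaterThanLessThan this u] show ?thesis
        proof (rule eventually_mono)
          fix v assume "\<eta> v \<in> {of_int \<lfloor>\<eta> u\<rfloor><..<of_int \<lfloor>\<eta> u\<rfloor> + 1} \<and> v \<in> ?Q"
          then show "?g v = of_real (?d v) * \<phi> v" by (intro eq) (auto simp: floor_eq_iff)
        qed
      qed
      ultimately show ?thesis using eq[OF u refl] by (intro exI[of _ ?g] exI[of _ ?d]) simp
    next
      case True
      then obtain h where h: "\<eta> u = of_int h" by (auto elim: Ints_cases)
      have "- C < h" "h < C" using C[OF u] h by linarith+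
      then have step: "\<beta> (h - 1) * int N = \<beta> h * int M" by (rule \<beta>_step)
      let ?g = "\<lambda>v. circle_phase N M (\<beta> h) (K v)" and ?d = "\<lambda>v. \<bar>cos (pi * \<eta> v)\<bar>"
      have "continuous_on ?Q ?g"
        unfolding N_def M_def by (intro compK continuous_map_circle_phase m)
      moreover have "continuous_on ?Q ?d" by (intro continuous_intros \<eta>_cont)
      moreover have "?d u \<noteq> 0" unfolding h by simp
      moreover have eq: "?g v = of_real (?d v) * \<phi> v" if "v \<in> ?Q" "\<bar>\<eta> v - of_int h\<bar> < 1/2" for v
        using circle_phase_eq[OF KZ[OF that(1)] \<eta>[OF that(1)] that(2), of \<beta>, OF step] by (simp add: \<phi>_def)
      moreover have "\<forall>\<^sub>F v in at u within ?Q. ?g v = of_real (?d v) * \<phi> v"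
      proof -
        have "\<eta> u \<in> {of_int h - 1/2<..<of_int h + 1/2}" using h by auto
        from near[OF open_greaterThanLessThan this u] show ?thesis
        proof (rule eventually_mono)
          fix v assume "\<eta> v \<in> {of_int h - 1/2<..<of_int h + 1/2} \<and> v \<in> ?Q"
          then have v: "v \<in> ?Q" "of_int h - 1/2 < \<eta> v" "\<eta> v < of_int h + 1/2"
            by (simp_all only: greaterThanLessThan_iff)
          then have "\<bar>\<eta> v - of_int h\<bar> < 1/2" by linarith
          with v(1) show "?g v = of_real (?d v) * \<phi> v" by (rule eq)
        qed
      qed
      ultimately show ?thesis using eq[OF u] h by (intro exI[of _ ?g] exI[of _ ?d]) simp
    qed
  qed
  have phase_a: "phase N \<beta> (a_path x) 0 = cis (2 * pi * (real_of_int (\<beta> 0) * x))" for x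
    by (auto simp: phase_def a_path_def cis_of_int_frac elim!: Ints_cases)
  have phase_v: "phase N \<beta> (ZVertex, 0, 0) r = 1" for r by (simp add: phase_def)
  \<comment> \<open>The side with the loop turns \<open>\<beta> 0 * L\<close> times, the other three
    sides not at all.\<close>
  have "real_of_int (\<beta> 0) * (real L * 1) = real_of_int (\<beta> 0) * (real L * 0)"
  proof (rule square_winding[OF \<phi>_cont, where \<theta> = "\<lambda>t. real_of_int (\<beta> 0) * (real L * t)"])
    show "\<phi> u \<noteq> 0" for u
      by (auto simp: \<phi>_def phase_def split: prod.split zcell.split)
    show "\<phi> (0, t) = cis (2 * pi * (real_of_int (\<beta> 0) * (real L * t)))" if "t \<in> {0..1}" for t
      unfolding \<phi>_def K0[OF that] \<eta>0[OF that] phase_a ..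
  qed (auto simp: \<phi>_def bd phase_v intro!: continuous_intros)
  moreover have "\<beta> 0 > 0" using NM by (simp add: \<beta>_def)
  ultimately show ?thesis by simp
qed

text \<open>The height modulo 1 is a function on the whole complex, so the winding argument applies
  to it directly; \<open>\<theta>\<close> is a real height along the first side.\<close>

lemma vertical_loop_not_nullhomotopic:
  fixes K :: "real \<times> real \<Rightarrow> zpoint"
  assumes m: "m > 0"
    and K: "continuous_map (top_of_set ({0..1} \<times> {0..1})) (Z_complex m n) K"
    and bd: "\<And>t. t \<in> {0..1} \<Longrightarrow> K (1, t) = (ZVertex, 0, 0)"
      "\<And>s. s \<in> {0..1} \<Longrightarrow> K (s, 0) = (ZVertex, 0, 0)" "\<And>s. s \<in> {0..1} \<Longrightarrow> K (s, 1) = (ZVertex, 0, 0)"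
    and \<theta>: "continuous_on {0..1} \<theta>"
      "\<And>t. t \<in> {0..1} \<Longrightarrow> cis (2 * pi * snd (snd (K (0, t)))) = cis (2 * pi * \<theta> t)"
  shows "\<theta> 1 = \<theta> 0"
proof (rule square_winding[where \<phi> = "\<lambda>u. cis (2 * pi * snd (snd (K u)))"])
  show "continuous_on ({0..1} \<times> {0..1}) (\<lambda>u. cis (2 * pi * snd (snd (K u))))"
    using continuous_map_compose[OF K continuous_map_height[OF m]] by (simp add: comp_def)
qed (use \<theta> in \<open>auto simp: bd\<close>)

section \<open>The Hausdorff property of the complex\<close>

lemma Hausdorff_space_of_separating:
  assumes "\<And>x y. x \<in> topspace X \<Longrightarrow> y \<in> topspace X \<Longrightarrow> x \<noteq> y \<Longrightarrow>
    \<exists>f :: 'a \<Rightarrow> 'b::t2_space. continuous_map X euclidean f \<and> f x \<noteq> f y"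
  shows "Hausdorff_space X"
  unfolding Hausdorff_space_def
proof (intro allI impI)
  fix x y assume xy: "x \<in> topspace X \<and> y \<in> topspace X \<and> x \<noteq> y"
  then obtain f :: "'a \<Rightarrow> 'b" where f: "continuous_map X euclidean f" "f x \<noteq> f y"
    using assms by blast
  then obtain U V where "open U" "open V" "f x \<in> U" "f y \<in> V" "U \<inter> V = {}"
    using hausdorff by metis
  then show "\<exists>U V. openin X U \<and> openin X V \<and> x \<in> U \<and> y \<in> V \<and> disjnt U V"
    using xy f(1)
    by (intro exI[of _ "{z \<in> topspace X. f z \<in> U}"] exI[of _ "{z \<in> topspace X. f z \<in> V}"])
      (auto simp: continuous_map_def disjnt_def)
qed

text \<open>Three kinds of continuous functions separate points: \<open>face i\<close> singles out
  each point of a 2-cell, \<open>edge i\<close> each point of a vertical 1-cell among the points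
  outside the 2-cells, and \<open>hor\<close> separates the points of the loop
  \<open>a\<close>.\<close>

lemma Hausdorff_Z_complex:
  assumes m: "m > 0"
  shows "Hausdorff_space (Z_complex m n)"
proof (rule Hausdorff_space_of_separating)
  let ?k = "gcd m n" and ?N = "n div gcd m n" and ?M = "m div gcd m n"
  let ?b = "\<lambda>y::real. y * (1 - y)"
  \<comment> \<open>The weight \<open>?b x * ?b y\<close> vanishes on the boundary, so extension by
    0 is continuous; dividing the other two components by it recovers the point.\<close>
  define face where "face i z = (case z of (ZFace j, x, y) \<Rightarrow>
      if j = i then (?b x * ?b y, ?b x * ?b y * x, ?b x * ?b y * y) else 0 | _ \<Rightarrow> (0::real \<times> real \<times> real))"
    for i and z :: zpoint
  have face: "continuous_map (Z_complex m n) euclidean (face i)" for i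
  proof (rule continuous_map_Z_complexI[where A = "\<lambda>_. 0" and T = "\<lambda>_ _. 0"
        and F = "\<lambda>j u. if j = i then (?b (fst u) * ?b (snd u), ?b (fst u) * ?b (snd u) * fst u,
          ?b (fst u) * ?b (snd u) * snd u) else 0"])
    show "continuous_on ({0..1} \<times> {0..1}) (\<lambda>u. if j = i then (?b (fst u) * ?b (snd u), ?b (fst u) * ?b (snd u) * fst u,
          ?b (fst u) * ?b (snd u) * snd u) else (0::real \<times> real \<times> real))" for j
      by (cases "j = i") (auto intro!: continuous_intros)
  qed (use m in \<open>auto simp: face_def a_path_def t_path_def zero_prod_def intro!: continuous_intros\<close>)
  \<comment> \<open>On a square the values on the left and the right side are weighted with
    \<open>1 - x\<close> and \<open>x\<close>. For \<open>k = 1\<close> both sides are the same edge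
    and the weights add up to 1.\<close>
  define edge where "edge i z = (case z of (ZFace j, x, y) \<Rightarrow>
      ((if j = i then 1 - x else 0) + (if Suc j mod ?k = i then x else 0)) *\<^sub>R (?b y, ?b y * y, 0)
      | (ZVert j, x, y) \<Rightarrow> if j = i then (?b y, ?b y * y, 0) else 0 | _ \<Rightarrow> (0::real \<times> real \<times> real))"
    for i and z :: zpoint
  have edge: "continuous_map (Z_complex m n) euclidean (edge i)" for i
  proof (rule continuous_map_Z_complexI[where A = "\<lambda>_. 0" and T = "\<lambda>j y. if j = i then (?b y, ?b y * y, 0) else 0"
        and F = "\<lambda>j u. ((if j = i then 1 - fst u else 0) + (if Suc j mod ?k = i then fst u else 0)) *\<^sub>R
          (?b (snd u), ?b (snd u) * snd u, 0)"])
    show "continuous_on ({0..1} \<times> {0..1}) (\<lambda>u. ((if j = i then 1 - fst u else 0) + (if Suc j mod ?k = i then fst u else 0)) *\<^sub>R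
          (?b (snd u), ?b (snd u) * snd u, 0::real))" for j
      by (cases "j = i"; cases "Suc j mod ?k = i") (auto intro!: continuous_intros)
    show "continuous_on {0..1} (\<lambda>y. if j = i then (?b y, ?b y * y, 0) else (0::real \<times> real \<times> real))" for j
      by (cases "j = i") (auto intro!: continuous_intros)
  qed (use m in \<open>auto simp: edge_def a_path_def t_path_def zero_prod_def intro!: continuous_intros\<close>)
  \<comment> \<open>Linear interpolation between \<open>?N\<close> turns at the bottom and
    \<open>?M\<close> turns at the top. Inside a square it may leave the unit circle; what counts is
    continuity and the values on the loop \<open>a\<close>.\<close>
  define hor where "hor z = (case z of (ZFace j, x, y) \<Rightarrow>
      of_real (1 - y) * cis (2 * pi * (real ?N * x)) + of_real y * cis (2 * pi * (real ?M * x))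
      | (ZHor, x, y) \<Rightarrow> cis (2 * pi * x) | _ \<Rightarrow> 1)" for z :: zpoint
  have hor: "continuous_map (Z_complex m n) euclidean hor"
    using cis_of_int_frac[of 1] cis_of_int(2)[of "int _"]
    by (intro continuous_map_Z_complexI[where A = "\<lambda>x. cis (2 * pi * x)" and T = "\<lambda>_ _. 1"
        and F = "\<lambda>j u. of_real (1 - snd u) * cis (2 * pi * (real ?N * fst u)) +
          of_real (snd u) * cis (2 * pi * (real ?M * fst u))"])
     (use m in \<open>auto simp: hor_def a_path_def t_path_def intro!: continuous_intros elim!: Ints_cases\<close>)
  \<comment> \<open>The separation criterion wants all functions to have one target type, so both
    kinds of values are padded with 0.\<close>
  have emb: "continuous_map (Z_complex m n) euclidean (\<lambda>z. (f z, 0::complex))"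
    if "continuous_map (Z_complex m n) euclidean f" for f :: "zpoint \<Rightarrow> real \<times> real \<times> real"
    using continuous_map_pairedI[OF that, of euclidean "\<lambda>_. 0"] by simp
  have emb': "continuous_map (Z_complex m n) euclidean (\<lambda>z. (0::real \<times> real \<times> real, hor z))"
    using continuous_map_pairedI[OF _ hor, of euclidean "\<lambda>_. 0"] by simp
  fix z w assume zw: "z \<in> topspace (Z_complex m n)" "w \<in> topspace (Z_complex m n)" "z \<noteq> w"
  obtain c x y where z: "z = (c, x, y)" by (cases z)
  obtain c' x' y' where w: "w = (c', x', y')" by (cases w)
  have zc: "c \<in> zcells m n" "(x, y) \<in> open_dom c" and wc: "c' \<in> zcells m n" "(x', y') \<in> open_dom c'"
    using zw by (auto simp: topspace_Z_complex[OF m] z w zopen_cell_def)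
  have face_inj: "face i (c, x, y) = face i w \<Longrightarrow> (c, x, y) = w"
    if "c = ZFace i" "(x, y) \<in> open_dom c" "snd w \<in> open_dom (fst w)" for i c x y w
  proof -
    assume eq: "face i (c, x, y) = face i w"
    obtain c' x' y' where w: "w = (c', x', y')" by (cases w)
    have p: "?b x * ?b y \<noteq> 0" using that by auto
    then have c': "c' = ZFace i"
      using eq that(1) unfolding face_def w by (cases c') (auto simp: zero_prod_def split: if_splits)
    with eq that(1) have "?b x * ?b y = ?b x' * ?b y'" "?b x * ?b y * x = ?b x' * ?b y' * x'"
      "?b x * ?b y * y = ?b x' * ?b y' * y'" unfolding face_def w by auto
    then have "x = x'" "y = y'" using p by (metis mult_cancel_left)+
    then show ?thesis using that(1) c' w by simp
  qed
  have edge_inj: "edge i (c, x, y) = edge i w \<Longrightarrow> (c, x, y) = w"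
    if "c = ZVert i" "(x, y) \<in> open_dom c" "snd w \<in> open_dom (fst w)" "fst w \<notin> range ZFace" for i c x y w
  proof -
    assume eq: "edge i (c, x, y) = edge i w"
    obtain c' x' y' where w: "w = (c', x', y')" by (cases w)
    have p: "?b y \<noteq> 0" using that by auto
    then have c': "c' = ZVert i"
      using eq that(1,4) unfolding edge_def w by (cases c') (auto simp: zero_prod_def split: if_splits)
    with eq that(1) have "?b y = ?b y'" "?b y * y = ?b y' * y'" unfolding edge_def w by auto
    then have "y = y'" using p by (metis mult_cancel_left)
    then show ?thesis using that c' w by simp
  qed
  have "(\<exists>i. face i z \<noteq> face i w) \<or> (\<exists>i. edge i z \<noteq> edge i w) \<or> hor z \<noteq> hor w"
  proof (cases "(\<exists>i. c = ZFace i) \<or> (\<exists>i. c' = ZFace i)")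
    case True
    then obtain i where i: "c = ZFace i \<or> c' = ZFace i" by blast
    have "face i z \<noteq> face i w"
      using i zc wc zw(3) face_inj[of c i x y w] face_inj[of c' i x' y' z] by (auto simp: z w)
    then show ?thesis by blast
  next
    case nf: False
    then have nf': "c \<notin> range ZFace" "c' \<notin> range ZFace" by auto
    show ?thesis
    proof (cases "(\<exists>i. c = ZVert i) \<or> (\<exists>i. c' = ZVert i)")
      case True
      then obtain i where i: "c = ZVert i \<or> c' = ZVert i" by blast
      have "edge i z \<noteq> edge i w"
        using i zc wc zw(3) nf' edge_inj[of c i x y w] edge_inj[of c' i x' y' z] by (auto simp: z w)
      then show ?thesis by blast
    next
      case False
      have inj: "s = t" if "cis (2 * pi * s) = cis (2 * pi * t)" "0 \<le> s" "s < 1" "0 \<le> t" "t < 1" for s t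
        using frac_eq_of_cis_eq[of s t] that by (simp add: frac_eq)
      have "c \<in> {ZVertex, ZHor}" "c' \<in> {ZVertex, ZHor}"
        using False nf zc wc by (auto simp: zcells_def)
      then have "hor z \<noteq> hor w"
        using zc wc zw(3) inj[of x x'] inj[of x 0] inj[of 0 x'] by (auto simp: z w hor_def)
      then show ?thesis by blast
    qed
  qed
  then show "\<exists>f :: zpoint \<Rightarrow> (real \<times> real \<times> real) \<times> complex.
      continuous_map (Z_complex m n) euclidean f \<and> f z \<noteq> f w"
  proof (elim disjE exE)
    show ?thesis if "face i z \<noteq> face i w" for i using that emb[OF face[of i]] by (intro exI[of _ "\<lambda>z. (face i z, 0)"]) auto
    show ?thesis if "edge i z \<noteq> edge i w" for i using that emb[OF edge[of i]] by (intro exI[of _ "\<lambda>z. (edge i z, 0)"]) auto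
    show ?thesis if "hor z \<noteq> hor w" using that emb' by (intro exI[of _ "\<lambda>z. (0, hor z)"]) auto
  qed
qed

section \<open>The cells of the universal cover\<close>

definition zpow :: "('a \<Rightarrow> 'a) \<Rightarrow> int \<Rightarrow> 'a \<Rightarrow> 'a" where
  "zpow f j = (if 0 \<le> j then f ^^ nat j else inv_into UNIV f ^^ nat (- j))"

lemma zpow_0 [simp]: "zpow f 0 x = x"
  by (simp add: zpow_def)

lemma zpow_Suc: 
  assumes "bij f"
  shows "zpow f (j + 1) x = f (zpow f j x)"
proof (cases "0 \<le> j")
  case True
  then show ?thesis by (simp add: zpow_def nat_add_distrib)
next
  case False
  then have "nat (- j) = Suc (nat (- (j + 1)))" by simp
  then show ?thesis
    using False assms by (simp add: zpow_def bij_is_surj surj_f_inv_f)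
qed

lemma zpow_add:
  assumes "bij f"
  shows "zpow f (i + j) x = zpow f i (zpow f j x)"
proof (induction i rule: int_induct[of _ 0])
  case (step1 i)
  have "zpow f (i + 1 + j) x = zpow f ((i + j) + 1) x" by (simp add: algebra_simps)
  also have "\<dots> = f (zpow f i (zpow f j x))" unfolding zpow_Suc[OF assms] step1 ..
  finally show ?case using zpow_Suc[OF assms] by metis
next
  case (step2 i)
  have "f (zpow f (i - 1 + j) x) = zpow f (i + j) x"
    using zpow_Suc[OF assms, of "i - 1 + j" x] by (simp add: algebra_simps)
  also have "\<dots> = f (zpow f (i - 1) (zpow f j x))"
    using zpow_Suc[OF assms, of "i - 1" "zpow f j x"] step2 by simp
  finally show ?case using assms by (metis bij_is_inj injD)
qed simp

text \<open>All characteristic maps send the corner to the one vertex; this allows lifts of all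
  cells to be indexed by vertices of the cover.\<close>

lemma zchar_origin [simp]: "zchar m n c (0, 0) = (ZVertex, 0, 0)"
  by (cases c) (auto simp: a_path_def t_path_def)

lemma origin_in_closed_dom [simp]: "(0, 0) \<in> closed_dom c"
  by (cases c) auto

lemma open_dom_subset: "open_dom c \<subseteq> closed_dom c"
  by (cases c) auto

lemma zchar_open_dom: "u \<in> open_dom c \<Longrightarrow> zchar m n c u = (c, u)"
  by (cases c; cases u) (auto simp: a_path_def t_path_def frac_eq elim: Ints_cases)

lemma closed_dom_box: obtains a b c' d where "closed_dom c = {a..b} \<times> {c'..d}" "a \<le> b" "c' \<le> d"
proof (cases c)
  case ZVertex
  then show ?thesis using that[of 0 0 0 0] by simp
next
  case ZHor
  then show ?thesis using that[of 0 1 0 0] by simp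
next
  case ZVert
  then show ?thesis using that[of 0 0 0 1] by simp
next
  case ZFace
  then show ?thesis using that[of 0 1 0 1] by simp
qed

lemma connected_closed_dom: "connected (closed_dom c)"
  by (rule closed_dom_box[of c]) (auto intro: connected_Times)

lemma compact_closed_dom: "compact (closed_dom c)"
  by (rule closed_dom_box[of c]) (auto intro: compact_Times)

lemma closure_open_dom: "closure (open_dom c) = closed_dom c"
  by (cases c) (auto simp: closure_Times)

lemma open_dom_nonempty: "open_dom c \<noteq> {}"
  by (cases c) auto

lemma a_path_of_int [simp]: "a_path (real_of_int j) = (ZVertex, 0, 0)" "a_path (real i) = (ZVertex, 0, 0)"
  "a_path 0 = (ZVertex, 0, 0)" "a_path 1 = (ZVertex, 0, 0)"
  by (auto simp: a_path_def)

lemma a_path_add: "a_path (real j + t) = a_path t"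
  by (auto simp: a_path_def frac_def)

lemma a_path_snd [simp]: "snd (snd (a_path x)) = 0"
  by (simp add: a_path_def)

lemma t_path_0_1 [simp]: "t_path i 0 = (ZVertex, 0, 0)" "t_path i 1 = (ZVertex, 0, 0)"
  by (simp_all add: t_path_def)

lemma cis_t_path: "cis (2 * pi * snd (snd (t_path i y))) = cis (2 * pi * y)"
  by (auto simp: t_path_def)

section \<open>Lifts of cells, named by their corners\<close>

locale z_cover =  fixes m n :: nat and X :: "'x topology" and p :: "'x \<Rightarrow> zpoint"
  assumes m: "m > 0" and n: "n > 0" and univ: "universal_covering X p (Z_complex m n)"
begin

abbreviation k :: nat where "k \<equiv> gcd m n"
abbreviation N :: nat where "N \<equiv> n div gcd m n"
abbreviation M :: nat where "M \<equiv> m div gcd m n"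

lemma cov: "covering_map X p (Z_complex m n)" and sc: "simply_connected_space X"
  using univ by (auto simp: universal_covering_def)

lemma p_cont: "continuous_map X (Z_complex m n) p"
  using cov by (simp add: covering_map_def)

lemma Hausdorff_X: "Hausdorff_space X"
  by (rule covering_map_Hausdorff[OF cov Hausdorff_Z_complex[OF m]])

lemma k0: "k > 0" and N0: "N > 0" and M0: "M > 0" 
  using m n by (auto simp: div_greater_zero_iff intro: gcd_le1_nat gcd_le2_nat)

definition V :: "'x set" where "V = {x \<in> topspace X. p x = (ZVertex, 0, 0)}"

abbreviation "cells \<equiv> zcells m n"
abbreviation "clifts \<equiv> char_lifts m n X p"

lemma in_cells [simp]: "ZVertex \<in> cells" "ZHor \<in> cells" "ZVert i \<in> cells \<longleftrightarrow> i < k" "ZFace i \<in> cells \<longleftrightarrow> i < k"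
  by (auto simp: zcells_def)

lemma clift_cont: "h \<in> clifts c \<Longrightarrow> continuous_map (top_of_set (closed_dom c)) X h"
  and clift_p: "h \<in> clifts c \<Longrightarrow> u \<in> closed_dom c \<Longrightarrow> p (h u) = zchar m n c u"
  by (auto simp: char_lifts_def)

lemma clift_top: "h \<in> clifts c \<Longrightarrow> u \<in> closed_dom c \<Longrightarrow> h u \<in> topspace X"
  using clift_cont[of h c] by (auto simp: continuous_map_def)

lemma clift_ex:
  assumes "c \<in> cells" "u \<in> closed_dom c" "x \<in> topspace X" "p x = zchar m n c u"
  shows "\<exists>h\<in>clifts c. h u = x"
proof -
  obtain A B C D where box: "closed_dom c = {A..B} \<times> {C..D}" "A \<le> B" "C \<le> D"
    by (rule closed_dom_box)
  have "liftable X p (zchar m n c) (closed_dom c)"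
    using liftable_box[OF cov] continuous_map_zchar[OF m assms(1)] box by metis
  then show ?thesis using assms unfolding liftable_def char_lifts_def by blast
qed

lemma clift_unique:
  assumes "h \<in> clifts c" "h' \<in> clifts c" "u \<in> closed_dom c" "h u = h' u" "v \<in> closed_dom c"
  shows "h v = h' v"
  by (rule covering_map_unique_lift[OF cov connected_space_top_of_set[OF connected_closed_dom]])
    (use assms in \<open>auto simp: clift_p intro: clift_cont\<close>)

text \<open>By unique lifting the corner determines the lift, so \<open>(c, x)\<close> with
  \<open>x\<close> in \<open>V\<close> names each lift once. For \<open>x\<close> outside
  \<open>V\<close> the value is unspecified.\<close>

definition lf :: "zcell \<Rightarrow> 'x \<Rightarrow> real \<times> real \<Rightarrow> 'x" where
  "lf c x = (SOME h. h \<in> clifts c \<and> h (0, 0) = x)"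

lemma lf_in: "c \<in> cells \<Longrightarrow> x \<in> V \<Longrightarrow> lf c x \<in> clifts c"
  and lf_origin: "c \<in> cells \<Longrightarrow> x \<in> V \<Longrightarrow> lf c x (0, 0) = x"
proof -
  assume "c \<in> cells" "x \<in> V"
  then have "\<exists>h. h \<in> clifts c \<and> h (0, 0) = x" using clift_ex[of c "(0, 0)" x] by (auto simp: V_def)
  from someI_ex[OF this] show "lf c x \<in> clifts c" "lf c x (0, 0) = x" by (auto simp: lf_def)
qed

lemma clift_origin: "h \<in> clifts c \<Longrightarrow> h (0, 0) \<in> V"
  using clift_p[of h c "(0, 0)"] clift_top[of h c "(0, 0)"] by (simp add: V_def)

lemma clift_eq_lf: "c \<in> cells \<Longrightarrow> h \<in> clifts c \<Longrightarrow> u \<in> closed_dom c \<Longrightarrow> h u = lf c (h (0, 0)) u"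
  by (rule clift_unique[of h c _ "(0, 0)"]) (simp_all add: lf_in lf_origin clift_origin)

lemma p_lf: "c \<in> cells \<Longrightarrow> x \<in> V \<Longrightarrow> u \<in> closed_dom c \<Longrightarrow> p (lf c x u) = zchar m n c u"
  using lf_in clift_p by blast

lemma lf_cont: "c \<in> cells \<Longrightarrow> x \<in> V \<Longrightarrow> continuous_map (top_of_set (closed_dom c)) X (lf c x)"
  using lf_in clift_cont by blast

lemma lf_top: "c \<in> cells \<Longrightarrow> x \<in> V \<Longrightarrow> u \<in> closed_dom c \<Longrightarrow> lf c x u \<in> topspace X"
  using lf_in clift_top by blast

lemma lf_inj:
  assumes "c \<in> cells" "x \<in> V" "y \<in> V" "u \<in> closed_dom c" "lf c x u = lf c y u"
  shows "x = y"
  using clift_unique[OF lf_in lf_in, of c x y u "(0, 0)"] lf_origin assms by simp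

lemma V_top: "x \<in> V \<Longrightarrow> x \<in> topspace X" by (simp add: V_def)

definition cell :: "zcell \<Rightarrow> 'x \<Rightarrow> 'x set" where "cell c x = lf c x ` open_dom c"

lemma char_lift_image:
  assumes "c \<in> cells" "A \<subseteq> closed_dom c"
  shows "(\<lambda>h. h ` A) ` clifts c = (\<lambda>x. lf c x ` A) ` V"
proof (intro equalityI subsetI)
  fix B assume "B \<in> (\<lambda>h. h ` A) ` clifts c"
  then obtain h where h: "h \<in> clifts c" "B = h ` A" by blast
  have "h ` A = lf c (h (0, 0)) ` A"
    using assms(2) by (intro image_cong refl clift_eq_lf[OF assms(1) h(1)]) auto
  then show "B \<in> (\<lambda>x. lf c x ` A) ` V" using h clift_origin by blast
qed (use assms lf_in in blast)

lemma X_cells_eq: "X_cells m n X p = {cell c x | c x. c \<in> cells \<and> x \<in> V}"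
  unfolding X_cells_def cell_def using char_lift_image[OF _ open_dom_subset] by auto

lemma p_lf_open: "c \<in> cells \<Longrightarrow> x \<in> V \<Longrightarrow> u \<in> open_dom c \<Longrightarrow> p (lf c x u) = (c, u)"
  using p_lf zchar_open_dom open_dom_subset by (metis subsetD)

text \<open>\<open>p\<close> recovers \<open>c\<close> and \<open>u\<close> from the point, and
  unique lifting then recovers \<open>x\<close>.\<close>

lemma lf_eq_cell:
  assumes "lf c x u = lf d y v" "c \<in> cells" "d \<in> cells" "x \<in> V" "y \<in> V" "u \<in> open_dom c" "v \<in> open_dom d"
  shows "c = d \<and> x = y \<and> u = v"
proof -
  have "(c, u) = (d, v)" using p_lf_open assms by metis
  then show ?thesis using lf_inj[of c x y u] assms open_dom_subset by auto
qed

lemma point_in_cell: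
  assumes "y \<in> topspace X"
  obtains c x u where "c \<in> cells" "x \<in> V" "u \<in> open_dom c" "y = lf c x u"
proof -
  have "p y \<in> Z_points m n"
    using p_cont assms topspace_Z_complex[OF m, of n] by (auto simp: continuous_map_def)
  then obtain c u where c: "c \<in> cells" "u \<in> open_dom c" "p y = (c, u)"
    by (auto simp: zopen_cell_def)
  have u: "u \<in> closed_dom c" using c open_dom_subset by blast
  then obtain h where h: "h \<in> clifts c" "h u = y"
    using clift_ex[OF c(1) _ assms] c zchar_open_dom by metis
  then show thesis using that[OF c(1) clift_origin[OF h(1)] c(2)] clift_eq_lf[OF c(1) h(1) u] by simp
qed

lemma cell_disjoint:
  assumes "c \<in> cells" "d \<in> cells" "x \<in> V" "y \<in> V" "cell c x \<inter> cell d y \<noteq> {}"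
  shows "c = d \<and> x = y"
  using assms lf_eq_cell unfolding cell_def by blast

lemma cell_nonempty: "cell c x \<noteq> {}"
  using open_dom_nonempty by (auto simp: cell_def)

lemma cell_top: "c \<in> cells \<Longrightarrow> x \<in> V \<Longrightarrow> cell c x \<subseteq> topspace X"
  using lf_top open_dom_subset by (fastforce simp: cell_def)

text \<open>The cover carries the weak topology of its own cells. On a sheet \<open>W\<close> the
  question becomes whether the image of \<open>W \<inter> U\<close> is open in the base, which is
  tested on characteristic maps: a parameter sent into this image has a lift through a point of
  \<open>W \<inter> U\<close>, and to that lift the hypothesis applies.\<close>

lemma openin_X:
  assumes sub: "U \<subseteq> topspace X"
    and op: "\<And>c x. c \<in> cells \<Longrightarrow> x \<in> V \<Longrightarrow>
      openin (top_of_set (closed_dom c)) {u \<in> closed_dom c. lf c x u \<in> U}"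
  shows "openin X U"
proof (subst openin_subopen, intro ballI)
  fix x assume x: "x \<in> U"
  then have xX: "x \<in> topspace X" using sub by blast
  then have "p x \<in> topspace (Z_complex m n)" using p_cont by (auto simp: continuous_map_def)
  then obtain U0 where U0: "openin (Z_complex m n) U0" "p x \<in> U0"
    and sheets: "\<And>x. x \<in> topspace X \<Longrightarrow> p x \<in> U0 \<Longrightarrow>
      \<exists>V r. openin X V \<and> x \<in> V \<and> continuous_map (subtopology (Z_complex m n) U0) X r \<and> r \<in> U0 \<rightarrow> V \<and>
         (\<forall>y\<in>U0. p (r y) = y) \<and> (\<forall>v\<in>V. p v \<in> U0 \<and> r (p v) = v)"
    by (rule covering_map_sheets[OF cov]) blast
  obtain W r where W: "openin X W" "x \<in> W" "\<And>v. v \<in> W \<Longrightarrow> r (p v) = v"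
    using sheets[OF xX U0(2)] by (elim exE conjE) blast
  have WX: "W \<subseteq> topspace X" using W(1) openin_subset by blast
  have "openin (Z_complex m n) (p ` (W \<inter> U))"
    unfolding Z_complex_def openin_weak_topology
  proof (intro conjI ballI)
    have "p ` (W \<inter> U) \<subseteq> topspace (Z_complex m n)" using p_cont WX by (auto simp: continuous_map_def)
    then show "p ` (W \<inter> U) \<subseteq> Z_points m n" using topspace_Z_complex[OF m] by metis
    fix c assume c: "c \<in> cells"
    show "openin (top_of_set (closed_dom c)) {u \<in> closed_dom c. zchar m n c u \<in> p ` (W \<inter> U)}"
    proof (subst openin_subopen, intro ballI)
      fix u assume "u \<in> {u \<in> closed_dom c. zchar m n c u \<in> p ` (W \<inter> U)}"
      then obtain w where u: "u \<in> closed_dom c" and w: "w \<in> W" "w \<in> U" "zchar m n c u = p w" by blast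
      then obtain h where h: "h \<in> clifts c" "h u = w" using clift_ex[OF c u] WX by force
      let ?y = "h (0, 0)"
      let ?T = "{v \<in> closed_dom c. lf c ?y v \<in> U} \<inter> {v \<in> closed_dom c. lf c ?y v \<in> W}"
      have "openin (top_of_set (closed_dom c)) ?T"
        using op[OF c clift_origin[OF h(1)]]
          openin_continuous_map_preimage[OF lf_cont[OF c clift_origin[OF h(1)]] W(1)]
        by (intro openin_Int) auto
      moreover have "u \<in> ?T" using clift_eq_lf[OF c h(1) u] u w h by simp
      moreover have "?T \<subseteq> {u \<in> closed_dom c. zchar m n c u \<in> p ` (W \<inter> U)}"
        using p_lf[OF c clift_origin[OF h(1)]] by (auto intro!: rev_image_eqI)
      ultimately show "\<exists>T. openin (top_of_set (closed_dom c)) T \<and> u \<in> T \<and>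
          T \<subseteq> {u \<in> closed_dom c. zchar m n c u \<in> p ` (W \<inter> U)}" by blast
    qed
  qed
  then have "openin X {y \<in> topspace X. p y \<in> p ` (W \<inter> U)}"
    using p_cont by (simp add: continuous_map_def)
  then have "openin X (W \<inter> {y \<in> topspace X. p y \<in> p ` (W \<inter> U)})"
    using W(1) by blast
  moreover have "W \<inter> {y \<in> topspace X. p y \<in> p ` (W \<inter> U)} \<subseteq> U"
  proof
    fix y assume "y \<in> W \<inter> {y \<in> topspace X. p y \<in> p ` (W \<inter> U)}"
    then obtain w where w: "y \<in> W" "w \<in> W" "w \<in> U" "p y = p w" by blast
    have "y = w" using W(3)[OF w(1)] W(3)[OF w(2)] unfolding w(4) by (rule trans[OF sym])
    with w(3) show "y \<in> U" by simp
  qed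
  moreover have "x \<in> W \<inter> {y \<in> topspace X. p y \<in> p ` (W \<inter> U)}" using x W(2) xX by auto
  ultimately show "\<exists>T. openin X T \<and> x \<in> T \<and> T \<subseteq> U" by blast
qed

section \<open>Moving between vertices along 1-cells\<close>

text \<open>The step to the next vertex along a lift of \<open>a\<close>. It is the identity outside
  \<open>V\<close> so that it is a bijection of the whole type, as \<open>zpow\<close>
  needs.\<close>

definition s :: "'x \<Rightarrow> 'x" where "s x = (if x \<in> V then lf ZHor x (1, 0) else x)"

definition up :: "nat \<Rightarrow> 'x \<Rightarrow> 'x" where "up i x = lf (ZVert i) x (0, 1)"

definition sh :: "int \<Rightarrow> 'x \<Rightarrow> 'x" where "sh j = zpow s j"

text \<open>A lift is determined by its value at any point of its domain, so its corner can be
  recovered from any other vertex on it.\<close>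

lemma end_bij:
  assumes "c \<in> cells" "u \<in> closed_dom c" "zchar m n c u = (ZVertex, 0, 0)"
  shows "bij_betw (\<lambda>x. lf c x u) V V"
proof (rule bij_betw_imageI)
  show "inj_on (\<lambda>x. lf c x u) V" using assms by (intro inj_onI) (rule lf_inj)
  show "(\<lambda>x. lf c x u) ` V = V"
  proof (intro equalityI subsetI)
    fix y assume "y \<in> (\<lambda>x. lf c x u) ` V"
    then obtain x where "x \<in> V" "y = lf c x u" by blast
    then show "y \<in> V" using lf_top[of c x u] p_lf[of c x u] assms by (simp add: V_def)
  next
    fix y assume "y \<in> V"
    then obtain h where "h \<in> clifts c" "h u = y" using clift_ex assms by (metis (mono_tags, lifting) V_def mem_Collect_eq)
    then show "y \<in> (\<lambda>x. lf c x u) ` V"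
      using clift_eq_lf[of c h u] clift_origin assms by (intro image_eqI[of _ _ "h (0, 0)"]) auto
  qed
qed

lemma s_bij: "bij_betw s V V"
  using end_bij[of ZHor "(1, 0)"] by (simp add: s_def cong: bij_betw_cong)

lemma bij_s: "bij s"
proof -
  have "bij_betw s (- V) (- V)" by (simp add: s_def bij_betw_def inj_on_def)
  from bij_betw_combine[OF s_bij this] show ?thesis by simp
qed

lemma up_bij: "i < k \<Longrightarrow> bij_betw (up i) V V"
  unfolding up_def[abs_def] by (rule end_bij) auto

lemma up_V [simp]: "i < k \<Longrightarrow> x \<in> V \<Longrightarrow> up i x \<in> V"
  using up_bij bij_betwE by blast

lemma s_V: "s x \<in> V \<longleftrightarrow> x \<in> V"
  using bij_betw_apply[OF s_bij, of x] by (auto simp: s_def)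

lemma sh_0 [simp]: "sh 0 x = x" by (simp add: sh_def)

lemma sh_add: "sh (i + j) x = sh i (sh j x)"
  unfolding sh_def by (rule zpow_add[OF bij_s])

lemma sh_1: "sh 1 x = s x" by (simp add: sh_def zpow_def)

lemma sh_V [simp]: "sh j x \<in> V \<longleftrightarrow> x \<in> V"
proof (induction j rule: int_induct[of _ 0])
  case (step1 i)
  then show ?case by (simp add: add.commute[of i] sh_add[of 1] sh_1 s_V)
next
  case (step2 i)
  have "sh i x = s (sh (i - 1) x)" using sh_add[of 1 "i - 1" x] by (simp add: sh_1)
  then show ?case using step2 by (simp add: s_V)
qed simp

lemma sh_inv [simp]: "sh j (sh (- j) x) = x" "sh (- j) (sh j x) = x"
  by (simp_all flip: sh_add)

section \<open>Horizontal paths, and loops that do not close up\<close>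

text \<open>By unique lifting, a path over \<open>a_path\<close> runs through one lifted 1-cell per
  unit of time, namely the one at its current vertex.\<close>

lemma horizontal_lift_segment:
  assumes \<gamma>: "continuous_map (top_of_set {0..real L}) X \<gamma>" "\<And>t. t \<in> {0..real L} \<Longrightarrow> p (\<gamma> t) = a_path t"
    and j: "j < L" and r: "r \<in> {0..1}"
  shows "\<gamma> (real j + r) = lf ZHor (\<gamma> (real j)) (r, 0)"
proof -
  have jL: "real j + 1 \<le> real L" using j by linarith
  have "(\<lambda>u. \<gamma> (real j + fst u)) \<in> clifts ZHor"
    unfolding char_lifts_def
  proof (intro CollectI conjI ballI)
    have "continuous_map (top_of_set (closed_dom ZHor)) (top_of_set {0..real L}) (\<lambda>u. real j + fst u)"
      using jL by (auto intro!: continuous_intros)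
    from continuous_map_compose[OF this \<gamma>(1)]
    show "continuous_map (top_of_set (closed_dom ZHor)) X (\<lambda>u. \<gamma> (real j + fst u))" by (simp add: comp_def)
    show "p (\<gamma> (real j + fst u)) = zchar m n ZHor u" if "u \<in> closed_dom ZHor" for u
      using that \<gamma>(2)[of "real j + fst u"] jL by (auto simp: a_path_add)
  qed
  from clift_eq_lf[OF _ this, of "(r, 0)"] r show ?thesis by simp
qed

lemma horizontal_lift_vertex:
  assumes \<gamma>: "continuous_map (top_of_set {0..real L}) X \<gamma>" "\<And>t. t \<in> {0..real L} \<Longrightarrow> p (\<gamma> t) = a_path t"
    and j: "j \<le> L"
  shows "\<gamma> (real j) = sh j (\<gamma> 0) \<and> \<gamma> (real j) \<in> V"
  using j
proof (induction j)
  case 0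
  have "\<gamma> 0 \<in> topspace X" using \<gamma>(1) by (auto simp: continuous_map_def)
  then show ?case using \<gamma>(2)[of 0] by (simp add: V_def)
next
  case (Suc j)
  then have IH: "\<gamma> (real j) = sh (int j) (\<gamma> 0)" "\<gamma> (real j) \<in> V" by auto
  have "\<gamma> (real (Suc j)) = lf ZHor (\<gamma> (real j)) (1, 0)"
    using horizontal_lift_segment[OF \<gamma>, of j 1] Suc.prems by (simp add: add.commute)
  also have "\<dots> = s (\<gamma> (real j))" using IH(2) by (simp only: s_def if_True)
  finally have "\<gamma> (real (Suc j)) = s (\<gamma> (real j))" .
  then show ?case using IH s_V by (simp add: sh_add sh_1)
qed

lemma horizontal_path_ex:
  assumes x: "x \<in> V"
  shows "\<exists>\<gamma>. continuous_map (top_of_set {0..real L}) X \<gamma> \<and> \<gamma> 0 = x \<and> (\<forall>t\<in>{0..real L}. p (\<gamma> t) = a_path t)"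
proof (induction L)
  case 0
  then show ?case using x by (intro exI[of _ "\<lambda>_. x"]) (auto simp: V_def)
next
  case (Suc L)
  then obtain \<gamma> where \<gamma>: "continuous_map (top_of_set {0..real L}) X \<gamma>" "\<gamma> 0 = x" "\<forall>t\<in>{0..real L}. p (\<gamma> t) = a_path t"
    by blast
  let ?y = "\<gamma> (real L)"
  let ?\<delta> = "\<lambda>t. lf ZHor ?y (t - real L, 0)"
  have y: "?y \<in> V" using horizontal_lift_vertex[OF \<gamma>(1), of L] \<gamma>(3) by blast
  have U: "{0..real (Suc L)} = {0..real L} \<union> {real L..real L + 1}" by auto
  have "continuous_map (top_of_set {real L..real L + 1}) (top_of_set (closed_dom ZHor)) (\<lambda>t. (t - real L, 0))"
    by (auto intro!: continuous_intros)
  from continuous_map_compose[OF this lf_cont[OF _ y]]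
  have "continuous_map (top_of_set {real L..real L + 1}) X ?\<delta>" by (simp add: comp_def)
  then have "continuous_map (top_of_set ({0..real L} \<union> {real L..real L + 1})) X
      (\<lambda>t. if t \<in> {0..real L} then \<gamma> t else ?\<delta> t)"
    using lf_origin[OF _ y] by (intro continuous_map_paste_closed \<gamma>(1)) auto
  moreover have "p (?\<delta> t) = a_path t" if "t \<in> {real L..real L + 1}" for t
    using p_lf[OF _ y, of ZHor "(t - real L, 0)"] that a_path_add[of L "t - real L"] by simp
  ultimately show ?case using \<gamma> U by (intro exI[of _ "\<lambda>t. if t \<in> {0..real L} then \<gamma> t else ?\<delta> t"]) auto
qed

text \<open>Simple connectivity contracts \<open>g\<close> in the cover; the projected contraction
  is a square in the base with three constant sides, the input of the two lemmas on loops.\<close>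

lemma loop_square:
  assumes g: "pathin X g" "g 0 = g 1" "g 0 \<in> V"
  obtains K :: "real \<times> real \<Rightarrow> zpoint" where "continuous_map (top_of_set ({0..1} \<times> {0..1})) (Z_complex m n) K"
    "\<And>t. t \<in> {0..1} \<Longrightarrow> K (0, t) = p (g t)" "\<And>t. t \<in> {0..1} \<Longrightarrow> K (1, t) = (ZVertex, 0, 0)"
    "\<And>s. s \<in> {0..1} \<Longrightarrow> K (s, 0) = (ZVertex, 0, 0)" "\<And>s. s \<in> {0..1} \<Longrightarrow> K (s, 1) = (ZVertex, 0, 0)"
proof -
  have "homotopic_with (\<lambda>r. r 0 = g 0 \<and> r 1 = g 0) (top_of_set {0..1}) X g (\<lambda>_. g 0)"
  proof -
    have "pathin X g \<and> g 1 = g 0 \<longrightarrow> homotopic_with (\<lambda>r. r 0 = g 0 \<and> r 1 = g 0) (top_of_set {0..1}) X g (\<lambda>_. g 0)"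
      using sc unfolding simply_connected_space_def by blast
    then show ?thesis using g by simp
  qed
  then obtain h where h: "continuous_map (prod_topology (top_of_set {0..1::real}) (top_of_set {0..1::real})) X h"
    "\<And>x. h (0, x) = g x" "\<And>x. h (1, x) = g 0" "\<And>t. t \<in> {0..1} \<Longrightarrow> h (t, 0) = g 0 \<and> h (t, 1) = g 0"
    unfolding homotopic_with_def by blast
  have "prod_topology (top_of_set {0..1::real}) (top_of_set {0..1::real}) = top_of_set ({0..1} \<times> {0..1})"
    by (simp add: subtopology_Times[symmetric] euclidean_product_topology)
  then have "continuous_map (top_of_set ({0..1} \<times> {0..1})) (Z_complex m n) (p \<circ> h)"
    using continuous_map_compose[OF h(1) p_cont] by simp
  moreover have "p (g 0) = (ZVertex, 0, 0)" using g(3) by (simp add: V_def)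
  ultimately show thesis using h(2-4) by (intro that[of "p \<circ> h"]) simp_all
qed

text \<open>If the vertex returns after \<open>L\<close> steps, the lift of the
  \<open>L\<close>-fold loop \<open>a\<close> is closed and hence contractible in the cover, which
  \<open>horizontal_loop_not_nullhomotopic\<close> allows only for \<open>L = 0\<close>.\<close>

lemma sh_fixed_nat: 
  assumes x: "x \<in> V" and fixed: "sh (int L) x = x"
  shows "L = 0"
proof -
  obtain \<gamma> where \<gamma>: "continuous_map (top_of_set {0..real L}) X \<gamma>" "\<gamma> 0 = x" "\<And>t. t \<in> {0..real L} \<Longrightarrow> p (\<gamma> t) = a_path t"
    using horizontal_path_ex[OF x] by metis
  define g where "g = (\<lambda>t. \<gamma> (real L * t))"
  have "continuous_map (top_of_set {0..1}) (top_of_set {0..real L}) (\<lambda>t. real L * t)"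
    by (auto intro!: continuous_intros mult_left_le)
  from continuous_map_compose[OF this \<gamma>(1)] have "pathin X g" by (simp add: pathin_def g_def comp_def)
  moreover have "g 0 = x" "g 1 = x"
    using \<gamma>(2) horizontal_lift_vertex[OF \<gamma>(1,3), of L] fixed by (auto simp: g_def)
  ultimately obtain K :: "real \<times> real \<Rightarrow> zpoint" where K: "continuous_map (top_of_set ({0..1} \<times> {0..1})) (Z_complex m n) K"
    "\<And>t. t \<in> {0..1} \<Longrightarrow> K (0, t) = p (g t)" "\<And>t. t \<in> {0..1} \<Longrightarrow> K (1, t) = (ZVertex, 0, 0)"
    "\<And>s. s \<in> {0..1} \<Longrightarrow> K (s, 0) = (ZVertex, 0, 0)" "\<And>s. s \<in> {0..1} \<Longrightarrow> K (s, 1) = (ZVertex, 0, 0)"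
    using loop_square[of g] x by metis
  have "p (g t) = a_path (real L * t)" if "t \<in> {0..1}" for t
    using that \<gamma>(3)[of "real L * t"] by (auto simp: g_def mult_left_le)
  then show "L = 0" using horizontal_loop_not_nullhomotopic[OF m n K(1), of L] K by auto
qed

lemma sh_inj:
  assumes x: "x \<in> V" and eq: "sh i x = sh j x"
  shows "i = j"
proof -
  have *: "i = j" if "sh i x = sh j x" "i \<le> j" for i j
  proof -
    have "sh (j - i) x = sh (- i) (sh j x)" by (simp flip: sh_add)
    also have "\<dots> = x" using that by (metis sh_inv(2))
    finally have "sh (int (nat (j - i))) x = x" using that by simp
    then show ?thesis using sh_fixed_nat[OF x] that by fastforce
  qed
  show ?thesis using *[of i j] *[of j i] eq by (cases "i \<le> j") auto
qed

text \<open>The two ends of a vertical 1-cell are on different lines: otherwise the 1-cell and a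
  horizontal path back would form a closed path whose height gains one turn.\<close>

lemma up_not_sh:
  assumes x: "x \<in> V" and i: "i < k"
  shows "up i x \<noteq> sh j x"
proof
  assume eq: "up i x = sh j x"
  have "\<exists>\<sigma>. pathin X \<sigma> \<and> \<sigma> 0 = up i x \<and> \<sigma> 1 = x \<and> (\<forall>t\<in>{0..1}. snd (snd (p (\<sigma> t))) = 0)"
  proof -
    \<comment> \<open>\<open>horizontal_path_ex\<close> only runs forward, so for
      \<open>j \<ge> 0\<close> the path is taken from \<open>x\<close> to \<open>up i x\<close> and
      then reversed.\<close>
    define L where "L = nat \<bar>j\<bar>"
    define y where "y = (if j \<ge> 0 then x else up i x)"
    define z where "z = (if j \<ge> 0 then up i x else x)"
    have y: "y \<in> V" using x i by (simp add: y_def)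
    have z: "z = sh (int L) y" using eq by (auto simp: z_def y_def L_def)
    obtain \<gamma> where \<gamma>: "continuous_map (top_of_set {0..real L}) X \<gamma>" "\<gamma> 0 = y" "\<And>t. t \<in> {0..real L} \<Longrightarrow> p (\<gamma> t) = a_path t"
      using horizontal_path_ex[OF y] by metis
    have \<gamma>L: "\<gamma> (real L) = z" using horizontal_lift_vertex[OF \<gamma>(1,3), of L] z \<gamma>(2) by simp
    have c1: "continuous_map (top_of_set {0..1}) (top_of_set {0..real L}) (\<lambda>t. real L * t)"
      by (auto intro!: continuous_intros mult_left_le)
    have c2: "continuous_map (top_of_set {0..1}) (top_of_set {0..real L}) (\<lambda>t. real L * (1 - t))"
      by (auto intro!: continuous_intros mult_left_le)
    show ?thesis
    proof (cases "j \<ge> 0")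
      case False
      show ?thesis
      proof (intro exI[of _ "\<lambda>t. \<gamma> (real L * t)"] conjI ballI)
        show "pathin X (\<lambda>t. \<gamma> (real L * t))"
          using continuous_map_compose[OF c1 \<gamma>(1)] by (simp add: pathin_def comp_def)
        show "snd (snd (p (\<gamma> (real L * t)))) = 0" if "t \<in> {0..1}" for t
          using \<gamma>(3)[of "real L * t"] that by (auto simp: mult_left_le)
      qed (use False \<gamma>(2) \<gamma>L in \<open>auto simp: y_def z_def\<close>)
    next
      case True
      show ?thesis
      proof (intro exI[of _ "\<lambda>t. \<gamma> (real L * (1 - t))"] conjI ballI)
        show "pathin X (\<lambda>t. \<gamma> (real L * (1 - t)))"
          using continuous_map_compose[OF c2 \<gamma>(1)] by (simp add: pathin_def comp_def)
        show "snd (snd (p (\<gamma> (real L * (1 - t))))) = 0" if "t \<in> {0..1}" for t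
          using \<gamma>(3)[of "real L * (1 - t)"] that by (auto simp: mult_left_le)
      qed (use True \<gamma>(2) \<gamma>L in \<open>auto simp: y_def z_def\<close>)
    qed
  qed
  then obtain \<sigma> where \<sigma>: "pathin X \<sigma>" "\<sigma> 0 = up i x" "\<sigma> 1 = x" "\<And>t. t \<in> {0..1} \<Longrightarrow> snd (snd (p (\<sigma> t))) = 0"
    by blast
  define g where "g = (\<lambda>t. if t \<in> {0..1/2} then lf (ZVert i) x (0, 2 * t) else \<sigma> (2 * t - 1))"
  have "continuous_map (top_of_set {0..1/2}) X (\<lambda>t. lf (ZVert i) x (0, 2 * t))"
  proof -
    have "continuous_map (top_of_set {0..1/2}) (top_of_set (closed_dom (ZVert i))) (\<lambda>t. (0, 2 * t))"
      by (auto intro!: continuous_intros)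
    from continuous_map_compose[OF this lf_cont[OF _ x]] i show ?thesis by (simp add: comp_def)
  qed
  moreover have "continuous_map (top_of_set {1/2..1}) X (\<lambda>t. \<sigma> (2 * t - 1))"
  proof -
    have "continuous_map (top_of_set {1/2..1}) (top_of_set {0..1}) (\<lambda>t::real. 2 * t - 1)"
      by (auto intro!: continuous_intros)
    from continuous_map_compose[OF this \<sigma>(1)[unfolded pathin_def]] show ?thesis by (simp add: comp_def)
  qed
  ultimately have "continuous_map (top_of_set ({0..1/2} \<union> {1/2..1})) X g"
    unfolding g_def
  proof (rule continuous_map_paste_closed)
    fix v :: real assume "v \<in> {0..1/2}" "v \<in> {1/2..1}"
    then have v: "v = 1/2" by simp
    show "lf (ZVert i) x (0, 2 * v) = \<sigma> (2 * v - 1)" unfolding v using \<sigma>(2) by (simp add: up_def)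
  qed auto
  moreover have "{0..1/2} \<union> {1/2..1} = {0..1::real}" by auto
  ultimately have g: "pathin X g" by (simp add: pathin_def)
  have g01: "g 0 = x" "g 1 = x" using lf_origin[of "ZVert i" x] x i \<sigma>(3) by (auto simp: g_def)
  then obtain K :: "real \<times> real \<Rightarrow> zpoint" where K: "continuous_map (top_of_set ({0..1} \<times> {0..1})) (Z_complex m n) K"
    "\<And>t. t \<in> {0..1} \<Longrightarrow> K (0, t) = p (g t)" "\<And>t. t \<in> {0..1} \<Longrightarrow> K (1, t) = (ZVertex, 0, 0)"
    "\<And>s. s \<in> {0..1} \<Longrightarrow> K (s, 0) = (ZVertex, 0, 0)" "\<And>s. s \<in> {0..1} \<Longrightarrow> K (s, 1) = (ZVertex, 0, 0)"
    using loop_square[of g] x g by metis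
  \<comment> \<open>The height along \<open>g\<close>: it rises to 1 on the vertical half and is
    kept at 1, which is 0 modulo 1, on the horizontal half.\<close>
  have "min (2 * 1) 1 = (min (2 * 0) 1 :: real)"
  proof (rule vertical_loop_not_nullhomotopic[OF m K(1,3,4,5), where \<theta> = "\<lambda>t. min (2 * t) 1"])
    fix t :: real assume t: "t \<in> {0..1}"
    show "cis (2 * pi * snd (snd (K (0, t)))) = cis (2 * pi * min (2 * t) 1)"
    proof (cases "t \<le> 1/2")
      case True
      then have "p (g t) = t_path i (2 * t)"
        using t p_lf[of "ZVert i" x "(0, 2 * t)"] x i by (simp add: g_def)
      then show ?thesis using K(2)[OF t] True cis_t_path[of i "2 * t"] by simp
    next
      case False
      then have "snd (snd (p (g t))) = 0" using \<sigma>(4)[of "2 * t - 1"] t by (simp add: g_def)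
      then show ?thesis using K(2)[OF t] False by simp
    qed
  qed (auto intro!: continuous_intros)
  then show False by simp
qed

section \<open>The sides of lifted squares\<close>

text \<open>Restricted to a vertical side, a lifted square is a lift of \<open>t_j\<close>, hence
  the one starting at the lower end of this side.\<close>

lemma lf_face_edge:
  assumes i: "i < k" and x: "x \<in> V" and j: "j < k" and a: "a \<in> {0, 1}" 
    and p: "\<And>y. y \<in> {0..1} \<Longrightarrow> zchar m n (ZFace i) (a, y) = t_path j y" and y: "y \<in> {0..1}"
  shows "lf (ZFace i) x (a, y) = lf (ZVert j) (lf (ZFace i) x (a, 0)) (0, y)"
proof -
  have "(\<lambda>u. lf (ZFace i) x (a, snd u)) \<in> clifts (ZVert j)"
    unfolding char_lifts_def
  proof (intro CollectI conjI ballI)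
    have "continuous_map (top_of_set (closed_dom (ZVert j))) (top_of_set (closed_dom (ZFace i))) (\<lambda>u. (a, snd u))"
      using a by (auto intro!: continuous_intros)
    from continuous_map_compose[OF this lf_cont[OF _ x]] i
    show "continuous_map (top_of_set (closed_dom (ZVert j))) X (\<lambda>u. lf (ZFace i) x (a, snd u))" by (simp add: comp_def)
    show "p (lf (ZFace i) x (a, snd u)) = zchar m n (ZVert j) u" if "u \<in> closed_dom (ZVert j)" for u
      using that p_lf[of "ZFace i" x "(a, snd u)"] x a i p[of "snd u"] by auto
  qed
  from clift_eq_lf[OF _ this, of "(0, y)"] y j show ?thesis by simp
qed

text \<open>Rescaled by \<open>L\<close>, a horizontal side of a lifted square is a path over
  \<open>a_path\<close>, which splits into \<open>L\<close> lifted 1-cells. It is used with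
  \<open>L = N\<close> at the bottom and \<open>L = M\<close> at the top.\<close>

lemma lf_face_side:
  assumes i: "i < k" and x: "x \<in> V" and b: "b \<in> {0, 1}" and L: "L > 0"
    and p: "\<And>a. a \<in> {0..1} \<Longrightarrow> zchar m n (ZFace i) (a, b) = a_path (real L * a)"
  shows "j < L \<Longrightarrow> r \<in> {0..1} \<Longrightarrow>
      lf (ZFace i) x ((real j + r) / real L, b) = lf ZHor (sh j (lf (ZFace i) x (0, b))) (r, 0)"
    and "lf (ZFace i) x (1, b) = sh L (lf (ZFace i) x (0, b))"
proof -
  define \<gamma> where "\<gamma> = (\<lambda>t. lf (ZFace i) x (t / real L, b))"
  have "continuous_map (top_of_set {0..real L}) (top_of_set (closed_dom (ZFace i))) (\<lambda>t. (t / real L, b))"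
    using b L by (auto intro!: continuous_intros simp: field_simps)
  from continuous_map_compose[OF this lf_cont[OF _ x]] i
  have \<gamma>: "continuous_map (top_of_set {0..real L}) X \<gamma>" by (simp add: comp_def \<gamma>_def)
  have \<gamma>p: "p (\<gamma> t) = a_path t" if "t \<in> {0..real L}" for t
    using p_lf[of "ZFace i" x "(t / real L, b)"] that i x b L p[of "t / real L"] by (auto simp: \<gamma>_def)
  have v: "\<gamma> (real j) = sh j (\<gamma> 0)" if "j \<le> L" for j
    using horizontal_lift_vertex[OF \<gamma> \<gamma>p that] by simp
  show "lf (ZFace i) x ((real j + r) / real L, b) = lf ZHor (sh j (lf (ZFace i) x (0, b))) (r, 0)"
    if "j < L" "r \<in> {0..1}"
    using horizontal_lift_segment[OF \<gamma> \<gamma>p that] v[of j] that by (simp add: \<gamma>_def)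
  show "lf (ZFace i) x (1, b) = sh L (lf (ZFace i) x (0, b))"
    using v[of L] L by (simp add: \<gamma>_def)
qed

lemma face_left:
  assumes "i < k" "x \<in> V" "y \<in> {0..1}"
  shows "lf (ZFace i) x (0, y) = lf (ZVert i) x (0, y)"
  using lf_face_edge[of i x i 0 y] assms lf_origin[of "ZFace i" x] by simp

lemma face_bottom:
  assumes "i < k" "x \<in> V"
  shows "j < N \<Longrightarrow> r \<in> {0..1} \<Longrightarrow> lf (ZFace i) x ((real j + r) / real N, 0) = lf ZHor (sh j x) (r, 0)"
    and "lf (ZFace i) x (1, 0) = sh N x"
  using lf_face_side[of i x 0 N] assms lf_origin[of "ZFace i" x] N0 by simp_all

lemma face_top:
  assumes "i < k" "x \<in> V"
  shows "j < M \<Longrightarrow> r \<in> {0..1} \<Longrightarrow> lf (ZFace i) x ((real j + r) / real M, 1) = lf ZHor (sh j (up i x)) (r, 0)"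
    and "lf (ZFace i) x (1, 1) = sh M (up i x)"
  using lf_face_side[of i x 1 M] assms face_left[of i x 1] M0 by (simp_all add: up_def)

lemma face_right:
  assumes "i < k" "x \<in> V" "y \<in> {0..1}"
  shows "lf (ZFace i) x (1, y) = lf (ZVert (Suc i mod k)) (sh N x) (0, y)"
proof -
  have "zchar m n (ZFace i) (1, y) = t_path (Suc i mod k) y" for y
    by simp
  then show ?thesis
    using lf_face_edge[of i x "Suc i mod k" 1 y] face_bottom(2)[of i x] assms k0 by simp
qed

text \<open>Both expressions are the top right corner of a square, reached along the bottom and the
  right side or along the left side and the top.\<close>

lemma up_sh_step: "i < k \<Longrightarrow> x \<in> V \<Longrightarrow> up (Suc i mod k) (sh N x) = sh M (up i x)"
  using face_right[of i x 1] face_top(2)[of i x] by (simp add: up_def)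

text \<open>The indices of the vertical 1-cells in a strip run cyclically in both directions;
  \<open>j\<close> counts squares to the right.\<close>

definition idx :: "nat \<Rightarrow> int \<Rightarrow> nat" where "idx i j = nat ((int i + j) mod int k)"

lemma idx_less [simp]: "idx i j < k"
  unfolding idx_def using k0 by (simp add: nat_less_iff del: gcd_pos_nat)

lemma idx_0 [simp]: "i < k \<Longrightarrow> idx i 0 = i"
  by (simp add: idx_def)

lemma idx_Suc: "idx i (j + 1) = Suc (idx i j) mod k"
proof -
  have "int (Suc (idx i j) mod k) = (int (idx i j) + 1) mod int k"
    by (simp add: zmod_int add.commute)
  also have "int (idx i j) = (int i + j) mod int k" unfolding idx_def using k0 by simp
  also have "((int i + j) mod int k + 1) mod int k = int (idx i (j + 1))"
    unfolding idx_def using k0 by (simp add: mod_add_left_eq add.assoc)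
  finally show ?thesis by linarith
qed

lemma idx_idx: "idx (idx i j) l = idx i (j + l)"
  unfolding idx_def using k0 by (simp add: mod_add_left_eq add.assoc)

lemma up_sh:
  assumes "i < k" "x \<in> V"
  shows "up (idx i j) (sh (j * int N) x) = sh (j * int M) (up i x)"
proof (induction j rule: int_induct[of _ 0])
  case (step1 j)
  have "sh ((j + 1) * int N) x = sh N (sh (j * int N) x)"
    "sh ((j + 1) * int M) (up i x) = sh M (sh (j * int M) (up i x))"
    by (simp_all flip: sh_add add: algebra_simps)
  then show ?case using up_sh_step[of "idx i j" "sh (j * int N) x"] step1 assms by (simp add: idx_Suc)
next
  case (step2 j)
  have e: "sh N (sh ((j - 1) * int N) x) = sh (j * int N) x"
    "sh M (sh ((j - 1) * int M) (up i x)) = sh (j * int M) (up i x)"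
    by (simp_all flip: sh_add add: algebra_simps)
  have "sh M (up (idx i (j - 1)) (sh ((j - 1) * int N) x)) = sh M (sh ((j - 1) * int M) (up i x))"
    using up_sh_step[of "idx i (j - 1)" "sh ((j - 1) * int N) x"] step2 assms idx_Suc[of i "j - 1"] e by simp
  then show ?case by (metis sh_inv(2))
qed (use assms in simp)

section \<open>Branching lines and strips\<close>

abbreviation H :: "'x set" where "H \<equiv> horizontal_part m n X p"

lemma H_eq: "H = (\<Union>x\<in>V. lf ZHor x ` closed_dom ZHor)"
  unfolding horizontal_part_def using char_lift_image[of ZHor "closed_dom ZHor"] by simp

lemma lf_hor_0 [simp]: "x \<in> V \<Longrightarrow> lf ZHor x (0, 0) = x"
  and lf_hor_1 [simp]: "x \<in> V \<Longrightarrow> lf ZHor x (1, 0) = sh 1 x"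
  and lf_vert_0 [simp]: "x \<in> V \<Longrightarrow> i < k \<Longrightarrow> lf (ZVert i) x (0, 0) = x"
  and lf_vert_1 [simp]: "lf (ZVert i) x (0, 1) = up i x"
  and lf_vertex [simp]: "x \<in> V \<Longrightarrow> lf ZVertex x (0, 0) = x"
  by (simp_all add: lf_origin sh_1 s_def up_def)

lemma mem_H: "y \<in> H \<longleftrightarrow> y \<in> topspace X \<and> snd (snd (p y)) = 0"
proof
  assume "y \<in> H"
  then obtain x u where "x \<in> V" "u \<in> closed_dom ZHor" "y = lf ZHor x u" by (auto simp: H_eq)
  then show "y \<in> topspace X \<and> snd (snd (p y)) = 0"
    using lf_top[of ZHor x u] p_lf[of ZHor x u] by (cases u) auto
next
  assume y: "y \<in> topspace X \<and> snd (snd (p y)) = 0"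
  then obtain c x u where c: "c \<in> cells" "x \<in> V" "u \<in> open_dom c" "y = lf c x u"
    using point_in_cell by metis
  then have 0: "snd u = 0" using y p_lf_open by simp
  then show "y \<in> H"
  proof (cases c)
    case ZVertex
    have "x = lf ZHor x (0, 0)" using c by simp
    then have "x \<in> lf ZHor x ` closed_dom ZHor" by (metis image_eqI origin_in_closed_dom)
    then show ?thesis using c ZVertex by (auto simp: H_eq)
  next
    case ZHor
    then have "y \<in> lf ZHor x ` closed_dom ZHor" using c open_dom_subset by blast
    then show ?thesis using c by (auto simp: H_eq)
  qed (use c in auto)
qed

lemma H_top: "H \<subseteq> topspace X" by (auto simp: mem_H)

text \<open>Every lower-dimensional closed cell lies in a side of a square: a horizontal 1-cell at
  the start of the bottom of a square of index 0, a vertical one as the left side of a square of its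
  own index. So the squares determine the topology.\<close>

lemma openin_X_faces:
  assumes sub: "U \<subseteq> topspace X"
    and face: "\<And>i x. i < k \<Longrightarrow> x \<in> V \<Longrightarrow>
      openin (top_of_set ({0..1} \<times> {0..1})) {u \<in> {0..1} \<times> {0..1}. lf (ZFace i) x u \<in> U}"
  shows "openin X U"
proof (rule openin_X[OF sub])
  fix c x assume c: "c \<in> cells" and x: "x \<in> V"
  have pull: "openin (top_of_set (closed_dom c)) {u \<in> closed_dom c. lf c x u \<in> U}"
    if i: "i < k" and g: "continuous_on (closed_dom c) g" "g ` closed_dom c \<subseteq> {0..1} \<times> {0..1}"
      and eq: "\<And>u. u \<in> closed_dom c \<Longrightarrow> lf c x u = lf (ZFace i) x (g u)" for g i
  proof -
    have "continuous_map (top_of_set (closed_dom c)) (top_of_set ({0..1} \<times> {0..1})) g"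
      using g by auto
    from openin_continuous_map_preimage[OF this face[OF i x]]
    show ?thesis using g(2) eq by (simp add: image_subset_iff cong: conj_cong)
  qed
  show "openin (top_of_set (closed_dom c)) {u \<in> closed_dom c. lf c x u \<in> U}"
  proof (cases c)
    case ZVertex
    have "{u \<in> closed_dom c. lf c x u \<in> U} = {} \<or> {u \<in> closed_dom c. lf c x u \<in> U} = closed_dom c"
      using ZVertex by auto
    then show ?thesis by (elim disjE) (simp_all only: openin_empty openin_subtopology_self)
  next
    case ZHor
    show ?thesis
    proof (rule pull[OF k0, of "\<lambda>u. (fst u / real N, 0::real)"])
      show "continuous_on (closed_dom c) (\<lambda>u. (fst u / real N, 0::real))"
        using N0 by (auto intro!: continuous_intros)
      have "a \<le> real N" if "a \<le> 1" for a 
        using N0 that by (metis One_nat_def Suc_leI of_nat_1 of_nat_le_iff order_trans)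
      then show "(\<lambda>u. (fst u / real N, 0::real)) ` closed_dom c \<subseteq> {0..1} \<times> {0..1}"
        using ZHor N0 by (auto simp: field_simps)
      show "lf c x u = lf (ZFace 0) x (fst u / real N, 0::real)" if "u \<in> closed_dom c" for u
        using face_bottom(1)[OF k0 x N0, of "fst u"] that ZHor by auto
    qed
  next
    case (ZVert i)
    show ?thesis
      by (rule pull[of i id]) (use c x ZVert face_left[of i x] in auto)
  next
    case (ZFace i)
    then show ?thesis using face c x by simp
  qed
qed

text \<open>The coordinates \<open>(c, x, u)\<close> of a point are unique, so membership amounts to
  evaluating \<open>G\<close>, and openness can be checked square by square.\<close>

definition cellset :: "(zcell \<Rightarrow> 'x \<Rightarrow> real \<times> real \<Rightarrow> bool) \<Rightarrow> 'x set" where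
  "cellset G = {lf c x u | c x u. c \<in> cells \<and> x \<in> V \<and> u \<in> open_dom c \<and> G c x u}"

lemma cellset_top: "cellset G \<subseteq> topspace X"
  using lf_top open_dom_subset by (fastforce simp: cellset_def)

lemma mem_cellset:
  "c \<in> cells \<Longrightarrow> x \<in> V \<Longrightarrow> u \<in> open_dom c \<Longrightarrow> lf c x u \<in> cellset G \<longleftrightarrow> G c x u"
  unfolding cellset_def using lf_eq_cell by blast

lemma mem_cellset_vertex: "x \<in> V \<Longrightarrow> x \<in> cellset G \<longleftrightarrow> G ZVertex x (0, 0)"
  using mem_cellset[of ZVertex x "(0, 0)" G] by simp

section \<open>Branching lines and their vertices\<close>

definition orb :: "'x \<Rightarrow> 'x set" where "orb x = range (\<lambda>j. sh j x)"

lemma orb_refl [simp]: "x \<in> orb x"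
  unfolding orb_def by (rule range_eqI[of _ _ 0]) simp

lemma orb_sh [simp]: "sh j y \<in> orb x \<longleftrightarrow> y \<in> orb x"
proof
  assume "sh j y \<in> orb x"
  then obtain l where "sh j y = sh l x" by (auto simp: orb_def)
  then have "y = sh (- j + l) x" by (metis sh_inv(2) sh_add)
  then show "y \<in> orb x" by (auto simp: orb_def)
next
  assume "y \<in> orb x"
  then show "sh j y \<in> orb x" by (auto simp: orb_def simp flip: sh_add)
qed

lemma orb_V: "x \<in> V \<Longrightarrow> y \<in> orb x \<Longrightarrow> y \<in> V"
  by (auto simp: orb_def)

lemma orb_eq: "y \<in> orb x \<Longrightarrow> orb y = orb x"
proof -
  assume y: "y \<in> orb x"
  then obtain j where j: "y = sh j x" by (auto simp: orb_def)
  then have x: "x = sh (- j) y" by simp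
  show ?thesis
  proof (intro equalityI subsetI)
    fix z assume "z \<in> orb y"
    then show "z \<in> orb x" using y by (auto simp: orb_def[of y])
  next
    fix z assume "z \<in> orb x"
    moreover have "x \<in> orb y" using x by (auto simp: orb_def)
    ultimately show "z \<in> orb y" by (auto simp: orb_def[of x])
  qed
qed

definition hline :: "'x \<Rightarrow> 'x set" where "hline x = (\<Union>y\<in>orb x. lf ZHor y ` closed_dom ZHor)"

lemma hline_cellset: 
  assumes x: "x \<in> V"
  shows "hline x = cellset (\<lambda>c y u. (c = ZVertex \<or> c = ZHor) \<and> y \<in> orb x)"
proof (intro equalityI subsetI)
  fix z assume "z \<in> hline x"
  then obtain y r where y: "y \<in> orb x" "r \<in> {0..1}" "z = lf ZHor y (r, 0)" by (auto simp: hline_def)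
  have yV: "y \<in> V" using x y(1) by (rule orb_V)
  consider "r = 0" | "r = 1" | "0 < r" "r < 1" using y by fastforce
  then show "z \<in> cellset (\<lambda>c y u. (c = ZVertex \<or> c = ZHor) \<and> y \<in> orb x)"
    by cases (use y yV in \<open>auto simp: mem_cellset_vertex mem_cellset\<close>)
next
  fix z assume "z \<in> cellset (\<lambda>c y u. (c = ZVertex \<or> c = ZHor) \<and> y \<in> orb x)"
  then obtain c y u where y: "y \<in> V" "u \<in> open_dom c" "c = ZVertex \<or> c = ZHor" "y \<in> orb x" "z = lf c y u"
    by (auto simp: cellset_def)
  from y(3) have "z \<in> lf ZHor y ` closed_dom ZHor"
  proof
    assume "c = ZVertex"
    then have "z = lf ZHor y (0, 0)" using y by simp
    then show ?thesis by (metis image_eqI origin_in_closed_dom)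
  qed (use y open_dom_subset in auto)
  then show "z \<in> hline x" using y by (auto simp: hline_def)
qed

lemma hline_subset_H: "x \<in> V \<Longrightarrow> hline x \<subseteq> H"
  using orb_V by (auto simp: hline_def H_eq)

lemma vertex_in_hline: "x \<in> V \<Longrightarrow> y \<in> V \<Longrightarrow> y \<in> hline x \<longleftrightarrow> y \<in> orb x"
  by (simp add: hline_cellset mem_cellset_vertex)

lemma hline_refl: "x \<in> V \<Longrightarrow> x \<in> hline x"
  by (simp add: vertex_in_hline)

lemma hline_eq: "y \<in> orb x \<Longrightarrow> hline y = hline x"
  by (simp add: hline_def orb_eq)

lemma hline_disjoint:
  assumes "x \<in> V" "y \<in> V" "hline x \<inter> hline y \<noteq> {}"
  shows "hline x = hline y"
proof -
  obtain z where z: "z \<in> hline x" "z \<in> hline y" using assms by blast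
  obtain c w u where w: "c \<in> cells" "w \<in> V" "u \<in> open_dom c" "z = lf c w u" "w \<in> orb x"
    using z(1) unfolding hline_cellset[OF assms(1)] cellset_def by blast
  then have "w \<in> orb y" using z(2) by (simp add: hline_cellset[OF assms(2)] mem_cellset)
  then show ?thesis using hline_eq w by metis
qed

lemma connectedin_lf:
  assumes "c \<in> cells" "x \<in> V" "connected A" "A \<subseteq> closed_dom c"
  shows "connectedin X (lf c x ` A)"
  by (rule connectedin_continuous_map_image[OF lf_cont]) (use assms in \<open>auto simp: connectedin_subtopology connectedin_iff_connected\<close>)

lemma hline_connected:
  assumes "x \<in> V"
  shows "connectedin X (hline x)"
proof -
  have "connectedin X (\<Union>j. lf ZHor (sh j x) ` closed_dom ZHor)"
  proof (rule connectedin_int_chain)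
    show "connectedin X (lf ZHor (sh j x) ` closed_dom ZHor)" for j
      using assms by (intro connectedin_lf connected_closed_dom) auto
    fix j
    have "sh (j + 1) x = lf ZHor (sh j x) (1, 0)" "sh (j + 1) x = lf ZHor (sh (j + 1) x) (0, 0)"
      using assms by (simp_all flip: sh_add add: add.commute)
    moreover have "(1, 0) \<in> closed_dom ZHor" by simp
    ultimately show "lf ZHor (sh j x) ` closed_dom ZHor \<inter> lf ZHor (sh (j + 1) x) ` closed_dom ZHor \<noteq> {}"
      by (metis IntI emptyE image_eqI origin_in_closed_dom)
  qed
  then show ?thesis by (simp add: hline_def orb_def)
qed

lemma face_bottom_point:
  assumes "i < k" "x \<in> V" "0 \<le> a" "a \<le> 1"
  obtains j :: int and r where "0 \<le> j" "j < int N" "r \<in> {0..1}" "a = (of_int j + r) / real N"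
    "lf (ZFace i) x (a, 0) = lf ZHor (sh j x) (r, 0)"
proof -
  obtain j r where jr: "j < N" "r \<in> {0..1}" "a = (real j + r) / real N"
    using grid_point[OF assms(3,4) N0] by metis
  then show thesis using that[of "int j" r] face_bottom(1)[OF assms(1,2) jr(1,2)] by simp
qed

lemma face_top_point:
  assumes "i < k" "x \<in> V" "0 \<le> a" "a \<le> 1"
  obtains j :: int and r where "0 \<le> j" "j < int M" "r \<in> {0..1}" "a = (of_int j + r) / real M"
    "lf (ZFace i) x (a, 1) = lf ZHor (sh j (up i x)) (r, 0)"
proof -
  obtain j r where jr: "j < M" "r \<in> {0..1}" "a = (real j + r) / real M"
    using grid_point[OF assms(3,4) M0] by metis
  then show thesis using that[of "int j" r] face_top(1)[OF assms(1,2) jr(1,2)] by simp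
qed

lemma hor_in_hline: "x \<in> V \<Longrightarrow> y \<in> V \<Longrightarrow> r \<in> {0..1} \<Longrightarrow> lf ZHor y (r, 0) \<in> hline x \<longleftrightarrow> y \<in> orb x"
  by (cases "r = 0"; cases "r = 1") (auto simp: hline_cellset mem_cellset mem_cellset_vertex)

lemma hline_openin_H:
  assumes x: "x \<in> V"
  shows "openin (subtopology X H) (hline x)"
proof -
  \<comment> \<open>An open collar of the line: the lower halves of the squares and vertical 1-cells
    that start on it and the upper halves of those that end on it. It meets no other line.\<close>
  define G where "G c y u \<longleftrightarrow> (case c of ZVert i \<Rightarrow> snd u < 1/2 \<and> y \<in> orb x \<or> snd u > 1/2 \<and> up i y \<in> orb x
    | ZFace i \<Rightarrow> snd u < 1/2 \<and> y \<in> orb x \<or> snd u > 1/2 \<and> up i y \<in> orb x | _ \<Rightarrow> y \<in> orb x)"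
    for c y and u :: "real \<times> real"
  let ?U = "cellset G"
  have hor: "lf ZHor y (r, 0) \<in> ?U \<longleftrightarrow> y \<in> orb x" if "y \<in> V" "r \<in> {0..1}" for y r
    by (cases "r = 0"; cases "r = 1") (use that in \<open>auto simp: mem_cellset_vertex mem_cellset G_def\<close>)
  have vert: "lf (ZVert i) y (0, t) \<in> ?U \<longleftrightarrow> t < 1/2 \<and> y \<in> orb x \<or> t > 1/2 \<and> up i y \<in> orb x"
    if "y \<in> V" "i < k" "t \<in> {0..1}" for i y t
    by (cases "t = 0"; cases "t = 1") (use that in \<open>auto simp: mem_cellset_vertex mem_cellset G_def\<close>)
  have face: "lf (ZFace i) y (a, b) \<in> ?U \<longleftrightarrow> b < 1/2 \<and> y \<in> orb x \<or> b > 1/2 \<and> up i y \<in> orb x"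
    if y: "y \<in> V" "i < k" and a: "0 \<le> a" "a \<le> 1" and b: "0 \<le> b" "b \<le> 1" for i y a b
  proof -
    consider "b = 0" | "b = 1" | "a = 0" | "a = 1" | "0 < a" "a < 1" "0 < b" "b < 1"
      using a b by fastforce
    then show ?thesis
    proof cases
      case 1
      obtain j r where "r \<in> {0..1}" "lf (ZFace i) y (a, 0) = lf ZHor (sh j y) (r, 0)"
        using face_bottom_point[OF y(2,1) a] by metis
      then show ?thesis using hor[of "sh j y" r] 1 y by simp
    next
      case 2
      obtain j r where "r \<in> {0..1}" "lf (ZFace i) y (a, 1) = lf ZHor (sh j (up i y)) (r, 0)"
        using face_top_point[OF y(2,1) a] by metis
      then show ?thesis using hor[of "sh j (up i y)" r] 2 y by simp
    next
      case 3
      then show ?thesis using face_left[of i y b] vert[of y i b] y b by simp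
    next
      case 4
      then show ?thesis using face_right[of i y b] vert[of "sh N y" "Suc i mod k" b] y b k0 up_sh_step[of i y] by simp
    next
      case 5
      then show ?thesis using y by (auto simp: mem_cellset G_def)
    qed
  qed
  have "openin X ?U"
  proof (rule openin_X_faces[OF cellset_top])
    fix i y assume i: "i < k" and y: "y \<in> V"
    have "{u \<in> {0..1} \<times> {0..1}. lf (ZFace i) y u \<in> ?U} = ({0..1} \<times> {0..1}) \<inter>
        ((if y \<in> orb x then UNIV \<times> {..<1/2} else {}) \<union> (if up i y \<in> orb x then UNIV \<times> {1/2<..} else {}))"
      using face[OF y i] by auto
    then show "openin (top_of_set ({0..1} \<times> {0..1})) {u \<in> {0..1} \<times> {0..1}. lf (ZFace i) y u \<in> ?U}"
      by (simp only: openin_open_Int open_Un open_Times open_UNIV open_lessThan open_greaterThan open_empty split: if_split) auto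
  qed
  moreover have "hline x = ?U \<inter> H"
  proof (intro equalityI subsetI)
    fix z assume z: "z \<in> hline x"
    then obtain y r where y: "y \<in> orb x" "r \<in> {0..1}" "z = lf ZHor y (r, 0)" by (auto simp: hline_def)
    then show "z \<in> ?U \<inter> H" using hor[of y r] orb_V[OF x y(1)] z hline_subset_H[OF x] by auto
  next
    fix z assume z: "z \<in> ?U \<inter> H"
    then obtain y r where y: "y \<in> V" "r \<in> {0..1}" "z = lf ZHor y (r, 0)" by (auto simp: H_eq)
    then show "z \<in> hline x" using z hor[of y r] hor_in_hline[OF x y(1,2)] by simp
  qed
  ultimately show ?thesis by (auto simp: openin_subtopology)
qed

lemma branching_lines_eq: "branching_lines m n X p = hline ` V"
  unfolding branching_lines_def
proof (rule connected_components_of_open_partition)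
  show "\<Union> (hline ` V) = topspace (subtopology X H)"
  proof -
    have "\<Union> (hline ` V) = H"
    proof
      show "\<Union> (hline ` V) \<subseteq> H" using hline_subset_H by blast
      show "H \<subseteq> \<Union> (hline ` V)" using orb_refl by (force simp: H_eq hline_def)
    qed
    then show ?thesis using H_top by (simp add: inf.absorb2)
  qed
  show "A \<noteq> {}" if "A \<in> hline ` V" for A using that hline_refl by blast
  show "openin (subtopology X H) A" if "A \<in> hline ` V" for A using that hline_openin_H by blast
  show "connectedin (subtopology X H) A" if "A \<in> hline ` V" for A
    using that hline_connected hline_subset_H by (auto simp only: connectedin_subtopology)
  show "A \<inter> B = {}" if "A \<in> hline ` V" "B \<in> hline ` V" "A \<noteq> B" for A B
    using that hline_disjoint by blast
qed

text \<open>The next vertical 1-cell to the right of \<open>t\<^sub>i\<close> over \<open>x\<close> in its strip is \<open>t\<^sub>i\<^sub>+\<^sub>1\<close> over the vertex \<open>n/k\<close>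
  steps further.\<close>

definition same_strip :: "nat \<Rightarrow> 'x \<Rightarrow> nat \<Rightarrow> 'x \<Rightarrow> bool" where
  "same_strip i x i' y \<longleftrightarrow> (\<exists>j. i' = idx i j \<and> y = sh (j * int N) x)"

lemma idx_1: "i < k \<Longrightarrow> idx i 1 = Suc i mod k"
  using idx_Suc[of i 0] by simp

lemma same_strip_refl [simp]: "i < k \<Longrightarrow> same_strip i x i x"
  unfolding same_strip_def by (rule exI[of _ 0]) simp

lemma same_strip_idx:
  assumes "same_strip i x i' y"
  shows "same_strip i x (idx i' j) (sh (j * int N) y)"
proof -
  obtain l where "i' = idx i l" "y = sh (l * int N) x" using assms by (auto simp: same_strip_def)
  then show ?thesis unfolding same_strip_def
    by (intro exI[of _ "l + j"]) (simp add: idx_idx algebra_simps flip: sh_add)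
qed

lemma same_strip_idx_iff:
  assumes "i' < k"
  shows "same_strip i x (idx i' j) (sh (j * int N) y) \<longleftrightarrow> same_strip i x i' y"
proof
  assume "same_strip i x (idx i' j) (sh (j * int N) y)"
  from same_strip_idx[OF this, of "- j"] assms show "same_strip i x i' y"
    by (simp add: idx_idx flip: sh_add)
qed (rule same_strip_idx)

lemma same_strip_step: "i' < k \<Longrightarrow> same_strip i x (Suc i' mod k) (sh (int N) y) \<longleftrightarrow> same_strip i x i' y"
  using same_strip_idx_iff[of i' i x 1 y] by (simp add: idx_1)

lemma same_strip_sym: "i < k \<Longrightarrow> same_strip i x i' y \<Longrightarrow> same_strip i' y i x"
proof -
  assume i: "i < k" and "same_strip i x i' y"
  then obtain l where "i' = idx i l" "y = sh (l * int N) x" by (auto simp: same_strip_def)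
  then show ?thesis using i unfolding same_strip_def
    by (intro exI[of _ "- l"]) (simp add: idx_idx flip: sh_add)
qed

lemma same_strip_trans: "same_strip i x i' y \<Longrightarrow> same_strip i' y i'' z \<Longrightarrow> same_strip i x i'' z"
  using same_strip_idx by (auto simp: same_strip_def[of i'])

section \<open>Open strips and their closures\<close>

text \<open>The open strip through the vertical 1-cell \<open>(i, x)\<close>. A square goes with the
  vertical 1-cell of the same index and corner, which is its left side.\<close>

definition sp :: "nat \<Rightarrow> 'x \<Rightarrow> 'x set" where
  "sp i x = cellset (\<lambda>c y u. case c of ZVert i' \<Rightarrow> same_strip i x i' y | ZFace i' \<Rightarrow> same_strip i x i' y | _ \<Rightarrow> False)"

lemma vert_in_sp: "i' < k \<Longrightarrow> y \<in> V \<Longrightarrow> 0 < t \<Longrightarrow> t < 1 \<Longrightarrow> lf (ZVert i') y (0, t) \<in> sp i x \<longleftrightarrow> same_strip i x i' y"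
  by (simp add: sp_def mem_cellset)

lemma sp_disjoint_H: "sp i x \<inter> H = {}"
proof -
  have "snd (snd (p z)) \<noteq> 0" if z: "z \<in> sp i x" for z
  proof -
    obtain c y u where y: "c \<in> cells" "y \<in> V" "u \<in> open_dom c" "z = lf c y u"
      "case c of ZVert i' \<Rightarrow> same_strip i x i' y | ZFace i' \<Rightarrow> same_strip i x i' y | _ \<Rightarrow> False"
      using z unfolding sp_def cellset_def by blast
    then show ?thesis using p_lf_open[of c y u] by (cases c) auto
  qed
  then show ?thesis by (auto simp: mem_H)
qed

lemma sp_top: "sp i x \<subseteq> topspace X"
  unfolding sp_def by (rule cellset_top)

lemma face_in_sp:
  assumes "i' < k" "y \<in> V" "a \<in> {0..1}" "b \<in> {0..1}"
  shows "lf (ZFace i') y (a, b) \<in> sp i x \<longleftrightarrow> 0 < b \<and> b < 1 \<and> same_strip i x i' y"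
proof (cases "0 < b \<and> b < 1")
  case True
  consider "a = 0" | "a = 1" | "0 < a" "a < 1" using assms by fastforce
  then show ?thesis
  proof cases
    case 1
    then show ?thesis using face_left[of i' y b] vert_in_sp[of i' y b] True assms by simp
  next
    case 2
    then show ?thesis
      using face_right[of i' y b] vert_in_sp[of "Suc i' mod k" "sh N y" b] True assms k0 same_strip_step[of i' i x y] by simp
  next
    case 3
    then show ?thesis using True assms by (simp add: sp_def mem_cellset)
  qed
next
  case False
  then have "b = 0 \<or> b = 1" using assms by auto
  then have "snd (snd (p (lf (ZFace i') y (a, b)))) = 0"
    using p_lf[of "ZFace i'" y "(a, b)"] assms by auto
  then have "lf (ZFace i') y (a, b) \<in> H" using lf_top[of "ZFace i'" y "(a, b)"] assms by (simp add: mem_H)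
  then show ?thesis using sp_disjoint_H False by blast
qed

lemma sp_open: 
  assumes "i < k" "x \<in> V"
  shows "openin X (sp i x)"
proof (rule openin_X_faces[OF sp_top])
  fix i' y assume "i' < k" "y \<in> V"
  then have "{u \<in> {0..1} \<times> {0..1}. lf (ZFace i') y u \<in> sp i x} =
      ({0..1} \<times> {0..1}) \<inter> (if same_strip i x i' y then UNIV \<times> {0<..<1} else {})"
    by (auto simp: face_in_sp)
  then show "openin (top_of_set ({0..1} \<times> {0..1})) {u \<in> {0..1} \<times> {0..1}. lf (ZFace i') y u \<in> sp i x}"
    by (simp add: openin_open_Int open_Times)
qed

lemma sp_union: "i < k \<Longrightarrow> x \<in> V \<Longrightarrow>
    sp i x = (\<Union>j. lf (ZFace (idx i j)) (sh (j * int N) x) ` ({0..1} \<times> {0<..<1}))"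
proof (intro equalityI subsetI)
  fix z assume i: "i < k" "x \<in> V" and "z \<in> sp i x"
  then obtain c y u where y: "c \<in> cells" "y \<in> V" "u \<in> open_dom c" "z = lf c y u"
    "case c of ZVert i' \<Rightarrow> same_strip i x i' y | ZFace i' \<Rightarrow> same_strip i x i' y | _ \<Rightarrow> False"
    unfolding sp_def cellset_def by blast
  obtain i' v where "z = lf (ZFace i') y v" "same_strip i x i' y" "v \<in> {0..1} \<times> {0<..<1}"
  proof (cases c)
    case (ZVert i')
    then show thesis using y that[of i' u] face_left[of i' y "snd u"] by auto
  next
    case (ZFace i')
    then show thesis using y that[of i' u] by auto
  qed (use y in auto)
  then show "z \<in> (\<Union>j. lf (ZFace (idx i j)) (sh (j * int N) x) ` ({0..1} \<times> {0<..<1}))"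
    by (auto simp: same_strip_def)
next
  fix z assume i: "i < k" "x \<in> V" and "z \<in> (\<Union>j. lf (ZFace (idx i j)) (sh (j * int N) x) ` ({0..1} \<times> {0<..<1}))"
  then obtain j a b where "z = lf (ZFace (idx i j)) (sh (j * int N) x) (a, b)" "a \<in> {0..1}" "0 < b" "b < 1" by auto
  then show "z \<in> sp i x" using i by (auto simp: face_in_sp same_strip_def)
qed

lemma sp_connected: 
  assumes "i < k" "x \<in> V"
  shows "connectedin X (sp i x)"
  unfolding sp_union[OF assms]
proof (rule connectedin_int_chain)
  fix j
  show "connectedin X (lf (ZFace (idx i j)) (sh (j * int N) x) ` ({0..1} \<times> {0<..<1}))"
    using assms by (intro connectedin_lf connected_Times) auto
  have "sh (int N) (sh (j * int N) x) = sh ((j + 1) * int N) x"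
    by (simp flip: sh_add add: algebra_simps)
  \<comment> \<open>Consecutive squares share the midpoint of a vertical side.\<close>
  then have "lf (ZFace (idx i j)) (sh (j * int N) x) (1, 1/2) = lf (ZFace (idx i (j + 1))) (sh ((j + 1) * int N) x) (0, 1/2)"
    using face_right[of "idx i j" "sh (j * int N) x" "1/2"] face_left[of "idx i (j + 1)" "sh ((j + 1) * int N) x" "1/2"] assms
    using idx_less[of i "j + 1"] by (simp add: idx_Suc)
  moreover have "(1, 1/2) \<in> {0..1::real} \<times> {0<..<1::real}" "(0, 1/2) \<in> {0..1::real} \<times> {0<..<1::real}" by auto
  ultimately have "lf (ZFace (idx i j)) (sh (j * int N) x) (1, 1/2) \<in> lf (ZFace (idx i j)) (sh (j * int N) x) ` ({0..1} \<times> {0<..<1}) \<inter>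
      lf (ZFace (idx i (j + 1))) (sh ((j + 1) * int N) x) ` ({0..1} \<times> {0<..<1})"
    by (intro IntI image_eqI[OF refl]) (auto intro: image_eqI)
  then show "lf (ZFace (idx i j)) (sh (j * int N) x) ` ({0..1} \<times> {0<..<1}) \<inter>
      lf (ZFace (idx i (j + 1))) (sh ((j + 1) * int N) x) ` ({0..1} \<times> {0<..<1}) \<noteq> {}"
    by blast
qed

lemma sp_nonempty: "i < k \<Longrightarrow> x \<in> V \<Longrightarrow> sp i x \<noteq> {}"
  using vert_in_sp[of i x "1/2" i x] by auto

lemma sp_eq: "i < k \<Longrightarrow> same_strip i x i' y \<Longrightarrow> sp i x = sp i' y"
proof -
  assume "i < k" "same_strip i x i' y"
  then have "same_strip i x = same_strip i' y"
    by (intro ext iffI) (blast intro: same_strip_trans[OF same_strip_sym], blast intro: same_strip_trans)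
  then show ?thesis unfolding sp_def by (rule arg_cong)
qed

lemma sp_point:
  assumes "z \<in> topspace X - H"
  obtains i y u where "i < k" "y \<in> V" "(u \<in> open_dom (ZFace i) \<and> z = lf (ZFace i) y u) \<or> (u \<in> open_dom (ZVert i) \<and> z = lf (ZVert i) y u)"
    "\<And>i' x. z \<in> sp i' x \<longleftrightarrow> same_strip i' x i y"
proof -
  have "z \<in> topspace X" using assms by blast
  then obtain c y u where c: "c \<in> cells" "y \<in> V" "u \<in> open_dom c" "z = lf c y u"
    by (rule point_in_cell)
  show thesis
  proof (cases c)
    case ZVertex
    then show thesis using assms c p_lf_open[of c y u] by (auto simp: mem_H)
  next
    case ZHor
    then show thesis using assms c p_lf_open[of c y u] by (auto simp: mem_H)
  next
    case (ZVert i)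
    then show thesis using c that[of i y u] by (auto simp: sp_def mem_cellset)
  next
    case (ZFace i)
    then show thesis using c that[of i y u] by (auto simp: sp_def mem_cellset)
  qed
qed

lemma sp_disjoint:
  assumes "i < k" "x \<in> V" "i' < k" "x' \<in> V" "sp i x \<inter> sp i' x' \<noteq> {}"
  shows "same_strip i x i' x'"
proof -
  obtain z where z: "z \<in> sp i x" "z \<in> sp i' x'" using assms by blast
  then have "z \<in> topspace X - H" using sp_top sp_disjoint_H by blast
  then obtain l y where "\<And>i' x. z \<in> sp i' x \<longleftrightarrow> same_strip i' x l y" using sp_point by metis
  then show ?thesis using z same_strip_sym same_strip_trans assms by blast
qed

lemma components_off_H:
  "connected_components_of (subtopology X (topspace X - H)) = {sp i x | i x. i < k \<and> x \<in> V}" (is "_ = ?S")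
proof (rule connected_components_of_open_partition)
  have sub: "sp i x \<subseteq> topspace X - H" for i x using sp_top sp_disjoint_H by blast
  show "A \<noteq> {}" if "A \<in> ?S" for A using that sp_nonempty by blast
  show "openin (subtopology X (topspace X - H)) A" if "A \<in> ?S" for A
  proof -
    obtain i x where A: "A = sp i x" "i < k" "x \<in> V" using \<open>A \<in> ?S\<close> by blast
    have "sp i x = sp i x \<inter> (topspace X - H)" using sub by blast
    then show ?thesis unfolding A(1) openin_subtopology using sp_open[OF A(2,3)] by blast
  qed
  show "connectedin (subtopology X (topspace X - H)) A" if "A \<in> ?S" for A
  proof -
    obtain i x where A: "A = sp i x" "i < k" "x \<in> V" using \<open>A \<in> ?S\<close> by blast
    then show ?thesis using sp_connected sub by (simp only: connectedin_subtopology simp_thms)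
  qed
  show "A \<inter> B = {}" if "A \<in> ?S" "B \<in> ?S" "A \<noteq> B" for A B
    using that sp_disjoint sp_eq by blast
  show "\<Union> ?S = topspace (subtopology X (topspace X - H))"
  proof (intro equalityI subsetI)
    fix z assume "z \<in> topspace (subtopology X (topspace X - H))"
    then have "z \<in> topspace X - H" by auto
    then obtain i y u where iy: "i < k" "y \<in> V" "\<And>i' x. z \<in> sp i' x \<longleftrightarrow> same_strip i' x i y" by (rule sp_point) blast
    then have "z \<in> sp i y" by simp
    then show "z \<in> \<Union> ?S" using iy(1,2) by blast
  qed (use sub in auto)
qed

definition strip :: "nat \<Rightarrow> 'x \<Rightarrow> 'x set" where "strip i x = X closure_of (sp i x)"

lemma strips_eq: "strips m n X p = {strip i x | i x. i < k \<and> x \<in> V}"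
  unfolding strips_def components_off_H strip_def by blast

text \<open>A point off \<open>H\<close> has an open strip as neighbourhood; if it is in the closure
  of another open strip, the two strips meet and are equal. So the closure adds only points of
  \<open>H\<close>.\<close>

lemma strip_off_H:
  assumes "i < k" "x \<in> V"
  shows "strip i x - H = sp i x"
proof (intro equalityI subsetI)
  fix z assume z: "z \<in> strip i x - H"
  then have "z \<in> topspace X - H" using closure_of_subset_topspace[of X "sp i x"] by (auto simp: strip_def)
  then obtain l y where ly: "l < k" "y \<in> V" "\<And>i' x. z \<in> sp i' x \<longleftrightarrow> same_strip i' x l y" by (rule sp_point) blast
  then have "z \<in> sp l y" by simp
  then have "sp i x \<inter> sp l y \<noteq> {}" using z sp_open[OF ly(1,2)] by (auto simp: strip_def in_closure_of)
  then have "same_strip i x l y" by (intro sp_disjoint assms ly)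
  then show "z \<in> sp i x" using ly by simp
next
  fix z assume "z \<in> sp i x"
  then show "z \<in> strip i x - H"
    using sp_disjoint_H subsetD[OF closure_of_subset[OF sp_top]] by (auto simp: strip_def)
qed

text \<open>The image of the compact model cell is closed since the cover is Hausdorff. Consequently
  automorphisms, which are required to permute open cells, permute closed cells as well.\<close>

lemma lf_closed_image:
  assumes "c \<in> cells" "x \<in> V"
  shows "X closure_of (cell c x) = lf c x ` closed_dom c"
proof (rule equalityI)
  have "compactin X (lf c x ` closed_dom c)"
    by (rule image_compactin[OF _ lf_cont[OF assms]]) (simp add: compactin_subtopology compact_closed_dom)
  then have "closedin X (lf c x ` closed_dom c)"
    using Hausdorff_X compactin_imp_closedin by blast
  then show "X closure_of (cell c x) \<subseteq> lf c x ` closed_dom c"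
    using open_dom_subset by (intro closure_of_minimal) (auto simp: cell_def)
  have "lf c x ` (top_of_set (closed_dom c) closure_of open_dom c) \<subseteq> X closure_of (lf c x ` open_dom c)"
    by (rule continuous_map_image_closure_subset[OF lf_cont[OF assms]])
  moreover have "top_of_set (closed_dom c) closure_of open_dom c = closed_dom c"
    using open_dom_subset[of c] by (simp add: closure_of_subtopology inf.absorb2 closure_open_dom)
  ultimately show "lf c x ` closed_dom c \<subseteq> X closure_of (cell c x)" by (simp add: cell_def)
qed

lemma vert_in_strip:
  assumes "i < k" "x \<in> V" "i' < k" "y \<in> V"
  shows "lf (ZVert i') y ` closed_dom (ZVert i') \<subseteq> strip i x \<longleftrightarrow> same_strip i x i' y"
proof
  assume "lf (ZVert i') y ` closed_dom (ZVert i') \<subseteq> strip i x"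
  then have 1: "lf (ZVert i') y (0, 1/2) \<in> strip i x" by auto
  have "lf (ZVert i') y (0, 1/2) \<notin> H" using p_lf_open[of "ZVert i'" y "(0, 1/2)"] assms by (simp add: mem_H)
  then show "same_strip i x i' y" using 1 strip_off_H assms vert_in_sp[of i' y "1/2" i x] by auto
next
  assume "same_strip i x i' y"
  then have "cell (ZVert i') y \<subseteq> sp i x" using assms vert_in_sp by (auto simp: cell_def)
  from closure_of_mono[OF this, of X] show "lf (ZVert i') y ` closed_dom (ZVert i') \<subseteq> strip i x"
    using lf_closed_image[of "ZVert i'" y] assms by (simp add: strip_def)
qed

text \<open>By \<open>up_sh\<close>, all vertical 1-cells of a strip start on one line and end on
  one line; this makes the descriptions in \<open>lower_line\<close> and \<open>upper_line\<close>
  unique. The point \<open>u\<close> selects the end.\<close>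

lemma end_line_strip:
  assumes i: "i < k" "x \<in> V" and u: "u \<in> {(0, 0), (0, 1)}"
  shows "(THE L. L \<in> branching_lines m n X p \<and> (\<exists>i'<k. \<exists>h\<in>clifts (ZVert i').
      h ` closed_dom (ZVert i') \<subseteq> strip i x \<and> h u \<in> L)) = hline (lf (ZVert i) x u)"
proof (rule the_equality)
  have uc: "u \<in> closed_dom (ZVert l)" for l using u by auto
  have e: "lf (ZVert i) x u \<in> V" if "i < k" "x \<in> V" for i x using u that by auto
  have "lf (ZVert i) x \<in> clifts (ZVert i)" "lf (ZVert i) x ` closed_dom (ZVert i) \<subseteq> strip i x"
    using vert_in_strip[OF i i] i lf_in[of "ZVert i" x] by simp_all
  then show "hline (lf (ZVert i) x u) \<in> branching_lines m n X p \<and> (\<exists>i'<k. \<exists>h\<in>clifts (ZVert i').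
      h ` closed_dom (ZVert i') \<subseteq> strip i x \<and> h u \<in> hline (lf (ZVert i) x u))"
    using hline_refl[OF e[OF i]] e[OF i] i by (auto simp: branching_lines_eq)
  fix L assume L: "L \<in> branching_lines m n X p \<and> (\<exists>i'<k. \<exists>h\<in>clifts (ZVert i').
      h ` closed_dom (ZVert i') \<subseteq> strip i x \<and> h u \<in> L)"
  then obtain i' h where h: "i' < k" "h \<in> clifts (ZVert i')" "h ` closed_dom (ZVert i') \<subseteq> strip i x" "h u \<in> L"
    by blast
  let ?y = "h (0, 0)"
  have y: "?y \<in> V" by (rule clift_origin[OF h(2)])
  have eq: "h v = lf (ZVert i') ?y v" if "v \<in> closed_dom (ZVert i')" for v
    using clift_eq_lf[OF _ h(2) that] h(1) by simp
  have "lf (ZVert i') ?y ` closed_dom (ZVert i') \<subseteq> strip i x"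
    using h(3) eq by (metis image_cong)
  then have "same_strip i x i' ?y" using vert_in_strip[OF i h(1) y] by blast
  then obtain j where j: "i' = idx i j" "?y = sh (j * int N) x" by (auto simp: same_strip_def)
  have "lf (ZVert i') ?y u \<in> orb (lf (ZVert i) x u)"
    using u i up_sh[OF i, of j] by (auto simp: j)
  then have 1: "lf (ZVert i') ?y u \<in> hline (lf (ZVert i) x u)"
    using vertex_in_hline[OF e[OF i] e[OF h(1) y]] by blast
  obtain z where z: "z \<in> V" "L = hline z" using L by (auto simp: branching_lines_eq)
  have "lf (ZVert i') ?y u \<in> hline z" using h(4) eq[OF uc] z by metis
  then show "L = hline (lf (ZVert i) x u)"
    unfolding z(2) using 1 by (intro hline_disjoint z e i) blast
qed

lemma lower_line_strip: "i < k \<Longrightarrow> x \<in> V \<Longrightarrow> lower_line m n X p (strip i x) = hline x"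
  using end_line_strip[of i x "(0, 0)"] by (simp add: lower_line_def)

lemma upper_line_strip: "i < k \<Longrightarrow> x \<in> V \<Longrightarrow> upper_line m n X p (strip i x) = hline (up i x)"
  using end_line_strip[of i x "(0, 1)"] by (simp add: upper_line_def)

section \<open>Automorphisms of the universal cover\<close>

abbreviation "C0 \<equiv> X_cells m n X p"
abbreviation "\<Gamma> \<equiv> cell_homeos X C0"

lemma C0_sub: "C0 \<subseteq> Pow (topspace X)" "{} \<notin> C0"
proof -
  show "C0 \<subseteq> Pow (topspace X)" using cell_top by (auto simp: X_cells_eq)
  show "{} \<notin> C0" using cell_nonempty by (auto simp: X_cells_eq)
qed

lemma cell_C0 [simp]: "c \<in> cells \<Longrightarrow> x \<in> V \<Longrightarrow> cell c x \<in> C0"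
  by (auto simp: X_cells_eq)

lemma C0_E:
  assumes "\<sigma> \<in> C0"
  obtains c x where "c \<in> cells" "x \<in> V" "\<sigma> = cell c x"
  using assms by (auto simp: X_cells_eq)

lemma cell_eq_iff: "c \<in> cells \<Longrightarrow> d \<in> cells \<Longrightarrow> x \<in> V \<Longrightarrow> y \<in> V \<Longrightarrow> cell c x = cell d y \<longleftrightarrow> c = d \<and> x = y"
  using cell_disjoint[of c d x y] cell_nonempty[of c x] by auto

lemma lf_mem_cell: "c \<in> cells \<Longrightarrow> d \<in> cells \<Longrightarrow> x \<in> V \<Longrightarrow> y \<in> V \<Longrightarrow> u \<in> open_dom c \<Longrightarrow>
    lf c x u \<in> cell d y \<longleftrightarrow> c = d \<and> x = y"
  unfolding cell_def using lf_eq_cell by blast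

lemma cell_vertex: "x \<in> V \<Longrightarrow> cell ZVertex x = {x}"
  by (simp add: cell_def)

section \<open>Recognising the kind of a cell topologically\<close>

lemma cell_singleton_iff:
  assumes "c \<in> cells" "x \<in> V"
  shows "(\<exists>z. cell c x = {z}) \<longleftrightarrow> c = ZVertex"
proof
  assume "\<exists>z. cell c x = {z}"
  then obtain z where z: "cell c x = {z}" by blast
  have one: "u = v" if "u \<in> open_dom c" "v \<in> open_dom c" for u v
  proof -
    have "lf c x u = z" "lf c x v = z" using z that by (auto simp: cell_def)
    then show ?thesis using lf_eq_cell[of c x u c x v] assms that by simp
  qed
  show "c = ZVertex"
  proof (cases c)
    case ZHor
    then show ?thesis using one[of "(1/2, 0)" "(1/3, 0)"] by simp
  next
    case (ZVert i)
    then show ?thesis using one[of "(0, 1/2)" "(0, 1/3)"] by simp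
  next
    case (ZFace i)
    then show ?thesis using one[of "(1/2, 1/2)" "(1/2, 1/3)"] by simp
  qed
qed (use assms cell_vertex in auto)

lemma open_meets_cell:
  assumes "openin X U" "c \<in> cells" "x \<in> V" "u \<in> closed_dom c" "lf c x u \<in> U"
  shows "U \<inter> cell c x \<noteq> {}"
proof -
  have "lf c x u \<in> X closure_of (cell c x)" using lf_closed_image assms by blast
  then show ?thesis using assms by (auto simp: in_closure_of)
qed

lemma face_cell_open:
  assumes "i < k" "x \<in> V"
  shows "openin X (cell (ZFace i) x)"
proof (rule openin_X_faces)
  fix i' y assume i': "i' < k" "y \<in> V"
  have "lf (ZFace i') y (a, b) \<in> cell (ZFace i) x \<longleftrightarrow> a \<in> {0<..<1} \<and> b \<in> {0<..<1} \<and> i' = i \<and> y = x"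
    if "a \<in> {0..1}" "b \<in> {0..1}" for a b
  proof (cases "a \<in> {0<..<1} \<and> b \<in> {0<..<1}")
    case True
    then show ?thesis using lf_mem_cell[of "ZFace i'" "ZFace i" y x "(a, b)"] assms i' by auto
  next
    case False
    then have "a = 0 \<or> a = 1 \<or> b = 0 \<or> b = 1" using that by auto
    then have "fst (zchar m n (ZFace i') (a, b)) \<noteq> ZFace i" by (auto simp: a_path_def t_path_def)
    then have "fst (p (lf (ZFace i') y (a, b))) \<noteq> ZFace i" using p_lf[of "ZFace i'" y "(a, b)"] i' that by simp
    moreover have "fst (p z) = ZFace i" if "z \<in> cell (ZFace i) x" for z
      using that p_lf_open[of "ZFace i" x] assms by (auto simp: cell_def)
    ultimately show ?thesis using False by blast
  qed
  then have "{u \<in> {0..1} \<times> {0..1}. lf (ZFace i') y u \<in> cell (ZFace i) x} =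
      ({0..1} \<times> {0..1}) \<inter> (if i' = i \<and> y = x then {0<..<1} \<times> {0<..<1} else {})"
    by auto
  then show "openin (top_of_set ({0..1} \<times> {0..1})) {u \<in> {0..1} \<times> {0..1}. lf (ZFace i') y u \<in> cell (ZFace i) x}"
    by (simp add: openin_open_Int open_Times)
qed (use cell_top assms in auto)

text \<open>The square whose bottom carries the 1-cell over \<open>x\<close> at position
  \<open>j\<close> has its corner \<open>j\<close> steps back along the line.\<close>

lemma hor_bottom_point:
  assumes "i < k" "x \<in> V" "j < N" "r \<in> {0..1}"
  shows "\<exists>a\<in>{0..1}. lf (ZFace i) (sh (- int j) x) (a, 0) = lf ZHor x (r, 0)"
proof (rule bexI[of _ "(real j + r) / real N"])
  have "real j + 1 \<le> real N" using assms(3) by linarith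
  then show "(real j + r) / real N \<in> {0..1}" using assms(3,4) by (auto simp: field_simps)
  show "lf (ZFace i) (sh (- int j) x) ((real j + r) / real N, 0) = lf ZHor x (r, 0)"
    using face_bottom(1)[of i "sh (- int j) x" j r] assms by simp
qed

lemma hor_top_point:
  assumes "i < k" "y \<in> V" "up i y = sh (- int j) x" "j < M" "r \<in> {0..1}"
  shows "\<exists>a\<in>{0..1}. lf (ZFace i) y (a, 1) = lf ZHor x (r, 0)"
proof (rule bexI[of _ "(real j + r) / real M"])
  have "real j + 1 \<le> real M" using assms(4) by linarith
  then show "(real j + r) / real M \<in> {0..1}" using assms(4,5) by (auto simp: field_simps)
  show "lf (ZFace i) y ((real j + r) / real M, 1) = lf ZHor x (r, 0)"
    using face_top(1)[of i y j r] assms by simp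
qed

lemma cell_open_iff:
  assumes c: "c \<in> cells" and x: "x \<in> V"
  shows "openin X (cell c x) \<longleftrightarrow> c \<in> range ZFace"
proof
  assume op: "openin X (cell c x)"
  have *: "c = d" if "d \<in> cells" "y \<in> V" "u \<in> closed_dom d" "lf d y u \<in> cell c x" for d y u
    using open_meets_cell[OF op that] cell_disjoint[of c d x y] c x that by simp
  show "c \<in> range ZFace"
  proof (cases c)
    case ZVertex
    then show ?thesis using *[of ZHor x "(0, 0)"] x cell_vertex by simp
  next
    case ZHor
    obtain a where a: "a \<in> {0..1}" "lf (ZFace 0) x (a, 0) = lf ZHor x (1/2, 0)"
      using hor_bottom_point[OF k0 x N0, of "1/2"] by auto
    have "lf ZHor x (1/2, 0) \<in> cell c x" using ZHor by (auto simp: cell_def)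
    then show ?thesis using *[of "ZFace 0" x "(a, 0)"] x a k0 by auto
  next
    case (ZVert i)
    then have "lf (ZFace i) x (0, 1/2) \<in> cell c x"
      using face_left[of i x "1/2"] c x by (auto simp: cell_def)
    then show ?thesis using *[of "ZFace i" x "(0, 1/2)"] x c ZVert by auto
  qed auto
qed (use face_cell_open c x in auto)

text \<open>Uses open sets and cells alone, and is therefore preserved by automorphisms. The open
  cells are the 2-cells; \<open>\<tau>1\<close> and \<open>\<tau>2\<close> may coincide.\<close>

definition two_sided :: "'x set \<Rightarrow> bool" where
  "two_sided \<sigma> \<longleftrightarrow> (\<exists>\<tau>1\<in>C0. \<exists>\<tau>2\<in>C0. openin X \<tau>1 \<and> openin X \<tau>2 \<and> openin X (\<sigma> \<union> \<tau>1 \<union> \<tau>2))"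

lemma vert_two_sided:
  assumes i: "i < k" and x: "x \<in> V"
  shows "two_sided (cell (ZVert i) x)"
proof -
  \<comment> \<open>The square on the left is named by the preceding vertical 1-cell of the strip:
    index one lower modulo \<open>k\<close>, vertex \<open>N\<close> steps back.\<close>
  define i0 where "i0 = idx i (- 1)"
  define x0 where "x0 = sh (- int N) x"
  have i0: "i0 < k" "Suc i0 mod k = i" and x0: "x0 \<in> V" "sh (int N) x0 = x"
    using idx_Suc[of i "- 1"] i x by (simp_all add: i0_def x0_def)
  define U where "U = cell (ZVert i) x \<union> cell (ZFace i) x \<union> cell (ZFace i0) x0"
  have "openin X U"
  proof (rule openin_X_faces)
    fix l y assume l: "l < k" "y \<in> V"
    have Suc_iff: "Suc l mod k = i \<and> sh (int N) y = x \<longleftrightarrow> l = i0 \<and> y = x0"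
    proof
      assume a: "Suc l mod k = i \<and> sh (int N) y = x"
      have "idx (Suc l mod k) (- 1) = l" using l idx_1[of l] idx_idx[of l 1 "- 1"] by simp
      then show "l = i0 \<and> y = x0" using a by (auto simp: i0_def x0_def)
    qed (use i0 x0 in auto)
    have "lf (ZFace l) y (a, b) \<in> U \<longleftrightarrow> b \<in> {0<..<1} \<and> (l = i \<and> y = x \<and> a < 1 \<or> l = i0 \<and> y = x0 \<and> 0 < a)"
      if ab: "a \<in> {0..1}" "b \<in> {0..1}" for a b
    proof (cases "b \<in> {0<..<1}")
      case True
      consider "a = 0" | "a = 1" | "0 < a" "a < 1" using ab by fastforce
      then show ?thesis
      proof cases
        case 1
        have "lf (ZFace l) y (a, b) \<in> cell d z \<longleftrightarrow> ZVert l = d \<and> y = z" if "d \<in> cells" "z \<in> V" for d z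
          using face_left[of l y b] lf_mem_cell[of "ZVert l" d y z "(0, b)"] that l 1 True by simp
        then show ?thesis using 1 True i i0 x x0 by (simp add: U_def)
      next
        case 2
        have "lf (ZFace l) y (a, b) \<in> cell d z \<longleftrightarrow> ZVert (Suc l mod k) = d \<and> sh N y = z" if "d \<in> cells" "z \<in> V" for d z
          using face_right[of l y b] lf_mem_cell[of "ZVert (Suc l mod k)" d "sh N y" z "(0, b)"] that l 2 True k0 by simp
        then show ?thesis using 2 True i i0 x x0 Suc_iff by (simp add: U_def)
      next
        case 3
        have "lf (ZFace l) y (a, b) \<in> cell d z \<longleftrightarrow> ZFace l = d \<and> y = z" if "d \<in> cells" "z \<in> V" for d z
          using lf_mem_cell[of "ZFace l" d y z "(a, b)"] that l 3 True by simp
        then show ?thesis using 3 True i i0 x x0 by (auto simp: U_def)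
      qed
    next
      case False
      then have "b = 0 \<or> b = 1" using ab by auto
      then have "snd (snd (p (lf (ZFace l) y (a, b)))) = 0" using p_lf[of "ZFace l" y "(a, b)"] ab l by auto
      moreover have "snd (snd (p z)) \<noteq> 0" if "z \<in> U" for z
        using that i i0 x x0 unfolding U_def by (elim UnE) (auto simp: cell_def p_lf_open)
      ultimately show ?thesis using False by blast
    qed
    then have "{u \<in> {0..1} \<times> {0..1}. lf (ZFace l) y u \<in> U} = ({0..1} \<times> {0..1}) \<inter>
      ((if l = i \<and> y = x then {..<1} \<times> {0<..<1} else {}) \<union> (if l = i0 \<and> y = x0 then {0<..} \<times> {0<..<1} else {}))"
      by auto
    moreover have "open ((if l = i \<and> y = x then {..<1} \<times> {0<..<1} else {}) \<union>
        (if l = i0 \<and> y = x0 then {0<..} \<times> {0<..<1} else {}) :: (real \<times> real) set)"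
      by (auto intro!: open_Un open_Times)
    ultimately show "openin (top_of_set ({0..1} \<times> {0..1})) {u \<in> {0..1} \<times> {0..1}. lf (ZFace l) y u \<in> U}"
      by (simp only: openin_open_Int)
  qed (use cell_top i i0 x x0 in \<open>auto simp: U_def\<close>)
  then show ?thesis unfolding two_sided_def U_def using face_cell_open i i0 x x0
    by (intro bexI[of _ "cell (ZFace i) x"] bexI[of _ "cell (ZFace i0) x0"]) auto
qed

lemma kN: "k * N = n" and kM: "k * M = m"
  by simp_all

text \<open>Each square with the midpoint of the 1-cell on its boundary is \<open>\<tau>1\<close> or
  \<open>\<tau>2\<close>. The set \<open>?A\<close> lists the possible positions of the 1-cell,
  \<open>k * N\<close> on bottoms and \<open>k * M\<close> on tops; injectivity of \<open>g\<close>
  says that they belong to different squares.\<close>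

lemma hor_not_two_sided:
  assumes x: "x \<in> V" and mn: "m \<noteq> n"
  shows "\<not> two_sided (cell ZHor x)"
proof
  assume "two_sided (cell ZHor x)"
  then obtain \<tau>1 \<tau>2 where \<tau>: "\<tau>1 \<in> C0" "\<tau>2 \<in> C0" "openin X (cell ZHor x \<union> \<tau>1 \<union> \<tau>2)"
    unfolding two_sided_def by blast
  have "lf ZHor x (1/2, 0) \<in> cell ZHor x" by (auto simp: cell_def)
  then have adj: "cell (ZFace i) y \<in> {\<tau>1, \<tau>2}"
    if "i < k" "y \<in> V" "u \<in> {0..1} \<times> {0..1}" "lf (ZFace i) y u = lf ZHor x (1/2, 0)" for i y u
  proof -
    have "(cell ZHor x \<union> \<tau>1 \<union> \<tau>2) \<inter> cell (ZFace i) y \<noteq> {}"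
      using open_meets_cell[OF \<tau>(3), of "ZFace i" y u] that \<open>lf ZHor x (1/2, 0) \<in> cell ZHor x\<close> by simp
    moreover have "cell ZHor x \<inter> cell (ZFace i) y = {}"
      using cell_disjoint[of ZHor "ZFace i" x y] that x by auto
    moreover have "\<tau> = cell (ZFace i) y" if "\<tau> \<in> C0" "\<tau> \<inter> cell (ZFace i) y \<noteq> {}" for \<tau>
      using that(1) by (rule C0_E) (use cell_disjoint[of _ "ZFace i" _ y] that \<open>i < k\<close> \<open>y \<in> V\<close> in auto)
    ultimately show ?thesis using \<tau>(1,2) by blast
  qed
  \<comment> \<open>The corner of the square of index \<open>i\<close> whose top carries the 1-cell
    at position \<open>j\<close>.\<close>
  define dn where "dn i j = inv_into V (up i) (sh (- int j) x)" for i j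
  have dn: "dn i j \<in> V" "up i (dn i j) = sh (- int j) x" if "i < k" for i j
    using up_bij[OF that] x that unfolding dn_def bij_betw_def
    by (auto intro!: inv_into_into f_inv_into_f)
  define g where "g = case_sum (\<lambda>(i, j). cell (ZFace i) (sh (- int j) x)) (\<lambda>(i, j). cell (ZFace i) (dn i j))"
  let ?A = "({..<k} \<times> {..<N}) <+> ({..<k} \<times> {..<M})"
  have "g ` ?A \<subseteq> {\<tau>1, \<tau>2}"
  proof (intro image_subsetI)
    fix a assume a: "a \<in> ?A"
    show "g a \<in> {\<tau>1, \<tau>2}"
    proof (cases a)
      case (Inl q)
      then obtain i j where q: "a = Inl (i, j)" "i < k" "j < N" using a by (cases q) auto
      obtain b where "b \<in> {0..1}" "lf (ZFace i) (sh (- int j) x) (b, 0) = lf ZHor x (1/2, 0)"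
        using hor_bottom_point[OF q(2) x q(3), of "1/2"] by auto
      then show ?thesis using adj[of i "sh (- int j) x" "(b, 0)"] q x by (simp add: g_def)
    next
      case (Inr q)
      then obtain i j where q: "a = Inr (i, j)" "i < k" "j < M" using a by (cases q) auto
      obtain b where "b \<in> {0..1}" "lf (ZFace i) (dn i j) (b, 1) = lf ZHor x (1/2, 0)"
        using hor_top_point[OF q(2) dn[OF q(2)] q(3), of "1/2"] by auto
      then show ?thesis using adj[of i "dn i j" "(b, 1)"] q dn(1)[of i j] by (simp add: g_def)
    qed
  qed
  then have "card (g ` ?A) \<le> card {\<tau>1, \<tau>2}" by (intro card_mono) auto
  also have "\<dots> \<le> 2" by (simp add: card_insert_if)
  finally have "card (g ` ?A) \<le> 2" .
  moreover have "inj_on g ?A"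
  proof (rule inj_onI)
    fix a b assume ab: "a \<in> ?A" "b \<in> ?A" "g a = g b"
    \<comment> \<open>Equality would put the 1-cell on both the bottom and the top of one square,
      whose lower and upper lines would then coincide, against \<open>up_not_sh\<close>.\<close>
    have shne: "sh (- int j) x \<noteq> dn i l" if "i < k" for i j l
    proof
      assume e: "sh (- int j) x = dn i l"
      have "up i (dn i l) = sh (- int l) x" using dn[OF that] by simp
      also have "x = sh (int j) (dn i l)" using e by (metis sh_inv(1))
      finally have "up i (dn i l) = sh (- int l + int j) (dn i l)" by (simp only: sh_add)
      then show False using up_not_sh[OF dn(1)[OF that] that] by blast
    qed
    have sh_eq: "j = l" if "sh (- int j) x = sh (- int l) x" for j l
      using sh_inj[OF x that] by simp
    have dn_eq: "j = l" if "dn i j = dn i l" "i < k" for i j l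
      using sh_eq[of j l] dn(2)[OF that(2), of j] dn(2)[OF that(2), of l] that(1) by simp
    show "a = b"
    proof (cases a; cases b)
      fix q r assume q: "a = Inl q" "b = Inl r"
      obtain i j i' l where ij: "q = (i, j)" "r = (i', l)" by (cases q, cases r) auto
      then have "i < k" "i' < k" using ab q by auto
      then have "i = i'" "sh (- int j) x = sh (- int l) x"
        using ab(3) q ij x cell_eq_iff[of "ZFace i" "ZFace i'"] by (auto simp: g_def)
      then show ?thesis using q ij sh_eq by simp
    next
      fix q r assume q: "a = Inl q" "b = Inr r"
      obtain i j i' l where ij: "q = (i, j)" "r = (i', l)" by (cases q, cases r) auto
      then have "i < k" "i' < k" using ab q by auto
      then show ?thesis
        using ab(3) q ij x cell_eq_iff[of "ZFace i" "ZFace i'" "sh (- int j) x" "dn i' l"] dn(1) shne by (auto simp: g_def)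
    next
      fix q r assume q: "a = Inr q" "b = Inl r"
      obtain i j i' l where ij: "q = (i, j)" "r = (i', l)" by (cases q, cases r) auto
      then have "i < k" "i' < k" using ab q by auto
      then show ?thesis
        using ab(3) q ij x cell_eq_iff[of "ZFace i" "ZFace i'" "dn i j" "sh (- int l) x"] dn(1) shne[of i l j] by (auto simp: g_def)
    next
      fix q r assume q: "a = Inr q" "b = Inr r"
      obtain i j i' l where ij: "q = (i, j)" "r = (i', l)" by (cases q, cases r) auto
      then have i: "i < k" "i' < k" using ab q by auto
      then have "i = i'" "dn i j = dn i' l"
        using ab(3) q ij x cell_eq_iff[of "ZFace i" "ZFace i'" "dn i j" "dn i' l"] dn(1) by (auto simp: g_def)
      then show ?thesis using q ij dn_eq i by simp
    qed
  qed
  then have "card (g ` ?A) = card ?A" by (rule card_image)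
  moreover have "card ?A = k * N + k * M" by (simp add: card_Plus card_cartesian_product)
  ultimately have "n + m \<le> 2" using kN kM by simp
  then show False using m n mn by linarith
qed

section \<open>Automorphisms acting on cells, lines and strips\<close>

lemma homeoD:
  assumes "f \<in> \<Gamma>"
  shows "inj_on f (topspace X)" "f ` topspace X = topspace X" "openin X U \<Longrightarrow> openin X (f ` U)"
    "A \<subseteq> topspace X \<Longrightarrow> X closure_of (f ` A) = f ` (X closure_of A)"
    "connectedin X A \<Longrightarrow> connectedin X (f ` A)"
proof -
  have h: "homeomorphic_map X X f" and b: "bij_betw f (topspace X) (topspace X)"
    using cell_homeosD[OF assms] by auto
  show "inj_on f (topspace X)" "f ` topspace X = topspace X" using b by (auto simp: bij_betw_def)
  show "openin X U \<Longrightarrow> openin X (f ` U)"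
    using homeomorphic_map_openness[OF h, of U] openin_subset[of X U] by blast
  show "A \<subseteq> topspace X \<Longrightarrow> X closure_of (f ` A) = f ` (X closure_of A)"
    using homeomorphic_map_closure_of[OF h, of A] by simp
  show "connectedin X A \<Longrightarrow> connectedin X (f ` A)"
    using connectedin_continuous_map_image homeomorphic_imp_continuous_map[OF h] by blast
qed

lemma homeo_inverse:
  assumes "f \<in> \<Gamma>"
  obtains f' where "f' \<in> \<Gamma>" "\<And>A. A \<subseteq> topspace X \<Longrightarrow> f' ` (f ` A) = A" "\<And>A. A \<subseteq> topspace X \<Longrightarrow> f ` (f' ` A) = A"
proof -
  let ?f' = "restrict (inv_into (topspace X) f) (topspace X)"
  have inv: "?f' ` (f ` A) = A" if "A \<subseteq> topspace X" for A
    using cell_homeos_inverse(2)[OF C0_sub(1) assms that] .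
  have mem: "?f' \<in> \<Gamma>" by (rule cell_homeos_inverse(1)[OF C0_sub(1) assms])
  have "f ` (?f' ` A) = A" if A: "A \<subseteq> topspace X" for A
  proof -
    have "\<exists>B\<subseteq>topspace X. A = f ` B" using A homeoD(2)[OF assms] by (metis subset_imageE)
    then show ?thesis using inv by metis
  qed
  with that inv mem show thesis by blast
qed

lemma homeo_two_sided: "f \<in> \<Gamma> \<Longrightarrow> two_sided \<sigma> \<Longrightarrow> two_sided (f ` \<sigma>)"
  unfolding two_sided_def using cell_homeosD(3) homeoD(3) by (metis (no_types, opaque_lifting) image_Un)

text \<open>Automorphisms may change the index of a vertical 1-cell or a 2-cell, so the index is
  replaced by 0.\<close>

fun kind :: "zcell \<Rightarrow> zcell" where
  "kind (ZVert i) = ZVert 0" | "kind (ZFace i) = ZFace 0" | "kind c = c"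

lemma cell_kind:
  assumes "c \<in> cells" "x \<in> V" "m \<noteq> n"
  shows "kind c = (if \<exists>z. cell c x = {z} then ZVertex else if openin X (cell c x) then ZFace 0
    else if two_sided (cell c x) then ZVert 0 else ZHor)"
  unfolding cell_singleton_iff[OF assms(1,2)] cell_open_iff[OF assms(1,2)]
proof (cases c)
  case (ZVert i)
  then have "two_sided (cell c x)" using vert_two_sided assms by simp
  then show "kind c = (if c = ZVertex then ZVertex else if c \<in> range ZFace then ZFace 0
    else if two_sided (cell c x) then ZVert 0 else ZHor)" using ZVert by auto
qed (use hor_not_two_sided[OF assms(2,3)] in auto)

lemma homeo_kind:
  assumes f: "f \<in> \<Gamma>" and c: "c \<in> cells" "x \<in> V" and d: "d \<in> cells" "y \<in> V" and eq: "f ` cell c x = cell d y" and mn: "m \<noteq> n"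
  shows "kind c = kind d"
proof -
  obtain f' where f': "f' \<in> \<Gamma>" "\<And>A. A \<subseteq> topspace X \<Longrightarrow> f' ` (f ` A) = A" using homeo_inverse[OF f] by metis
  have eq': "f' ` cell d y = cell c x" using f'(2)[OF cell_top[OF c]] eq by simp
  have "(\<exists>z. cell c x = {z}) \<longleftrightarrow> (\<exists>z. cell d y = {z})"
    using eq eq' by (metis image_empty image_insert)
  moreover have "openin X (cell c x) \<longleftrightarrow> openin X (cell d y)"
    using homeoD(3)[OF f, of "cell c x"] homeoD(3)[OF f'(1), of "cell d y"] eq eq' by auto
  moreover have "two_sided (cell c x) \<longleftrightarrow> two_sided (cell d y)"
    using homeo_two_sided[OF f, of "cell c x"] homeo_two_sided[OF f'(1), of "cell d y"] eq eq' by auto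
  ultimately show ?thesis unfolding cell_kind[OF c mn] cell_kind[OF d mn] by simp
qed

lemma homeo_cell:
  assumes f: "f \<in> \<Gamma>" and c: "c \<in> cells" "x \<in> V" and mn: "m \<noteq> n"
  obtains d y where "d \<in> cells" "y \<in> V" "f ` cell c x = cell d y" "kind c = kind d"
    "f ` (lf c x ` closed_dom c) = lf d y ` closed_dom d"
proof -
  obtain d y where d: "d \<in> cells" "y \<in> V" "f ` cell c x = cell d y"
    using cell_homeosD(3)[OF f cell_C0[OF c]] C0_E by metis
  moreover have "kind c = kind d" by (rule homeo_kind[OF f c d mn])
  moreover have "f ` (lf c x ` closed_dom c) = lf d y ` closed_dom d"
    using homeoD(4)[OF f cell_top[OF c]] lf_closed_image[OF c] lf_closed_image[OF d(1,2)] d(3) by simp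
  ultimately show thesis using that by blast
qed

lemma kind_eq [simp]: "kind c = ZVertex \<longleftrightarrow> c = ZVertex" "kind c = ZHor \<longleftrightarrow> c = ZHor"
  "ZVertex = kind c \<longleftrightarrow> c = ZVertex" "ZHor = kind c \<longleftrightarrow> c = ZHor"
  by (cases c; auto)+

lemma homeo_V:
  assumes f: "f \<in> \<Gamma>" and x: "x \<in> V" and mn: "m \<noteq> n"
  shows "f x \<in> V"
proof -
  obtain d y where "d \<in> cells" "y \<in> V" "f ` cell ZVertex x = cell d y" "kind ZVertex = kind d"
    using homeo_cell[OF f in_cells(1) x mn] by metis
  then show ?thesis using cell_vertex x by simp
qed

lemma homeo_hor:
  assumes f: "f \<in> \<Gamma>" and x: "x \<in> V" and mn: "m \<noteq> n"
  obtains y where "y \<in> V" "f ` cell ZHor x = cell ZHor y"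
    "f ` (lf ZHor x ` closed_dom ZHor) = lf ZHor y ` closed_dom ZHor"
  using homeo_cell[OF f in_cells(2) x mn] by (metis kind_eq(2) kind.simps(4))

lemma homeo_vert:
  assumes f: "f \<in> \<Gamma>" and x: "x \<in> V" and i: "i < k" and mn: "m \<noteq> n"
  obtains i' y where "i' < k" "y \<in> V" "f ` cell (ZVert i) x = cell (ZVert i') y"
    "f ` (lf (ZVert i) x ` closed_dom (ZVert i)) = lf (ZVert i') y ` closed_dom (ZVert i')"
proof -
  obtain d y where d: "d \<in> cells" "y \<in> V" "f ` cell (ZVert i) x = cell d y" "kind (ZVert i) = kind d"
    "f ` (lf (ZVert i) x ` closed_dom (ZVert i)) = lf d y ` closed_dom d"
    using homeo_cell[OF f in_cells(3)[THEN iffD2, OF i] x mn] by metis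
  then obtain i' where "d = ZVert i'" by (cases d) auto
  with d show thesis using that by auto
qed

lemma homeo_face:
  assumes f: "f \<in> \<Gamma>" and x: "x \<in> V" and i: "i < k" and mn: "m \<noteq> n"
  obtains i' y where "i' < k" "y \<in> V" "f ` cell (ZFace i) x = cell (ZFace i') y"
    "f ` (lf (ZFace i) x ` closed_dom (ZFace i)) = lf (ZFace i') y ` closed_dom (ZFace i')"
proof -
  obtain d y where d: "d \<in> cells" "y \<in> V" "f ` cell (ZFace i) x = cell d y" "kind (ZFace i) = kind d"
    "f ` (lf (ZFace i) x ` closed_dom (ZFace i)) = lf d y ` closed_dom d"
    using homeo_cell[OF f in_cells(4)[THEN iffD2, OF i] x mn] by metis
  then obtain i' where "d = ZFace i'" by (cases d) auto
  with d show thesis using that by auto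
qed

text \<open>The ends of a 1-cell are what its closure adds to the open cell, and homeomorphisms
  respect closures. The result is an equality of sets because the cell may be reversed.\<close>

lemma homeo_ends:
  assumes f: "f \<in> \<Gamma>" and c: "c \<in> cells" "x \<in> V" and d: "d \<in> cells" "y \<in> V" and eq: "f ` cell c x = cell d y"
    and E: "closed_dom c = open_dom c \<union> E" "closed_dom d = open_dom d \<union> E'" 
    and EV: "lf c x ` E \<subseteq> V" "lf d y ` E' \<subseteq> V" and nv: "c \<noteq> ZVertex" "d \<noteq> ZVertex"
  shows "f ` (lf c x ` E) = lf d y ` E'"
proof -
  have dis: "cell c x \<inter> V = {}" if "c \<in> cells" "x \<in> V" "c \<noteq> ZVertex" for c x
  proof (rule ccontr)
    assume "cell c x \<inter> V \<noteq> {}"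
    then obtain y where "y \<in> V" "y \<in> cell c x" by blast
    then show False using cell_disjoint[of c ZVertex x y] cell_vertex[of y] that by simp
  qed
  have cl: "lf c x ` closed_dom c = cell c x \<union> lf c x ` E" "lf d y ` closed_dom d = cell d y \<union> lf d y ` E'"
    unfolding E cell_def by auto
  have "f ` (lf c x ` E) = f ` (lf c x ` closed_dom c - cell c x)"
    using dis[OF c nv(1)] EV(1) cl by (intro arg_cong[of _ _ "image f"]) blast
  also have "\<dots> = f ` (lf c x ` closed_dom c) - f ` cell c x"
    using homeoD(1)[OF f] lf_top[OF c] cell_top[OF c] by (intro inj_on_image_set_diff) auto
  also have "f ` (lf c x ` closed_dom c) = lf d y ` closed_dom d"
    using homeoD(4)[OF f cell_top[OF c]] lf_closed_image[OF c] lf_closed_image[OF d] eq by simp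
  also have "lf d y ` closed_dom d - f ` cell c x = lf d y ` E'"
    using dis[OF d nv(2)] EV(2) cl eq by blast
  finally show ?thesis .
qed

lemma homeo_vert_ends:
  assumes "f \<in> \<Gamma>" "x \<in> V" "i < k" "y \<in> V" "i' < k" "f ` cell (ZVert i) x = cell (ZVert i') y"
  shows "{f x, f (up i x)} = {y, up i' y}"
proof -
  have cl: "closed_dom (ZVert j) = open_dom (ZVert j) \<union> {(0, 0), (0, 1)}" for j by auto
  have "f ` (lf (ZVert i) x ` {(0, 0), (0, 1)}) = lf (ZVert i') y ` {(0, 0), (0, 1)}"
    by (rule homeo_ends[OF _ _ _ _ _ _ cl cl]) (use assms in auto)
  then show ?thesis using assms by simp
qed

lemma homeo_hor_ends:
  assumes "f \<in> \<Gamma>" "x \<in> V" "y \<in> V" "f ` cell ZHor x = cell ZHor y"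
  shows "{f x, f (sh 1 x)} = {y, sh 1 y}"
proof -
  have cl: "closed_dom ZHor = open_dom ZHor \<union> {(0, 0), (1, 0)}" by auto
  have "f ` (lf ZHor x ` {(0, 0), (1, 0)}) = lf ZHor y ` {(0, 0), (1, 0)}"
    by (rule homeo_ends[OF _ _ _ _ _ _ cl cl]) (use assms in auto)
  then show ?thesis using assms by simp
qed

lemma homeo_H_subset:
  assumes f: "f \<in> \<Gamma>" and mn: "m \<noteq> n"
  shows "f ` H \<subseteq> H"
proof -
  have "f ` (lf ZHor x ` closed_dom ZHor) \<subseteq> H" if "x \<in> V" for x
    using homeo_hor[OF f that mn] by (metis H_eq UN_upper)
  moreover have "f ` H = (\<Union>x\<in>V. f ` (lf ZHor x ` closed_dom ZHor))" by (simp only: H_eq image_UN)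
  ultimately show ?thesis by blast
qed

lemma homeo_H:
  assumes f: "f \<in> \<Gamma>" and mn: "m \<noteq> n"
  shows "f ` H = H"
proof -
  obtain f' where f': "f' \<in> \<Gamma>" "\<And>A. A \<subseteq> topspace X \<Longrightarrow> f ` (f' ` A) = A" using homeo_inverse[OF f] by metis
  have "H = f ` (f' ` H)" using f'(2)[OF H_top] by simp
  also have "\<dots> \<subseteq> f ` H" using homeo_H_subset[OF f'(1) mn] by blast
  finally show ?thesis using homeo_H_subset[OF f mn] by blast
qed

lemma homeo_off_H:
  assumes f: "f \<in> \<Gamma>" and mn: "m \<noteq> n" and A: "A \<subseteq> topspace X"
  shows "f ` (A - H) = f ` A - H"
  using inj_on_image_set_diff[OF homeoD(1)[OF f], of A H] homeo_H[OF f mn] A H_top by auto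

lemma connected_in_hline:
  assumes "connectedin X A" "A \<subseteq> H" "x \<in> V" "A \<inter> hline x \<noteq> {}"
  shows "A \<subseteq> hline x"
proof (rule connected_components_of_maximal)
  show "hline x \<in> connected_components_of (subtopology X H)"
    using branching_lines_eq assms(3) unfolding branching_lines_def by blast
qed (use assms in \<open>auto simp: connectedin_subtopology disjnt_def\<close>)

lemma connected_in_sp:
  assumes "connectedin X A" "A \<inter> H = {}" "i < k" "x \<in> V" "A \<inter> sp i x \<noteq> {}"
  shows "A \<subseteq> sp i x"
proof (rule connected_components_of_maximal)
  show "sp i x \<in> connected_components_of (subtopology X (topspace X - H))"
    using components_off_H assms(3,4) by blast
  show "connectedin (subtopology X (topspace X - H)) A"
    using assms(1,2) connectedin_subset_topspace[OF assms(1)] by (auto simp: connectedin_subtopology)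
qed (use assms in \<open>auto simp: disjnt_def\<close>)

text \<open>Connectedness keeps the image of a line inside one line; the inverse automorphism gives
  the other inclusion.\<close>

lemma homeo_hline:
  assumes f: "f \<in> \<Gamma>" and mn: "m \<noteq> n" and x: "x \<in> V"
  shows "f ` hline x = hline (f x)"
proof -
  have *: "f ` hline x \<subseteq> hline (f x)" if "f \<in> \<Gamma>" "x \<in> V" for f x
  proof (rule connected_in_hline)
    show "f ` hline x \<subseteq> H" using homeo_H_subset[OF that(1) mn] hline_subset_H[OF that(2)] by blast
    show "f ` hline x \<inter> hline (f x) \<noteq> {}"
      using hline_refl that homeo_V[OF that mn] by blast
  qed (use that homeo_V[OF that mn] homeoD(5) hline_connected in auto)
  obtain f' where f': "f' \<in> \<Gamma>" "\<And>A. A \<subseteq> topspace X \<Longrightarrow> f ` (f' ` A) = A" "\<And>A. A \<subseteq> topspace X \<Longrightarrow> f' ` (f ` A) = A"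
    using homeo_inverse[OF f] by metis
  have fx: "f x \<in> V" by (rule homeo_V[OF f x mn])
  have "f' (f x) = x" using f'(3)[of "{x}"] V_top[OF x] by simp
  then have "f' ` hline (f x) \<subseteq> hline x" using *[OF f'(1) fx] by simp
  then have "f ` (f' ` hline (f x)) \<subseteq> f ` hline x" by blast
  moreover have "f ` (f' ` hline (f x)) = hline (f x)"
    using hline_subset_H[OF fx] H_top by (intro f'(2)) blast
  ultimately show ?thesis using *[OF f x] by blast
qed

lemma vert_cell_sp: "i < k \<Longrightarrow> x \<in> V \<Longrightarrow> cell (ZVert i) x \<subseteq> sp i x"
  using vert_in_sp[of i x _ i x] by (auto simp: cell_def)

lemma homeo_sp:
  assumes f: "f \<in> \<Gamma>" and mn: "m \<noteq> n" and x: "x \<in> V" "i < k" and y: "y \<in> V" "i' < k"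
    and eq: "f ` cell (ZVert i) x = cell (ZVert i') y"
  shows "f ` sp i x = sp i' y"
proof -
  have *: "f ` sp i x \<subseteq> sp i' y"
    if "f \<in> \<Gamma>" "i < k" "x \<in> V" "i' < k" "y \<in> V" "f ` cell (ZVert i) x = cell (ZVert i') y" for f i x i' y
  proof (rule connected_in_sp)
    have "f ` (sp i x - H) = f ` sp i x - H" by (rule homeo_off_H[OF that(1) mn sp_top])
    moreover have "sp i x - H = sp i x" using sp_disjoint_H by blast
    ultimately show "f ` sp i x \<inter> H = {}" by auto
    show "f ` sp i x \<inter> sp i' y \<noteq> {}"
      using vert_cell_sp[OF that(2,3)] vert_cell_sp[OF that(4,5)] that(6) cell_nonempty[of "ZVert i'" y] by blast
  qed (use that homeoD(5) sp_connected in auto)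
  obtain f' where f': "f' \<in> \<Gamma>" "\<And>A. A \<subseteq> topspace X \<Longrightarrow> f ` (f' ` A) = A" "\<And>A. A \<subseteq> topspace X \<Longrightarrow> f' ` (f ` A) = A"
    using homeo_inverse[OF f] by metis
  have "f' ` cell (ZVert i') y = cell (ZVert i) x" using f'(3)[of "cell (ZVert i) x"] cell_top x eq by simp
  then have "f' ` sp i' y \<subseteq> sp i x" using *[OF f'(1) y(2,1) x(2,1)] by simp
  then have "f ` (f' ` sp i' y) \<subseteq> f ` sp i x" by blast
  moreover have "f ` (f' ` sp i' y) = sp i' y" by (rule f'(2)[OF sp_top])
  ultimately show ?thesis using *[OF f x(2,1) y(2,1) eq] by blast
qed

lemma homeo_strip:
  assumes f: "f \<in> \<Gamma>" and mn: "m \<noteq> n" and x: "x \<in> V" "i < k" 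
  obtains i' y where "i' < k" "y \<in> V" "f ` sp i x = sp i' y" "f ` strip i x = strip i' y" "{f x, f (up i x)} = {y, up i' y}"
proof -
  obtain i' y where y: "i' < k" "y \<in> V" "f ` cell (ZVert i) x = cell (ZVert i') y"
    using homeo_vert[OF f x mn] by metis
  have sp: "f ` sp i x = sp i' y" by (rule homeo_sp[OF f mn x y(2,1,3)])
  moreover have "f ` strip i x = strip i' y" using homeoD(4)[OF f sp_top, of i x] sp by (simp add: strip_def)
  moreover have "{f x, f (up i x)} = {y, up i' y}" using homeo_vert_ends[OF f x y(2,1,3)] .
  ultimately show thesis using that y by blast
qed

section \<open>Automorphisms fixing all lines and all open strips\<close>

context
  fixes h
  assumes h: "h \<in> \<Gamma>" and mn: "m \<noteq> n" and lines: "\<And>x. x \<in> V \<Longrightarrow> h ` hline x = hline x"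
    and sps: "\<And>i x. i < k \<Longrightarrow> x \<in> V \<Longrightarrow> h ` sp i x = sp i x"
begin

lemma fix_orb: "x \<in> V \<Longrightarrow> h x \<in> orb x"
  using lines[of x] hline_refl[of x] vertex_in_hline[of x "h x"] homeo_V[OF h _ mn] by blast

lemma fix_vert:
  assumes i: "i < k" and x: "x \<in> V"
  shows "\<exists>j. h x = sh (j * int N) x \<and> h (up i x) = sh (j * int M) (up i x) \<and>
    h ` cell (ZVert i) x = cell (ZVert (idx i j)) (sh (j * int N) x)"
proof -
  obtain i' y where y: "i' < k" "y \<in> V" "h ` cell (ZVert i) x = cell (ZVert i') y"
    using homeo_vert[OF h x i mn] by metis
  have "cell (ZVert i') y \<subseteq> sp i x" using vert_cell_sp[OF i x] sps[OF i x] y(3) by blast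
  then have "lf (ZVert i') y (0, 1/2) \<in> sp i x" by (auto simp: cell_def)
  then have "same_strip i x i' y" using vert_in_sp[of i' y "1/2"] y by simp
  then obtain j where j: "i' = idx i j" "y = sh (j * int N) x" by (auto simp: same_strip_def)
  have u: "up i' y = sh (j * int M) (up i x)" unfolding j by (rule up_sh[OF i x])
  have ends: "{h x, h (up i x)} = {y, up i' y}" by (rule homeo_vert_ends[OF h x i y(2,1,3)])
  \<comment> \<open>The vertical 1-cell is not turned over: \<open>h x\<close> stays on the line of
    \<open>x\<close>, whereas \<open>up i' y\<close> is on the line of
    \<open>up i x\<close>.\<close>
  have "h x \<noteq> up i' y"
  proof
    assume "h x = up i' y"
    then have "up i x \<in> orb x" using fix_orb[OF x] u by simp
    then show False using up_not_sh[OF x i] by (auto simp: orb_def)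
  qed
  then have "h x = y" "h (up i x) = up i' y" using ends by (auto simp: doubleton_eq_iff)
  then have "h x = sh (j * int N) x" "h (up i x) = sh (j * int M) (up i x)" using j(2) u by simp_all
  moreover have "h ` cell (ZVert i) x = cell (ZVert (idx i j)) (sh (j * int N) x)" using y(3) j by simp
  ultimately show ?thesis by blast
qed

lemma MN: "M \<noteq> N"
  using kN kM mn by metis

lemma fix_vertex: 
  assumes "x \<in> V"
  shows "h x = x"
proof -
  have "d = 0" if "x \<in> V" "h x = sh d x" for x d
    using that
  \<comment> \<open>Every vertex has a vertical 1-cell of index 0 above it and, as
    \<open>up 0\<close> is onto, one below it; the smaller of \<open>M\<close> and \<open>N\<close>
    decides which one to follow.\<close>
  proof (induction "nat \<bar>d\<bar>" arbitrary: x d rule: less_induct)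
    case less
    show ?case
    proof (cases "M < N")
      case True
      obtain j where j: "h x = sh (j * int N) x" "h (up 0 x) = sh (j * int M) (up 0 x)"
        using fix_vert[OF k0 less.prems(1)] by blast
      have d: "d = j * int N" using sh_inj[OF less.prems(1)] j(1) less.prems(2) by simp
      show ?thesis
      proof (rule ccontr)
        assume "d \<noteq> 0"
        then have "\<bar>j\<bar> > 0" using d by auto
        then have "\<bar>j\<bar> * int M < \<bar>j\<bar> * int N" using True by (intro mult_strict_left_mono) auto
        then have "nat \<bar>j * int M\<bar> < nat \<bar>d\<bar>"
          using \<open>\<bar>j\<bar> > 0\<close> N0 M0 by (simp add: d abs_mult)
        then have "j * int M = 0" using less.hyps[of "j * int M" "up 0 x"] j(2) less.prems(1) k0 by simp
        then show False using \<open>\<bar>j\<bar> > 0\<close> M0 by auto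
      qed
    next
      case False
      then have NM: "N < M" using MN by simp
      obtain y where y: "y \<in> V" "up 0 y = x" using up_bij[OF k0] less.prems(1) by (metis bij_betw_def imageE)
      obtain j where j: "h y = sh (j * int N) y" "h x = sh (j * int M) x"
        using fix_vert[OF k0 y(1)] y(2) by blast
      have d: "d = j * int M" using sh_inj[OF less.prems(1)] j(2) less.prems(2) by simp
      show ?thesis
      proof (rule ccontr)
        assume "d \<noteq> 0"
        then have "\<bar>j\<bar> > 0" using d by auto
        then have "\<bar>j\<bar> * int N < \<bar>j\<bar> * int M" using NM by (intro mult_strict_left_mono) auto
        then have "nat \<bar>j * int N\<bar> < nat \<bar>d\<bar>"
          using \<open>\<bar>j\<bar> > 0\<close> N0 M0 by (simp add: d abs_mult)
        then have "j * int N = 0" using less.hyps[of "j * int N" y] j(1) y(1) by simp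
        then show False using \<open>\<bar>j\<bar> > 0\<close> N0 by auto
      qed
    qed
  qed
  moreover obtain d where "h x = sh d x" using fix_orb[OF assms] by (auto simp: orb_def)
  ultimately show ?thesis using assms by force
qed

text \<open>The shift \<open>j\<close> of the cell within its strip is also read off from its lower
  end, where it is 0.\<close>

lemma fix_cell_vert:
  assumes "i < k" "x \<in> V"
  shows "h ` cell (ZVert i) x = cell (ZVert i) x"
proof -
  obtain j where j: "h x = sh (j * int N) x" "h ` cell (ZVert i) x = cell (ZVert (idx i j)) (sh (j * int N) x)"
    using fix_vert[OF assms] by blast
  have "sh (j * int N) x = sh 0 x" using j(1) fix_vertex[OF assms(2)] by simp
  then have "j * int N = 0" by (rule sh_inj[OF assms(2)])
  then have "j = 0" using N0 by simp
  then show ?thesis using j(2) assms by simp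
qed

lemma fix_cell_hor:
  assumes x: "x \<in> V"
  shows "h ` cell ZHor x = cell ZHor x"
proof -
  obtain y where y: "y \<in> V" "h ` cell ZHor x = cell ZHor y" using homeo_hor[OF h x mn] by metis
  have "{x, sh 1 x} = {y, sh 1 y}"
    using homeo_hor_ends[OF h x y] fix_vertex x by simp
  \<comment> \<open>This excludes that the two ends are exchanged, for then \<open>y\<close> would
    be both the successor and the predecessor of \<open>x\<close>.\<close>
  moreover have "sh 1 (sh 1 x) \<noteq> x"
  proof
    assume "sh 1 (sh 1 x) = x"
    then have "sh (1 + 1) x = sh 0 x" unfolding sh_add by simp
    then show False using sh_inj[OF x] by fastforce
  qed
  ultimately have "x = y" by (auto simp: doubleton_eq_iff)
  then show ?thesis using y by simp
qed

text \<open>Only points on the left and right sides of a closed square project into an open vertical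
  1-cell.\<close>

lemma vert_in_face:
  assumes i: "i < k" "x \<in> V" and l: "l < k" "y \<in> V" and sub: "cell (ZVert l) y \<subseteq> lf (ZFace i) x ` closed_dom (ZFace i)"
  shows "y = x \<and> l = i \<or> y = sh (int N) x"
proof -
  have "lf (ZVert l) y (0, 1/2) \<in> cell (ZVert l) y" by (auto simp: cell_def)
  with sub have "lf (ZVert l) y (0, 1/2) \<in> lf (ZFace i) x ` closed_dom (ZFace i)" by (rule subsetD)
  then obtain a b where ab: "a \<in> {0..1}" "b \<in> {0..1}" "lf (ZVert l) y (0, 1/2) = lf (ZFace i) x (a, b)"
    by auto
  have "zchar m n (ZFace i) (a, b) = (ZVert l, 0, 1/2)"
    using p_lf[of "ZFace i" x "(a, b)"] p_lf_open[of "ZVert l" y "(0, 1/2)"] ab i l by simp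
  then have "(a = 0 \<or> a = 1) \<and> 0 < b \<and> b < 1"
    using ab(1,2) by (auto simp: a_path_def t_path_def split: if_splits)
  then show ?thesis
  proof (elim conjE disjE)
    assume b: "0 < b" "b < 1" and "a = 0"
    then show ?thesis using face_left[of i x b] ab(3) lf_eq_cell[of "ZVert l" y "(0, 1/2)" "ZVert i" x "(0, b)"] i l by simp
  next
    assume b: "0 < b" "b < 1" and "a = 1"
    then show ?thesis using face_right[of i x b] ab(3) k0
        lf_eq_cell[of "ZVert l" y "(0, 1/2)" "ZVert (Suc i mod k)" "sh N x" "(0, b)"] i l by simp
  qed
qed

text \<open>The image square contains both vertical sides of the original one, which are fixed. If
  it were a different square, the left side of the original would be its right side, and the right
  side of the original, \<open>N\<close> steps further along, could not belong to it by
  \<open>sh_inj\<close>.\<close>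

lemma fix_cell_face:
  assumes i: "i < k" and x: "x \<in> V"
  shows "h ` cell (ZFace i) x = cell (ZFace i) x"
proof -
  obtain i' y where y: "i' < k" "y \<in> V" "h ` cell (ZFace i) x = cell (ZFace i') y"
    "h ` (lf (ZFace i) x ` closed_dom (ZFace i)) = lf (ZFace i') y ` closed_dom (ZFace i')"
    using homeo_face[OF h x i mn] by metis
  have l: "cell (ZVert i) x \<subseteq> lf (ZFace i) x ` closed_dom (ZFace i)"
  proof
    fix z assume "z \<in> cell (ZVert i) x"
    then obtain t where t: "0 < t" "t < 1" "z = lf (ZVert i) x (0, t)" by (auto simp: cell_def)
    then have "z = lf (ZFace i) x (0, t)" using face_left[OF i x, of t] by simp
    then show "z \<in> lf (ZFace i) x ` closed_dom (ZFace i)" using t by auto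
  qed
  have r: "cell (ZVert (Suc i mod k)) (sh N x) \<subseteq> lf (ZFace i) x ` closed_dom (ZFace i)"
  proof
    fix z assume "z \<in> cell (ZVert (Suc i mod k)) (sh N x)"
    then obtain t where t: "0 < t" "t < 1" "z = lf (ZVert (Suc i mod k)) (sh N x) (0, t)" by (auto simp: cell_def)
    then have "z = lf (ZFace i) x (1, t)" using face_right[OF i x, of t] by simp
    then show "z \<in> lf (ZFace i) x ` closed_dom (ZFace i)" using t by auto
  qed
  have ik: "Suc i mod k < k" using k0 by simp
  have 1: "x = y \<and> i = i' \<or> x = sh (int N) y"
    using image_mono[OF l, of h] fix_cell_vert[OF i x] y by (intro vert_in_face[OF y(1,2) i x]) simp
  have 2: "sh (int N) x = y \<or> sh (int N) x = sh (int N) y"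
    using vert_in_face[OF y(1,2) ik, of "sh N x"] image_mono[OF r, of h] fix_cell_vert[OF ik, of "sh N x"] x y by auto
  have ne: "x \<noteq> sh (int j) x" if "j > 0" for j
    using sh_inj[OF x, of 0 "int j"] that by auto
  show ?thesis
  proof (cases "x = y \<and> i = i'")
    case False
    then have x1: "x = sh (int N) y" using 1 by blast
    from 2 show ?thesis
    proof
      assume "sh (int N) x = y"
      then have "sh (int N + int N) x = sh 0 x" unfolding sh_add using x1 by simp
      then show ?thesis using sh_inj[OF x] N0 by fastforce
    next
      assume "sh (int N) x = sh (int N) y"
      then have "x = sh (int N) x" using x1 by simp
      then show ?thesis using ne[of N] N0 by simp
    qed
  qed (use y(3) in simp)
qed

lemma fix_all:
  assumes "\<sigma> \<in> C0"
  shows "h ` \<sigma> = \<sigma>"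
proof -
  obtain c x where c: "c \<in> cells" "x \<in> V" "\<sigma> = cell c x" using assms by (rule C0_E)
  show ?thesis
    by (cases c) (use c fix_vertex fix_cell_hor fix_cell_vert fix_cell_face cell_vertex in auto)
qed

end

section \<open>The action on the tree\<close>

abbreviation "lines \<equiv> branching_lines m n X p"
abbreviation "strps \<equiv> strips m n X p"
abbreviation "low \<equiv> lower_line m n X p"
abbreviation "upp \<equiv> upper_line m n X p"
abbreviation "T \<equiv> T_complex m n X p"
abbreviation "TC \<equiv> tcells m n X p"
abbreviation "TP \<equiv> \<Union>(T_cells m n X p)"
abbreviation "tch \<equiv> tchar m n X p"

lemma low_upp_lines: "S \<in> strps \<Longrightarrow> low S \<in> lines \<and> upp S \<in> lines"
  by (auto simp: strips_eq lower_line_strip upper_line_strip branching_lines_eq)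

lemma TC_cases:
  assumes "c \<in> TC"
  obtains L where "L \<in> lines" "c = TVertex L" | S where "S \<in> strps" "c = TEdge S"
  using assms by (auto simp: tcells_def)

lemma in_TC [simp]: "TVertex L \<in> TC \<longleftrightarrow> L \<in> lines" "TEdge S \<in> TC \<longleftrightarrow> S \<in> strps"
  by (auto simp: tcells_def)

lemma in_TP: "(c, r) \<in> TP \<longleftrightarrow> c \<in> TC \<and> r \<in> topen_dom c"
  by (auto simp: T_cells_def topen_cell_def)

lemma tch_TP: "c \<in> TC \<Longrightarrow> r \<in> tclosed_dom c \<Longrightarrow> tch c r \<in> TP"
  by (cases c) (auto simp: in_TP low_upp_lines simp del: Union_iff)

lemma topspace_T: "topspace T = TP"
  unfolding T_complex_def by (rule topspace_weak_topology) (rule tch_TP)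

lemma lines_top: "L \<in> lines \<Longrightarrow> L \<subseteq> H"
  using hline_subset_H by (auto simp: branching_lines_eq)

lemma strips_top: "S \<in> strps \<Longrightarrow> S \<subseteq> topspace X"
  using subsetD[OF closure_of_subset_topspace] by (auto simp: strips_eq strip_def)

section \<open>Preimages of the cells of the tree\<close>

definition pre :: "'x tpoint set \<Rightarrow> 'x set" where
  "pre c = {x \<in> topspace X. tree_proj m n X p x \<in> c}"

lemma pre_vertex:
  assumes "L \<in> lines"
  shows "pre (topen_cell (TVertex L)) = L"
proof -
  have the_line: "(THE L. L \<in> lines \<and> x \<in> L) = L" if "L \<in> lines" "x \<in> L" for L x
    using that hline_disjoint by (intro the_equality) (auto simp: branching_lines_eq)
  have ex_line: "\<exists>L\<in>lines. x \<in> L" if "x \<in> H" for x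
    using that orb_refl by (force simp: branching_lines_eq H_eq hline_def)
  show ?thesis
  proof (intro equalityI subsetI)
    fix x assume "x \<in> pre (topen_cell (TVertex L))"
    then have "x \<in> H" "(THE L. L \<in> lines \<and> x \<in> L) = L"
      by (auto simp: pre_def topen_cell_def tree_proj_def split: if_splits)
    then show "x \<in> L" using ex_line[of x] the_line by metis
  next
    fix x assume "x \<in> L"
    then show "x \<in> pre (topen_cell (TVertex L))"
      using the_line[OF assms] lines_top[OF assms] H_top by (auto simp: pre_def topen_cell_def tree_proj_def)
  qed
qed

text \<open>Off \<open>H\<close> closed strips are disjoint, which makes the strip in
  \<open>tree_proj\<close> unique, and the height is strictly between 0 and 1.\<close>

lemma pre_edge:
  assumes "S \<in> strps"
  shows "pre (topen_cell (TEdge S)) = S - H"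
proof -
  have the_strip: "(THE S. S \<in> strps \<and> x \<in> S) = S" if S: "S \<in> strps" "x \<in> S" "x \<notin> H" for S x
  proof (rule the_equality)
    fix S' assume S': "S' \<in> strps \<and> x \<in> S'"
    obtain i y where y: "i < k" "y \<in> V" "S = strip i y" using S(1) by (auto simp: strips_eq)
    obtain i' z where z: "i' < k" "z \<in> V" "S' = strip i' z" using S' by (auto simp: strips_eq)
    have "x \<in> sp i y" "x \<in> sp i' z"
      using strip_off_H[OF y(1,2)] strip_off_H[OF z(1,2)] S S' y(3) z(3) by blast+
    then have "sp i y = sp i' z" using sp_disjoint[OF y(1,2) z(1,2)] sp_eq[OF y(1)] by blast
    then show "S' = S" using y z by (simp add: strip_def)
  qed (use S in simp)
  have ex_strip: "\<exists>S\<in>strps. x \<in> S" if x: "x \<in> topspace X - H" for x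
  proof -
    obtain i y where y: "i < k" "y \<in> V" "\<And>i' z. x \<in> sp i' z \<longleftrightarrow> same_strip i' z i y" by (rule sp_point[OF x]) blast
    then have "x \<in> strip i y" using strip_off_H[OF y(1,2)] by auto
    then show ?thesis using y(1,2) by (auto simp: strips_eq)
  qed
  have height: "0 < snd (snd (p x)) \<and> snd (snd (p x)) < 1" if x: "x \<in> topspace X - H" for x
  proof -
    obtain i y u where y: "i < k" "y \<in> V"
      "(u \<in> open_dom (ZFace i) \<and> x = lf (ZFace i) y u) \<or> (u \<in> open_dom (ZVert i) \<and> x = lf (ZVert i) y u)"
      by (rule sp_point[OF x]) blast
    then show ?thesis using p_lf_open[of "ZFace i" y u] p_lf_open[of "ZVert i" y u] by auto
  qed
  show ?thesis
  proof (intro equalityI subsetI)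
    fix x assume "x \<in> pre (topen_cell (TEdge S))"
    then have x: "x \<in> topspace X - H" "(THE S. S \<in> strps \<and> x \<in> S) = S"
      by (auto simp: pre_def topen_cell_def tree_proj_def split: if_splits)
    then show "x \<in> S - H" using ex_strip[OF x(1)] the_strip by (metis DiffD2 DiffI)
  next
    fix x assume x: "x \<in> S - H"
    then have "x \<in> topspace X - H" using strips_top[OF assms] by blast
    then show "x \<in> pre (topen_cell (TEdge S))"
      using height the_strip[OF assms] x by (auto simp: pre_def topen_cell_def tree_proj_def)
  qed
qed

text \<open>Edges are reversed where necessary, so that no argument is needed to show that \<open>f\<close> preserves the
  direction.\<close>

fun tcell_map :: "('x \<Rightarrow> 'x) \<Rightarrow> 'x tcell \<Rightarrow> 'x tcell" where
  "tcell_map f (TVertex L) = TVertex (f ` L)"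
| "tcell_map f (TEdge S) = TEdge (f ` S)"

fun flip :: "('x \<Rightarrow> 'x) \<Rightarrow> 'x tcell \<Rightarrow> real \<Rightarrow> real" where
  "flip f (TVertex L) r = r"
| "flip f (TEdge S) r = (if low (f ` S) = f ` low S then r else 1 - r)"

definition tmap :: "('x \<Rightarrow> 'x) \<Rightarrow> 'x tpoint \<Rightarrow> 'x tpoint" where
  "tmap f = (\<lambda>(c, r). (tcell_map f c, flip f c r))"

lemma flip_dom: "r \<in> tclosed_dom c \<Longrightarrow> flip f c r \<in> tclosed_dom (tcell_map f c)"
  "r \<in> topen_dom c \<Longrightarrow> flip f c r \<in> topen_dom (tcell_map f c)"
  by (cases c; auto)+

lemma homeo_lines:
  assumes f: "f \<in> \<Gamma>" and mn: "m \<noteq> n" and L: "L \<in> lines"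
  shows "f ` L \<in> lines"
  using L homeo_hline[OF f mn] homeo_V[OF f _ mn] by (auto simp: branching_lines_eq)

lemma homeo_strips:
  assumes f: "f \<in> \<Gamma>" and mn: "m \<noteq> n" and S: "S \<in> strps"
  shows "f ` S \<in> strps"
    and "(low (f ` S) = f ` low S \<and> upp (f ` S) = f ` upp S) \<or> (low (f ` S) = f ` upp S \<and> upp (f ` S) = f ` low S)"
proof -
  obtain i x where x: "i < k" "x \<in> V" "S = strip i x" using S by (auto simp: strips_eq)
  obtain i' y where y: "i' < k" "y \<in> V" "f ` strip i x = strip i' y" "{f x, f (up i x)} = {y, up i' y}"
    using homeo_strip[OF f mn x(2,1)] by metis
  show "f ` S \<in> strps" using x y by (auto simp: strips_eq)
  have "f ` hline x = hline (f x)" "f ` hline (up i x) = hline (f (up i x))"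
    using homeo_hline[OF f mn] x by auto
  then show "(low (f ` S) = f ` low S \<and> upp (f ` S) = f ` upp S) \<or> (low (f ` S) = f ` upp S \<and> upp (f ` S) = f ` low S)"
    using y(4) unfolding x(3) y(3) lower_line_strip[OF x(1,2)] upper_line_strip[OF x(1,2)]
      lower_line_strip[OF y(1,2)] upper_line_strip[OF y(1,2)] by (auto simp: doubleton_eq_iff)
qed

lemma tcell_map_TC:
  assumes "f \<in> \<Gamma>" "m \<noteq> n" "c \<in> TC"
  shows "tcell_map f c \<in> TC"
  using assms(3) by (rule TC_cases) (use homeo_lines[OF assms(1,2)] homeo_strips(1)[OF assms(1,2)] in auto)

lemma tmap_TP: 
  assumes "f \<in> \<Gamma>" "m \<noteq> n" "z \<in> TP"
  shows "tmap f z \<in> TP"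
  using assms(3) tcell_map_TC[OF assms(1,2)] flip_dom(2)
  by (cases z) (auto simp: in_TP tmap_def simp del: Union_iff)

text \<open>Compatibility with the attaching maps, from which continuity follows. If
  \<open>f\<close> does not respect the lower ends, it exchanges the two ends by
  \<open>homeo_strips\<close>, and the reversal \<open>1 - r\<close> matches this.\<close>

lemma tmap_tch:
  assumes f: "f \<in> \<Gamma>" "m \<noteq> n" and c: "c \<in> TC" "r \<in> tclosed_dom c"
  shows "tmap f (tch c r) = tch (tcell_map f c) (flip f c r)"
  using c(1)
proof (rule TC_cases)
  fix S assume S: "S \<in> strps" "c = TEdge S"
  show ?thesis using homeo_strips(2)[OF f S(1)] S by (auto simp: tmap_def)
qed (auto simp: tmap_def)

lemma tmap_continuous:
  assumes f: "f \<in> \<Gamma>" "m \<noteq> n"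
  shows "continuous_map T T (tmap f)"
proof -
  have "continuous_map (weak_topology TP TC tclosed_dom tch) T (tmap f)"
  proof (subst continuous_map_weak_topology[OF tch_TP], assumption, assumption, intro conjI ballI)
    show "tmap f \<in> TP \<rightarrow> topspace T" using tmap_TP[OF f] topspace_T by auto
    fix c assume c: "c \<in> TC"
    have "continuous_on (tclosed_dom c) (flip f c)"
    proof (cases c)
      case (TEdge S)
      then have "flip f c = (if low (f ` S) = f ` low S then (\<lambda>r. r) else (\<lambda>r. 1 - r))"
        by (auto simp: fun_eq_iff)
      then show ?thesis by (auto intro!: continuous_intros)
    qed simp
    then have "continuous_map (top_of_set (tclosed_dom c)) (top_of_set (tclosed_dom (tcell_map f c))) (flip f c)"
      using flip_dom(1) by auto
    moreover have "continuous_map (top_of_set (tclosed_dom (tcell_map f c))) T (tch (tcell_map f c))"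
      unfolding T_complex_def by (rule continuous_map_characteristic[OF tch_TP tcell_map_TC[OF f c]])
    ultimately have "continuous_map (top_of_set (tclosed_dom c)) T (tch (tcell_map f c) \<circ> flip f c)"
      by (rule continuous_map_compose)
    then show "continuous_map (top_of_set (tclosed_dom c)) T (\<lambda>r. tmap f (tch c r))"
      by (rule continuous_map_eq) (use tmap_tch[OF f c] in simp)
  qed
  then show ?thesis by (simp only: T_complex_def)
qed

lemma tcell_map_inverse:
  assumes inv: "\<And>A. A \<subseteq> topspace X \<Longrightarrow> f' ` (f ` A) = A" and c: "c \<in> TC"
  shows "tcell_map f' (tcell_map f c) = c"
  using c
proof (rule TC_cases)
  fix L assume L: "L \<in> lines" "c = TVertex L"
  then have "L \<subseteq> topspace X" using lines_top H_top by blast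
  then show ?thesis using L inv by simp
qed (use inv strips_top in simp)

lemma tmap_inverse:
  assumes f: "f \<in> \<Gamma>" "m \<noteq> n" and f': "f' \<in> \<Gamma>"
    and inv: "\<And>A. A \<subseteq> topspace X \<Longrightarrow> f' ` (f ` A) = A" "\<And>A. A \<subseteq> topspace X \<Longrightarrow> f ` (f' ` A) = A"
    and z: "z \<in> TP"
  shows "tmap f' (tmap f z) = z"
proof -
  obtain c r where zc: "z = (c, r)" by (cases z)
  then have c: "c \<in> TC" using z by (simp only: in_TP)
  have "flip f' (tcell_map f c) (flip f c r) = r"
    using c
  proof (rule TC_cases)
    fix S assume S: "S \<in> strps" "c = TEdge S"
    have S1: "f' ` (f ` S) = S" using inv(1) strips_top[OF S(1)] by blast
    have lS: "low S \<subseteq> topspace X" and lfS: "low (f ` S) \<subseteq> topspace X"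
      using low_upp_lines[OF S(1)] low_upp_lines[OF homeo_strips(1)[OF f S(1)]] lines_top H_top by blast+
    \<comment> \<open>\<open>f'\<close> reverses the image strip exactly if \<open>f\<close>
      reverses \<open>S\<close>, so the two reversals cancel.\<close>
    have "low S = f' ` low (f ` S) \<longleftrightarrow> low (f ` S) = f ` low S"
      using inv(1)[OF lS] inv(2)[OF lfS] by metis
    then show ?thesis using S S1 by simp
  qed simp
  then show ?thesis using tcell_map_inverse[OF inv(1) c] by (simp add: zc tmap_def)
qed

lemma flip_image: "flip f c ` topen_dom c = topen_dom (tcell_map f c)"
proof (cases c)
  case (TEdge S)
  have "(\<lambda>r. 1 - r) ` {0<..<1} = {0<..<1::real}"
  proof (intro equalityI subsetI)
    fix r :: real assume "r \<in> {0<..<1}"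
    then show "r \<in> (\<lambda>r. 1 - r) ` {0<..<1}" by (intro image_eqI[of _ _ "1 - r"]) auto
  qed auto
  then show ?thesis using TEdge by auto
qed auto

lemma tmap_cell: "tmap f ` topen_cell c = topen_cell (tcell_map f c)"
  unfolding topen_cell_def flip_image[of f c, symmetric] by (auto simp: tmap_def)

lemma tree_automorphism:
  assumes f: "f \<in> \<Gamma>" and mn: "m \<noteq> n"
  shows "\<exists>g\<in>cell_homeos T (T_cells m n X p). \<forall>d\<in>T_cells m n X p. f ` pre d = pre (g ` d)"
proof -
  obtain f' where f': "f' \<in> \<Gamma>" "\<And>A. A \<subseteq> topspace X \<Longrightarrow> f' ` (f ` A) = A" "\<And>A. A \<subseteq> topspace X \<Longrightarrow> f ` (f' ` A) = A"
    using homeo_inverse[OF f] by metis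
  define g where "g = restrict (tmap f) (topspace T)"
  have maps: "homeomorphic_maps T T (tmap f) (tmap f')"
    unfolding homeomorphic_maps_def
    using tmap_continuous[OF f mn] tmap_continuous[OF f'(1) mn]
      tmap_inverse[OF f mn f'(1) f'(2,3)] tmap_inverse[OF f'(1) mn f f'(3,2)]
    by (simp add: topspace_T del: Union_iff)
  then have "homeomorphic_map T T (tmap f)" using homeomorphic_map_maps by blast
  then have hg: "homeomorphic_map T T g" by (rule homeomorphic_map_eq) (simp add: g_def)
  then have "g \<in> Bij (topspace T)"
    using homeomorphic_imp_injective_map[OF hg] homeomorphic_imp_surjective_map[OF hg]
    by (simp add: Bij_def bij_betw_def) (simp add: g_def)
  have gc: "g ` topen_cell c = topen_cell (tcell_map f c)" if "c \<in> TC" for c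
  proof -
    have "topen_cell c \<subseteq> topspace T" using that by (auto simp: topspace_T T_cells_def)
    then have "g ` topen_cell c = tmap f ` topen_cell c" by (intro image_cong refl) (auto simp: g_def)
    then show ?thesis by (simp add: tmap_cell)
  qed
  have "(\<lambda>\<sigma>. g ` \<sigma>) ` T_cells m n X p = T_cells m n X p"
  proof -
    have "(\<lambda>\<sigma>. g ` \<sigma>) ` T_cells m n X p = topen_cell ` tcell_map f ` TC"
      unfolding T_cells_def image_image using gc by (intro image_cong refl) simp
    also have "tcell_map f ` TC = TC"
    proof (intro equalityI subsetI)
      fix c assume "c \<in> TC"
      then show "c \<in> tcell_map f ` TC"
        using tcell_map_inverse[OF f'(3)] tcell_map_TC[OF f'(1) mn] by (metis image_eqI)
    qed (use tcell_map_TC[OF f mn] in auto)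
    finally show ?thesis by (simp add: T_cells_def)
  qed
  with hg \<open>g \<in> Bij (topspace T)\<close> have g: "g \<in> cell_homeos T (T_cells m n X p)"
    by (simp add: cell_homeos_def)
  have "f ` pre d = pre (g ` d)" if d: "d \<in> T_cells m n X p" for d
  proof -
    obtain c where c: "c \<in> TC" "d = topen_cell c" using d by (auto simp: T_cells_def)
    from c(1) show ?thesis
    proof (rule TC_cases)
      fix L assume "L \<in> lines" "c = TVertex L"
      then show ?thesis using gc[OF c(1)] homeo_lines[OF f mn] by (simp add: c(2) pre_vertex)
    next
      fix S assume S: "S \<in> strps" "c = TEdge S"
      then show ?thesis using gc[OF c(1)] homeo_strips(1)[OF f mn S(1)] homeo_off_H[OF f mn strips_top[OF S(1)]]
        by (simp add: c(2) pre_edge)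
    qed
  qed
  with g show ?thesis by blast
qed

section \<open>Verifying the hypotheses of \<open>Aut_induced_map\<close>\<close>

text \<open>If \<open>G\<close> ignores the position inside the open cell, each cell is contained in
  the set or disjoint from it; \<open>(0, 0)\<close> is an arbitrary argument.\<close>

lemma cellset_cells:
  assumes "\<And>c x u v. G c x u \<longleftrightarrow> G c x v"
  shows "\<exists>A\<subseteq>C0. cellset G = \<Union>A"
proof (intro exI conjI)
  let ?A = "{cell c x | c x. c \<in> cells \<and> x \<in> V \<and> G c x (0, 0)}"
  show "?A \<subseteq> C0" by auto
  show "cellset G = \<Union>?A"
  proof (intro equalityI subsetI)
    fix z assume "z \<in> cellset G"
    then obtain c x u where "c \<in> cells" "x \<in> V" "u \<in> open_dom c" "G c x u" "z = lf c x u" by (auto simp: cellset_def)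
    then show "z \<in> \<Union>?A" using assms[of c x u "(0, 0)"] by (auto simp: cell_def)
  next
    fix z assume "z \<in> \<Union>?A"
    then obtain c x u where "c \<in> cells" "x \<in> V" "u \<in> open_dom c" "G c x (0, 0)" "z = lf c x u" by (auto simp: cell_def)
    then show "z \<in> cellset G" using assms[of c x u "(0, 0)"] by (simp add: mem_cellset)
  qed
qed

lemma pre_cells:
  assumes "d \<in> T_cells m n X p"
  shows "\<exists>A\<subseteq>C0. A \<noteq> {} \<and> pre d = \<Union>A"
proof -
  obtain c where c: "c \<in> TC" "d = topen_cell c" using assms by (auto simp: T_cells_def)
  have "pre d \<noteq> {} \<and> (\<exists>A\<subseteq>C0. pre d = \<Union>A)"
    using c(1)
  proof (rule TC_cases)
    fix L assume L: "L \<in> lines" "c = TVertex L"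
    then obtain x where x: "x \<in> V" "L = hline x" by (auto simp: branching_lines_eq)
    have "pre d = hline x" using L x c(2) pre_vertex by simp
    moreover have "\<exists>A\<subseteq>C0. hline x = \<Union>A" unfolding hline_cellset[OF x(1)] by (rule cellset_cells) simp
    ultimately show ?thesis using hline_refl[OF x(1)] by auto
  next
    fix S assume S: "S \<in> strps" "c = TEdge S"
    then obtain i x where x: "i < k" "x \<in> V" "S = strip i x" by (auto simp: strips_eq)
    have "pre d = sp i x" using S x c(2) pre_edge strip_off_H[OF x(1,2)] by simp
    moreover have "\<exists>A\<subseteq>C0. sp i x = \<Union>A" unfolding sp_def by (rule cellset_cells) simp
    ultimately show ?thesis using sp_nonempty[OF x(1,2)] by simp
  qed
  then show ?thesis by blast
qed

lemma pre_disjoint: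
  assumes "d \<in> T_cells m n X p" "d' \<in> T_cells m n X p" "pre d \<inter> pre d' \<noteq> {}"
  shows "d = d'"
proof -
  obtain c c' where c: "d = topen_cell c" "d' = topen_cell c'" using assms by (auto simp: T_cells_def)
  obtain x where "tree_proj m n X p x \<in> d" "tree_proj m n X p x \<in> d'" using assms(3) by (auto simp: pre_def)
  then show ?thesis using c by (auto simp: topen_cell_def)
qed

text \<open>\<open>Aut_induced_map\<close> asks for a cell of the tree; a vertex of the cover
  provides a branching line.\<close>

lemma V_nonempty: "V \<noteq> {}"
proof -
  have "(ZVertex, 0, 0) \<in> Z_points m n" using a_path_in_Z[of 0 m n] by simp
  moreover have "p ` topspace X = Z_points m n"
    using cov topspace_Z_complex[OF m, of n] by (simp only: covering_map_def)
  ultimately have "(ZVertex, 0, 0) \<in> p ` topspace X" by (simp only:)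
  then show ?thesis unfolding V_def by fastforce
qed

lemma pi_star_pre: "pi_star m n X p =
    (\<lambda>F. {g \<in> cell_homeos T (T_cells m n X p). \<exists>f\<in>F. \<forall>d\<in>T_cells m n X p. f ` pre d = pre (g ` d)})"
  by (simp add: fun_eq_iff pi_star_def pre_def)

lemma pi_star_properties:
  assumes mn: "m \<noteq> n"
  shows "pi_star m n X p \<in> hom (Aut_X m n X p) (Aut_T m n X p)
    \<and> continuous_map (Aut_topology X (X_cells m n X p))
        (Aut_topology (T_complex m n X p) (T_cells m n X p)) (pi_star m n X p)
    \<and> inj_on (pi_star m n X p) (carrier (Aut_X m n X p))"
proof -
  have TC: "T_cells m n X p \<subseteq> Pow (topspace T)" unfolding topspace_T by blast
  have ne: "T_cells m n X p \<noteq> {}" using V_nonempty by (auto simp: T_cells_def tcells_def branching_lines_eq)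
  note induced = Aut_induced_map[OF C0_sub TC ne pre_cells pre_disjoint tree_automorphism[OF _ mn], folded pi_star_pre]
  \<comment> \<open>The criterion for injectivity: fixing the preimages of all cells of the tree
    means fixing all lines and all open strips.\<close>
  have "f ` \<sigma> = \<sigma>" if f: "f \<in> \<Gamma>" and fix_pre: "\<And>d. d \<in> T_cells m n X p \<Longrightarrow> f ` pre d = pre d" and \<sigma>: "\<sigma> \<in> C0" for f \<sigma>
  proof (rule fix_all[OF f mn _ _ \<sigma>])
    fix x assume "x \<in> V"
    then have "hline x \<in> lines" by (auto simp: branching_lines_eq)
    then show "f ` hline x = hline x"
      using fix_pre[of "topen_cell (TVertex (hline x))"] pre_vertex by (simp add: T_cells_def)
  next
    fix i x assume x: "i < k" "x \<in> V"
    then have S: "strip i x \<in> strps" by (auto simp: strips_eq)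
    then show "f ` sp i x = sp i x"
      using fix_pre[of "topen_cell (TEdge (strip i x))"] pre_edge[OF S] strip_off_H[OF x] by (simp add: T_cells_def)
  qed
  then show ?thesis using induced by blast
qed

end

theorem corollary4p2:
  fixes m n :: nat and X :: "'x topology" and p :: "'x \<Rightarrow> zpoint"
  assumes "m > 0" and "n > 0" and "m \<noteq> n"
    and "universal_covering X p (Z_complex m n)"
  shows "pi_star m n X p \<in> hom (Aut_X m n X p) (Aut_T m n X p)
    \<and> continuous_map (Aut_topology X (X_cells m n X p))
        (Aut_topology (T_complex m n X p) (T_cells m n X p)) (pi_star m n X p)
    \<and> inj_on (pi_star m n X p) (carrier (Aut_X m n X p))"
proof -
  interpret z_cover m n X p
    using assms by unfold_locales
  show ?thesis by (rule pi_star_properties[OF assms(3)])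
qed

end
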